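(* Let $R:=\mathbb C[x_1,x_2,\dots,x_6]/(x_2^2-x_1x_3,\;x_5^2-x_4x_6)$ with its standard grading, and let $X:=\mathrm{Proj}(R)\subseteq\mathbb P^5$ be the associated projective variety over $\mathbb C$. Then $X$ is not isomorphic to a weighted projective space.
   Context: A weighted projective space is $\mathbb P(a_0,\dots,a_n)=\mathrm{Proj}\,\mathbb C[z_0,\dots,z_n]$ with $\deg z_i=a_i$ for positive integers $a_0,\dots,a_n$. Isomorphism means isomorphism of abstract varieties over $\mathbb C$. *)

theory Defs
  imports
    "HOL-Analysis.Analysis"
    "HOL-Library.Poly_Mapping"
    "HOL-Algebra.Module"
    "HOL-Algebra.QuotRing"
begin

text \<open>
  Varieties over \<open>\<complex>\<close> are treated as schemes over \<open>\<complex>\<close>: topological spaces with a sheaf of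
  \<open>\<complex>\<close>-algebras. Algebras are records of type \<^typ>\<open>(complex, 'a) module\<close>, as in the locale
  \<open>algebra\<close> of HOL-Algebra. Following Hartshorne II.2, \<open>Proj\<close> is built from homogeneous primes.
\<close>

record 'a graded_algebra = "(complex, 'a) module" +
  grade :: "nat \<Rightarrow> 'a set"

definition homog :: "'a graded_algebra \<Rightarrow> 'a set" where
  "homog S = (\<Union>d. grade S d)"


section \<open>Weighted polynomial algebras and their quotients\<close>

type_synonym cpoly = "(nat \<Rightarrow>\<^sub>0 nat) \<Rightarrow>\<^sub>0 complex"

definition Var :: "nat \<Rightarrow> cpoly" where
  "Var i = Poly_Mapping.single (Poly_Mapping.single i 1) 1"

definition poly_carrier :: "nat set \<Rightarrow> cpoly set" where
  "poly_carrier I = {p. \<forall>m \<in> Poly_Mapping.keys p. Poly_Mapping.keys m \<subseteq> I}"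

text \<open>The index set \<open>I\<close> of the variables is meant to be finite.\<close>

definition poly_algebra :: "nat set \<Rightarrow> (nat \<Rightarrow> nat) \<Rightarrow> cpoly graded_algebra" where
  "poly_algebra I a =
    \<lparr>carrier = poly_carrier I, mult = (*), one = 1, ring.zero = 0, add = (+),
     smult = (\<lambda>c p. Poly_Mapping.single 0 c * p),
     grade = (\<lambda>d. {p \<in> poly_carrier I. \<forall>m \<in> Poly_Mapping.keys p.
                       (\<Sum>i\<in>I. a i * Poly_Mapping.lookup m i) = d})\<rparr>"

definition quotient_algebra :: "'a graded_algebra \<Rightarrow> 'a set \<Rightarrow> 'a set graded_algebra" where
  "quotient_algebra S J =
    \<lparr>carrier = carrier (S Quot J), mult = mult (S Quot J), one = one (S Quot J),
     ring.zero = ring.zero (S Quot J), add = add (S Quot J),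
     smult = (\<lambda>c A. \<Union>x\<in>A. J +>\<^bsub>S\<^esub> (c \<odot>\<^bsub>S\<^esub> x)),
     grade = (\<lambda>d. (\<lambda>x. J +>\<^bsub>S\<^esub> x) ` grade S d)\<rparr>"


section \<open>Proj of a graded algebra\<close>

definition irrelevant_ideal :: "'a graded_algebra \<Rightarrow> 'a set" where
  "irrelevant_ideal S = genideal S (\<Union>d\<in>{1..}. grade S d)"

definition homogeneous_ideal :: "'a graded_algebra \<Rightarrow> 'a set \<Rightarrow> bool" where
  "homogeneous_ideal S J \<longleftrightarrow> ideal J S \<and> J = genideal S (J \<inter> homog S)"

definition proj_points :: "'a graded_algebra \<Rightarrow> 'a set set" where
  "proj_points S =
    {p. primeideal p S \<and> homogeneous_ideal S p \<and> \<not> irrelevant_ideal S \<subseteq> p}"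

text \<open>The sets \<open>D\<^sub>+(f)\<close>, for \<open>f\<close> homogeneous, form a base of the Zariski topology.\<close>

definition proj_topology :: "'a graded_algebra \<Rightarrow> 'a set topology" where
  "proj_topology S = topology_generated_by {{p \<in> proj_points S. f \<notin> p} | f. f \<in> homog S}"

text \<open>
  The degree-zero part \<open>S\<^sub>(\<^sub>p\<^sub>)\<close> of the localization of \<open>S\<close> at the homogeneous elements outside
  \<open>p\<close>. A fraction is the class of all pairs (numerator, denominator) representing it.
\<close>

definition hfrac :: "'a graded_algebra \<Rightarrow> 'a set \<Rightarrow> 'a \<Rightarrow> 'a \<Rightarrow> ('a \<times> 'a) set" where
  "hfrac S p a f = {(b, g). \<exists>d. b \<in> grade S d \<and> g \<in> grade S d \<and> g \<notin> p \<and>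
     (\<exists>h \<in> homog S - p. h \<otimes>\<^bsub>S\<^esub> (a \<otimes>\<^bsub>S\<^esub> g \<ominus>\<^bsub>S\<^esub> b \<otimes>\<^bsub>S\<^esub> f) = \<zero>\<^bsub>S\<^esub>)}"

definition homog_localization ::
    "'a graded_algebra \<Rightarrow> 'a set \<Rightarrow> (complex, ('a \<times> 'a) set) module" where
  "homog_localization S p =
    \<lparr>carrier = {hfrac S p a f | a f. \<exists>d. a \<in> grade S d \<and> f \<in> grade S d \<and> f \<notin> p},
     mult = (\<lambda>A B. \<Union>(a, f)\<in>A. \<Union>(b, g)\<in>B. hfrac S p (a \<otimes>\<^bsub>S\<^esub> b) (f \<otimes>\<^bsub>S\<^esub> g)),
     one = hfrac S p \<one>\<^bsub>S\<^esub> \<one>\<^bsub>S\<^esub>,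
     ring.zero = hfrac S p \<zero>\<^bsub>S\<^esub> \<one>\<^bsub>S\<^esub>,
     add = (\<lambda>A B. \<Union>(a, f)\<in>A. \<Union>(b, g)\<in>B.
             hfrac S p (a \<otimes>\<^bsub>S\<^esub> g \<oplus>\<^bsub>S\<^esub> b \<otimes>\<^bsub>S\<^esub> f) (f \<otimes>\<^bsub>S\<^esub> g)),
     smult = (\<lambda>c A. \<Union>(a, f)\<in>A. hfrac S p (c \<odot>\<^bsub>S\<^esub> a) f)\<rparr>"

definition regular_section ::
    "'a graded_algebra \<Rightarrow> 'a set set \<Rightarrow> ('a set \<Rightarrow> ('a \<times> 'a) set) \<Rightarrow> bool" where
  "regular_section S U s \<longleftrightarrow>
    s \<in> (\<Pi>\<^sub>E p\<in>U. carrier (homog_localization S p)) \<and>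
    (\<forall>p\<in>U. \<exists>V. openin (proj_topology S) V \<and> p \<in> V \<and> V \<subseteq> U \<and>
      (\<exists>d. \<exists>a\<in>grade S d. \<exists>f\<in>grade S d. \<forall>q\<in>V. f \<notin> q \<and> s q = hfrac S q a f))"

definition proj_sections ::
    "'a graded_algebra \<Rightarrow> 'a set set \<Rightarrow> (complex, 'a set \<Rightarrow> ('a \<times> 'a) set) module" where
  "proj_sections S U =
    \<lparr>carrier = {s. regular_section S U s},
     mult = (\<lambda>s t. \<lambda>p\<in>U. s p \<otimes>\<^bsub>homog_localization S p\<^esub> t p),
     one = (\<lambda>p\<in>U. \<one>\<^bsub>homog_localization S p\<^esub>),
     ring.zero = (\<lambda>p\<in>U. \<zero>\<^bsub>homog_localization S p\<^esub>),
     add = (\<lambda>s t. \<lambda>p\<in>U. s p \<oplus>\<^bsub>homog_localization S p\<^esub> t p),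
     smult = (\<lambda>c s. \<lambda>p\<in>U. c \<odot>\<^bsub>homog_localization S p\<^esub> s p)\<rparr>"

text \<open>\<open>sections X U\<close> and \<open>restr X U V\<close> only carry meaning for open \<open>V \<subseteq> U\<close>.\<close>

record ('p, 's) ringed_space =
  space_top :: "'p topology"
  sections :: "'p set \<Rightarrow> (complex, 's) module"
  restr :: "'p set \<Rightarrow> 'p set \<Rightarrow> 's \<Rightarrow> 's"

definition Proj ::
    "'a graded_algebra \<Rightarrow> ('a set, 'a set \<Rightarrow> ('a \<times> 'a) set) ringed_space" where
  "Proj S = \<lparr>space_top = proj_topology S, sections = proj_sections S,
             restr = (\<lambda>U V s. restrict s V)\<rparr>"


section \<open>Isomorphisms over the complex numbers\<close>

definition algebra_iso ::
    "(complex, 'a) module \<Rightarrow> (complex, 'b) module \<Rightarrow> ('a \<Rightarrow> 'b) set" where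
  "algebra_iso A B =
    {h \<in> ring_iso A B. \<forall>c. \<forall>x\<in>carrier A. h (c \<odot>\<^bsub>A\<^esub> x) = c \<odot>\<^bsub>B\<^esub> h x}"

definition open_preimage ::
    "('p, 's) ringed_space \<Rightarrow> ('p \<Rightarrow> 'q) \<Rightarrow> 'q set \<Rightarrow> 'p set" where
  "open_preimage X \<phi> V = {x \<in> topspace (space_top X). \<phi> x \<in> V}"

text \<open>
  A homeomorphism \<open>\<phi>\<close> with an isomorphism \<open>\<psi>\<close> of sheaves of \<open>\<complex>\<close>-algebras from the structure
  sheaf of \<open>Y\<close> to the direct image of that of \<open>X\<close>. Ring isomorphisms between local rings are
  local, so this is also the notion of isomorphism for locally ringed spaces over \<open>\<complex>\<close>.
\<close>

definition isomorphic_over_C ::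
    "('p, 's) ringed_space \<Rightarrow> ('q, 't) ringed_space \<Rightarrow> bool" where
  "isomorphic_over_C X Y \<longleftrightarrow>
    (\<exists>\<phi> \<psi>. homeomorphic_map (space_top X) (space_top Y) \<phi> \<and>
      (\<forall>V. openin (space_top Y) V \<longrightarrow>
         \<psi> V \<in> algebra_iso (sections Y V) (sections X (open_preimage X \<phi> V))) \<and>
      (\<forall>V W. openin (space_top Y) V \<longrightarrow> openin (space_top Y) W \<longrightarrow> W \<subseteq> V \<longrightarrow>
         (\<forall>s\<in>carrier (sections Y V).
            \<psi> W (restr Y V W s) =
            restr X (open_preimage X \<phi> V) (open_preimage X \<phi> W) (\<psi> V s))))"


section \<open>Weighted projective spaces and the variety \<open>X\<close>\<close>

definition weighted_projective_space ::
    "nat \<Rightarrow> (nat \<Rightarrow> nat) \<Rightarrow> (cpoly set, cpoly set \<Rightarrow> (cpoly \<times> cpoly) set) ringed_space" where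
  "weighted_projective_space n a = Proj (poly_algebra {0..n} a)"

definition R_algebra :: "cpoly set graded_algebra" where
  "R_algebra =
    (let P = poly_algebra {1..6} (\<lambda>_. 1)
     in quotient_algebra P
          (genideal P {(Var 2)\<^sup>2 - Var 1 * Var 3, (Var 5)\<^sup>2 - Var 4 * Var 6}))"

definition X_variety ::
    "(cpoly set set, cpoly set set \<Rightarrow> (cpoly set \<times> cpoly set) set) ringed_space" where
  "X_variety = Proj R_algebra"

end

theory Submission
  imports Defs "HOL-Computational_Algebra.Polynomial"
begin

text \<open>
  The rational function \<open>h = x\<^sub>1 / x\<^sub>4\<close> on \<open>X\<close> has even multiplicity along every prime divisor, but
  it is not a square. Both facts are read through an isomorphism from a weighted projective space
  with factorial coordinate ring \<open>S\<close>. There \<open>h\<close> is a reduced fraction \<open>A / B\<close> of homogeneous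
  polynomials, and a prime factor \<open>\<pi>\<close> of \<open>A\<close> or \<open>B\<close> generates a point of \<open>Proj S\<close>, hence gives a
  point \<open>x\<close> of \<open>X\<close>.

  At \<open>x\<close> some \<open>x\<^sub>u\<close> with \<open>u \<in> {1, 3}\<close> and some \<open>x\<^sub>v\<close> with \<open>v \<in> {4, 6}\<close> are invertible. Otherwise, say,
  \<open>x\<^sub>1, x\<^sub>2, x\<^sub>3\<close> vanish at \<open>x\<close>; by \<open>x\<^sub>2\<^sup>2 = x\<^sub>1 x\<^sub>3\<close> their multiplicities along \<open>\<pi>\<close> satisfy
  \<open>2 m\<^sub>2 = m\<^sub>1 + m\<^sub>3\<close>, so \<open>x\<^sub>1 / x\<^sub>2\<close> or \<open>x\<^sub>3 / x\<^sub>2\<close> is regular at \<open>x\<close>, which the equations of \<open>X\<close>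
  rule out. Since \<open>x\<^sub>1 x\<^sub>u\<close> and \<open>x\<^sub>4 x\<^sub>v\<close> are squares, \<open>h\<close> is a square times the unit \<open>x\<^sub>u / x\<^sub>v\<close>.

  Thus \<open>A = C\<^sup>2\<close> and \<open>B = D\<^sup>2\<close>, and \<open>h\<close> is the square of a section that is regular wherever \<open>x\<^sub>4 \<noteq> 0\<close>.
  Restricted to the line \<open>x\<^sub>1 = x\<^sub>2 = x\<^sub>3, x\<^sub>4 = x\<^sub>5 = x\<^sub>6\<close> this makes \<open>x\<^sub>1 / x\<^sub>4\<close> a square in
  \<open>\<complex>(x\<^sub>1, x\<^sub>4)\<close>, which is absurd.
\<close>

text \<open>Write x_1, x_2, x_3 = s^2, st, t^2 and x_4, x_5, x_6 = u^2, uv, v^2. Then X is the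
  quotient of P^3 by the involution (s,t,u,v) -> (-s,-t,u,v), and h = (s/u)^2, where s/u is not
  invariant. So h exhibits the 2-torsion of the class group Z + Z/2 of X, while a weighted
  projective space has class group Z. Class groups are replaced by multiplicities in S, which shapes
  the proof in two ways. Multiplicities are never defined on X: they are read through the
  isomorphism, and R is not shown to be a domain or normal. That the codimension two locus x_1 = x_2
  = x_3 = 0 contains no generic point of a prime divisor is obtained without dimension theory, from
  a syzygy between x_1 and x_2. And multiplicities are those of the polynomial ring S, not of local
  rings of Proj S, so all positive weights are treated uniformly, even those for which the two
  valuations differ by a factor.\<close>

section \<open>Gauss's theorem on factorial polynomial rings\<close>

definition prime_in :: "'a::comm_ring_1 set \<Rightarrow> 'a \<Rightarrow> bool" where
  "prime_in A p \<longleftrightarrow> p \<in> A \<and> p \<noteq> 0 \<and> \<not> p dvd 1 \<and>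
     (\<forall>a\<in>A. \<forall>b\<in>A. p dvd a * b \<longrightarrow> p dvd a \<or> p dvd b)"

text \<open>Existence of a factorization is enough, since the factors are prime and not merely
  irreducible.\<close>

definition ufd_on :: "'a::comm_ring_1 set \<Rightarrow> bool" where
  "ufd_on A \<longleftrightarrow> (\<forall>a\<in>A. a \<noteq> 0 \<longrightarrow>
     (\<exists>u ps. u dvd 1 \<and> (\<forall>p\<in>set ps. prime_in A p) \<and> a = u * prod_list ps))"

definition polys_over :: "'a::comm_ring_1 set \<Rightarrow> 'a poly set" where
  "polys_over A = {q. \<forall>i. coeff q i \<in> A}"

definition primitive_over :: "'a::comm_ring_1 set \<Rightarrow> 'a poly \<Rightarrow> bool" where
  "primitive_over A q \<longleftrightarrow> (\<forall>p. prime_in A p \<longrightarrow> \<not> [:p:] dvd q)"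

text \<open>Rings are subsets of a type because \<open>cpoly\<close> has infinitely many variables
  and S only finitely many. The relation \<open>dvd\<close> is that of the whole type;
  \<open>factor_mem\<close> makes it agree with divisibility inside A for nonzero elements.\<close>

locale factor_closed_subring =
  fixes A :: "'a::idom set"
  assumes zero_mem: "0 \<in> A" and one_mem: "1 \<in> A"
    and add_mem: "a \<in> A \<Longrightarrow> b \<in> A \<Longrightarrow> a + b \<in> A"
    and uminus_mem: "a \<in> A \<Longrightarrow> - a \<in> A"
    and mult_mem: "a \<in> A \<Longrightarrow> b \<in> A \<Longrightarrow> a * b \<in> A"
    and factor_mem: "a * b \<in> A \<Longrightarrow> a * b \<noteq> 0 \<Longrightarrow> a \<in> A"
begin

lemma factor_mem2: "a * b \<in> A \<Longrightarrow> a * b \<noteq> 0 \<Longrightarrow> b \<in> A"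
  using factor_mem[of b a] by (simp add: mult.commute)

lemma dvd_mem: "a dvd b \<Longrightarrow> b \<in> A \<Longrightarrow> b \<noteq> 0 \<Longrightarrow> a \<in> A"
  using factor_mem by (auto elim!: dvdE)

lemma sum_mem: "(\<And>i. i \<in> I \<Longrightarrow> f i \<in> A) \<Longrightarrow> sum f I \<in> A"
  by (induction I rule: infinite_finite_induct) (auto intro: zero_mem add_mem)

lemma prime_in_dvd_prod_list:
  assumes "prime_in A p" "\<forall>q\<in>set ps. q \<in> A" "p dvd prod_list ps"
  shows "\<exists>q\<in>set ps. p dvd q"
  using assms(2,3)
proof (induction ps)
  case Nil then show ?case using assms(1) by (simp add: prime_in_def)
next
  case (Cons q ps)
  have "prod_list ps \<in> A" using Cons.prems(1)
    by (induction ps) (auto intro: one_mem mult_mem)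
  then have "p dvd q \<or> p dvd prod_list ps"
    using Cons.prems assms(1) by (auto simp: prime_in_def)
  then show ?case using Cons by auto
qed

text \<open>q divides p * w; if it divided w, then p would be a unit. So such p and q are
  associates.\<close>

lemma prime_in_dvd_prime_in:
  assumes p: "prime_in A p" and q: "prime_in A q" and "p dvd q"
  shows "q dvd p"
proof -
  obtain w where w: "q = p * w" using \<open>p dvd q\<close> by (elim dvdE)
  have pw: "p * w \<in> A" "p * w \<noteq> 0" using q w by (simp_all add: prime_in_def)
  have "w \<in> A" "p \<in> A" using factor_mem[OF pw] factor_mem2[OF pw] by blast+
  then have "q dvd p \<or> q dvd w" using q w unfolding prime_in_def by (metis dvd_refl)
  moreover have "\<not> q dvd w"
  proof
    assume "q dvd w"
    then obtain v where "w = q * v" by (elim dvdE)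
    then have "q * 1 = q * (p * v)" using w by (simp add: mult_ac)
    then have "p * v = 1" using q by (auto simp: prime_in_def)
    then show False using p by (auto simp: prime_in_def dest: dvdI[of 1 p v, OF sym])
  qed
  ultimately show ?thesis by blast
qed

text \<open>The exponent counts the prime factors of a associated to p; the remaining factors and
  the units form a cofactor that p does not divide.\<close>

lemma ord_exists:
  assumes "ufd_on A" "prime_in A p" "a \<in> A" "a \<noteq> 0"
  shows "\<exists>k b. a = p ^ k * b \<and> \<not> p dvd b"
proof -
  obtain u ps where u: "u dvd 1" and ps: "\<forall>q\<in>set ps. prime_in A q" and a: "a = u * prod_list ps"
    using assms by (auto simp: ufd_on_def)
  have "\<exists>k b. prod_list ps = p ^ k * b \<and> b \<in> A \<and> \<not> p dvd b"
    using ps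
  proof (induction ps)
    case Nil
    then show ?case using assms(2) one_mem by (intro exI[of _ 0] exI[of _ 1], auto simp: prime_in_def)
  next
    case (Cons q ps)
    then obtain k b where kb: "prod_list ps = p ^ k * b" "b \<in> A" "\<not> p dvd b" by auto
    have q: "prime_in A q" using Cons.prems by simp
    show ?case
    proof (cases "p dvd q")
      case True
      then obtain w where w: "q = p * w" by (elim dvdE)
      have "q dvd p" using prime_in_dvd_prime_in[OF assms(2) q True] .
      then obtain v where v: "p = q * v" by (elim dvdE)
      have "p * 1 = p * (w * v)" using v w by (simp add: mult_ac)
      then have wv: "w * v = 1" using assms(2) by (auto simp: prime_in_def)
      have w_mem: "w \<in> A" using q w factor_mem2[of p w] by (auto simp: prime_in_def)
      have "\<not> p dvd w * b"
      proof
        assume "p dvd w * b"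
        then have "p dvd v * (w * b)" by (rule dvd_mult)
        then have "p dvd b" using wv by (metis mult.assoc mult.commute mult_1)
        then show False using kb by simp
      qed
      moreover have "prod_list (q # ps) = p ^ Suc k * (w * b)" using kb w by (simp add: mult_ac)
      ultimately show ?thesis using w_mem kb mult_mem by blast
    next
      case False
      then have "\<not> p dvd q * b" using assms(2) kb q by (auto simp: prime_in_def)
      moreover have "prod_list (q # ps) = p ^ k * (q * b)" using kb by (simp add: mult_ac)
      ultimately show ?thesis using q kb mult_mem by (blast intro: prime_in_def[THEN iffD1, THEN conjunct1])
    qed
  qed
  then obtain k b where kb: "prod_list ps = p ^ k * b" "b \<in> A" "\<not> p dvd b" by auto
  obtain v where v: "u * v = 1" using u by (metis dvdE)
  have "\<not> p dvd u * b"
  proof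
    assume "p dvd u * b"
    then have "p dvd v * (u * b)" by (rule dvd_mult)
    then have "p dvd b" using v by (metis mult.assoc mult.commute mult_1)
    then show False using kb by simp
  qed
  then show ?thesis using kb a by (metis mult.left_commute)
qed

end

text \<open>In the convolution every term except the one at (i, j) has a factor divisible by d.
  Applied with d prime for Gauss's lemma and with d = 0 for lowest terms.\<close>

lemma coeff_mult_least:
  fixes p q :: "'a::comm_semiring_1 poly"
  assumes "\<And>k. k < i \<Longrightarrow> d dvd coeff p k" "\<And>k. k < j \<Longrightarrow> d dvd coeff q k"
  shows "\<exists>r. coeff (p * q) (i + j) = coeff p i * coeff q j + d * r"
proof -
  have "coeff (p * q) (i + j) = (\<Sum>k\<le>i+j. coeff p k * coeff q (i + j - k))"
    by (simp add: coeff_mult)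
  also have "\<dots> = coeff p i * coeff q j + (\<Sum>k\<in>{..i+j}-{i}. coeff p k * coeff q (i + j - k))"
    by (subst sum.remove[of _ i]) auto
  finally have "coeff (p * q) (i + j) = coeff p i * coeff q j
      + (\<Sum>k\<in>{..i+j}-{i}. coeff p k * coeff q (i + j - k))" .
  moreover have "d dvd (\<Sum>k\<in>{..i+j}-{i}. coeff p k * coeff q (i + j - k))"
  proof (rule dvd_sum)
    fix k assume "k \<in> {..i+j}-{i}"
    then consider "k < i" | "i + j - k < j" by force
    then show "d dvd coeff p k * coeff q (i + j - k)" using assms by cases auto
  qed
  ultimately show ?thesis by (auto elim!: dvdE)
qed

text \<open>Factor closure of the polynomials over A is assumed here; for
  \<open>poly_carrier\<close> it comes from a fresh variable, in
  \<open>polys_over_poly_carrier_factor\<close>.\<close>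

locale gauss_subring = factor_closed_subring A for A :: "'a::idom set" +
  assumes ufd: "ufd_on A"
    and polys_factor: "(p::'a poly) * q \<in> polys_over A \<Longrightarrow> p * q \<noteq> 0 \<Longrightarrow> p \<in> polys_over A"
begin

abbreviation "B \<equiv> polys_over A"

sublocale polys: factor_closed_subring B
proof
  show "0 \<in> B" "1 \<in> B"
    by (auto simp: polys_over_def zero_mem one_mem)
  fix a b assume "a \<in> B" "b \<in> B"
  then show "a + b \<in> B" "-a \<in> B" "a * b \<in> B"
    by (auto simp: polys_over_def coeff_mult intro: add_mem uminus_mem sum_mem mult_mem)
qed (rule polys_factor)

lemma const_mem: "a \<in> A \<Longrightarrow> [:a:] \<in> B"
  by (auto simp: polys_over_def coeff_pCons zero_mem split: nat.split)

lemma const_memD: "[:a:] \<in> B \<Longrightarrow> a \<in> A"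
  by (auto simp: polys_over_def coeff_pCons dest: spec[of _ 0])

text \<open>Gauss's lemma: the first coefficients of a and of b that p does not divide would produce
  a coefficient of a * b that p does not divide.\<close>

lemma const_prime:
  assumes p: "prime_in A p"
  shows "prime_in B [:p:]"
  unfolding prime_in_def
proof (intro conjI ballI impI)
  show "[:p:] \<in> B" using p const_mem by (auto simp: prime_in_def)
  show "[:p:] \<noteq> 0" using p by (auto simp: prime_in_def)
  show "\<not> [:p:] dvd 1" using p by (auto simp: prime_in_def const_poly_dvd_iff dest: spec[of _ 0])
  fix a b assume ab: "a \<in> B" "b \<in> B" "[:p:] dvd a * b"
  show "[:p:] dvd a \<or> [:p:] dvd b"
  proof (rule ccontr)
    assume "\<not> ?thesis"
    then have ex: "\<exists>i. \<not> p dvd coeff a i" "\<exists>i. \<not> p dvd coeff b i"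
      by (auto simp: const_poly_dvd_iff)
    define i where "i = (LEAST i. \<not> p dvd coeff a i)"
    define j where "j = (LEAST i. \<not> p dvd coeff b i)"
    have i: "\<not> p dvd coeff a i" "\<And>k. k < i \<Longrightarrow> p dvd coeff a k"
      and j: "\<not> p dvd coeff b j" "\<And>k. k < j \<Longrightarrow> p dvd coeff b k"
      unfolding i_def j_def using LeastI_ex[OF ex(1)] LeastI_ex[OF ex(2)]
      by (auto dest: not_less_Least)
    obtain r where "coeff (a * b) (i + j) = coeff a i * coeff b j + p * r"
      using coeff_mult_least[of i p a j b] i j by auto
    moreover have "p dvd coeff (a * b) (i + j)" using ab by (auto simp: const_poly_dvd_iff)
    ultimately have "p dvd coeff a i * coeff b j" by (metis dvd_add_left_iff dvd_triv_left)
    moreover have "coeff a i \<in> A" "coeff b j \<in> A" using ab by (simp_all add: polys_over_def)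
    ultimately show False using p i(1) j(1) unfolding prime_in_def by blast
  qed
qed

text \<open>Constant primes are divided out one by one. Each also divides the leading coefficient,
  whose number of prime factors therefore bounds the process; no gcd is formed.\<close>

lemma content:
  assumes "q \<in> B" "q \<noteq> 0"
  shows "\<exists>e\<in>A. \<exists>q'\<in>B. q = [:e:] * q' \<and> primitive_over A q'"
proof -
  have "\<exists>e\<in>A. \<exists>q'\<in>B. q = [:e:] * q' \<and> primitive_over A q'"
    if "u dvd 1" "\<forall>p\<in>set ps. prime_in A p" "lead_coeff q = u * prod_list ps" "q \<in> B" "q \<noteq> 0"
    for u ps q
    using that
  proof (induction "length ps" arbitrary: u ps q rule: less_induct)
    case less
    show ?case
    proof (cases "primitive_over A q")
      case True
      then show ?thesis using less.prems one_mem by (intro bexI[of _ 1] bexI[of _ q]) auto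
    next
      case False
      then obtain p where p: "prime_in A p" "[:p:] dvd q" by (auto simp: primitive_over_def)
      then obtain q1 where q1: "q = [:p:] * q1" by (elim dvdE)
      have q1B: "q1 \<in> B" "q1 \<noteq> 0" using polys.factor_mem2[of "[:p:]" q1] q1 less.prems by auto
      have lc: "lead_coeff q = p * lead_coeff q1" using q1 by (simp add: lead_coeff_mult)
      obtain v where v: "u * v = 1" using less.prems(1) by (metis dvdE)
      have "prod_list ps = v * lead_coeff q" using less.prems(3) v
        by (metis mult.assoc mult.commute mult_1)
      then have "p dvd prod_list ps" using lc by simp
      then obtain r where r: "r \<in> set ps" "p dvd r"
        using prime_in_dvd_prod_list[OF p(1), of ps] less.prems(2) by (auto simp: prime_in_def)
      have rp: "prime_in A r" using less.prems r by auto
      \<comment> \<open>p and r are associates, so r can be struck from the factor list at the cost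
        of the unit w.\<close>
      have "r dvd p" using prime_in_dvd_prime_in[OF p(1) rp r(2)] .
      then obtain t where t: "p = r * t" by (elim dvdE)
      obtain w where w: "r = p * w" using r by (elim dvdE)
      have "p * 1 = p * (w * t)" using t w by (simp add: mult_ac)
      then have wt: "w * t = 1" using p by (auto simp: prime_in_def)
      have pl: "prod_list ps = r * prod_list (remove1 r ps)"
        using r(1) by (induction ps) (auto simp: mult_ac)
      have "p * lead_coeff q1 = p * (u * w * prod_list (remove1 r ps))"
        using less.prems(3) lc pl w by (simp add: mult_ac)
      then have lc1: "lead_coeff q1 = u * w * prod_list (remove1 r ps)"
        using p(1) by (auto simp: prime_in_def)
      have "w dvd 1" using wt by (metis dvdI)
      then have unit: "u * w dvd 1" using less.prems(1) by (metis mult_1 mult_dvd_mono)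
      have "length (remove1 r ps) < length ps"
        using length_pos_if_in_set[OF r(1)] r(1) by (simp add: length_remove1)
      moreover have "\<forall>p\<in>set (remove1 r ps). prime_in A p"
        using less.prems(2) set_remove1_subset[of r ps] by blast
      ultimately obtain e q' where "e \<in> A" "q' \<in> B" "q1 = [:e:] * q'" "primitive_over A q'"
        using less.hyps[OF _ unit _ lc1 q1B] by blast
      then show ?thesis using q1 p(1) mult_mem[of p e]
        by (intro bexI[of _ "p * e"] bexI[of _ q']) (auto simp: prime_in_def mult.commute)
    qed
  qed
  moreover have "lead_coeff q \<in> A" "lead_coeff q \<noteq> 0" using assms by (auto simp: polys_over_def)
  ultimately show ?thesis using ufd assms by (metis ufd_on_def)
qed

text \<open>The prime factors p of c are cancelled one at a time: p divides f * k, hence k, because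
  f is primitive.\<close>

lemma primitive_cancel:
  assumes f: "f \<in> B" "primitive_over A f" and c: "c \<in> A" "c \<noteq> 0"
    and g: "g \<in> B" "f dvd [:c:] * g"
  shows "f dvd g"
proof -
  obtain u ps where u: "u dvd 1" "\<forall>p\<in>set ps. prime_in A p" "c = u * prod_list ps"
    using ufd c by (auto simp: ufd_on_def)
  obtain v where v: "u * v = 1" using u(1) by (metis dvdE)
  have "f dvd [:v:] * ([:c:] * g)" using g(2) by (rule dvd_mult)
  also have "[:v:] * ([:c:] * g) = [:prod_list ps:] * g" using u(3) v
    by (simp add: mult.assoc[symmetric] mult.commute)
  finally have "f dvd [:prod_list ps:] * g" .
  then show ?thesis using u(2) g(1)
  proof (induction ps arbitrary: g)
    case Nil
    then show ?case by (simp add: one_pCons[symmetric])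
  next
    case (Cons p ps)
    have p: "prime_in A p" using Cons.prems by simp
    let ?g = "[:prod_list ps:] * g"
    have "prod_list ps \<in> A" using Cons.prems(2)
      by (induction ps) (auto intro: one_mem mult_mem simp: prime_in_def)
    then have gB: "?g \<in> B" using Cons.prems const_mem polys.mult_mem by blast
    have "f dvd [:p:] * ?g" using Cons.prems(1) by (simp add: mult_ac)
    then obtain k where k: "[:p:] * ?g = f * k" by (elim dvdE)
    have "f dvd ?g"
    proof (cases "?g = 0")
      case False
      have p0: "[:p:] \<noteq> 0" using p by (auto simp: prime_in_def)
      have "f * k \<in> B" "f * k \<noteq> 0"
        using k p gB const_mem polys.mult_mem[of "[:p:]" ?g] False p0
        by (auto simp: prime_in_def simp del: mult_pCons_left)
      then have "k \<in> B" using polys.factor_mem2 by blast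
      then have "[:p:] dvd f \<or> [:p:] dvd k" using const_prime[OF p] k f
        unfolding prime_in_def by (metis dvd_triv_left)
      then have "[:p:] dvd k" using f(2) p by (auto simp: primitive_over_def)
      then obtain k' where k': "k = [:p:] * k'" by (elim dvdE)
      have "[:p:] * ?g = [:p:] * (f * k')" using k k' by (metis mult.left_commute)
      then have "?g = f * k'" using p0 by (metis mult_left_cancel)
      then show ?thesis by (metis dvd_triv_left)
    next
      case True
      show ?thesis unfolding True by simp
    qed
    then show ?case using Cons by auto
  qed
qed

lemma primitive_const_unit:
  assumes "k \<in> A" "k \<noteq> 0" "[:k:] dvd q" "primitive_over A q"
  shows "k dvd 1"
proof -
  obtain u ps where u: "u dvd 1" "\<forall>p\<in>set ps. prime_in A p" "k = u * prod_list ps"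
    using ufd assms by (auto simp: ufd_on_def)
  show ?thesis
  proof (cases ps)
    case Nil then show ?thesis using u by simp
  next
    case (Cons p ps')
    then have "[:p:] dvd [:k:]" using u by (simp add: const_poly_dvd_iff coeff_pCons split: nat.split)
    then have "[:p:] dvd q" using assms(3) dvd_trans by blast
    then show ?thesis using assms(4) u(2) Cons by (auto simp: primitive_over_def)
  qed
qed

text \<open>Pseudo-division replaces the Euclidean algorithm over the fraction field: after scaling
  f by the leading coefficient of m, a multiple of m cancels its leading term, and minimality of m
  drives the remainder to 0.\<close>

lemma least_degree_dvd:
  assumes M_add: "\<And>x y. x \<in> M \<Longrightarrow> y \<in> M \<Longrightarrow> x + y \<in> M"
    and M_mult: "\<And>x b. x \<in> M \<Longrightarrow> b \<in> B \<Longrightarrow> b * x \<in> M"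
    and MB: "M \<subseteq> B" and m: "m \<in> M" "m \<noteq> 0"
    and least: "\<And>x. x \<in> M \<Longrightarrow> x \<noteq> 0 \<Longrightarrow> degree m \<le> degree x"
    and f: "f \<in> M"
  shows "\<exists>c\<in>A. c \<noteq> 0 \<and> m dvd [:c:] * f"
  using f
proof (induction "degree f" arbitrary: f rule: less_induct)
  case less
  show ?case
  proof (cases "f = 0")
    case True
    then show ?thesis using one_mem by (intro bexI[of _ 1]) auto
  next
    case False
    define l where "l = lead_coeff m"
    have l: "l \<in> A" "l \<noteq> 0" using m MB by (auto simp: l_def polys_over_def)
    define t where "t = monom (lead_coeff f) (degree f - degree m)"
    have t: "t \<in> B" using less.prems MB by (auto simp: t_def polys_over_def zero_mem)
    define f' where "f' = [:l:] * f + (- t) * m"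
    have f': "f' \<in> M" unfolding f'_def using less.prems m l t const_mem polys.uminus_mem M_add M_mult by blast
    have deg: "degree m \<le> degree f" using least[OF less.prems False] .
    have f'_alt: "f' = [:l:] * f - t * m" by (simp add: f'_def)
    have "f' = 0 \<or> degree f' < degree f"
    \<comment> \<open>Between constants the degree cannot drop, but the two terms of
      \<open>f'\<close> cancel outright.\<close>
    proof (cases "degree f = 0")
      case True
      then have "degree m = 0" using deg by simp
      then obtain a b where "f = [:a:]" "m = [:b:]" using True by (metis degree_eq_zeroE)
      then show ?thesis by (simp add: f'_alt l_def t_def monom_0 mult.commute)
    next
      case False
      have "coeff (t * m) (degree f) = lead_coeff f * l"
        unfolding t_def l_def using deg by (simp add: coeff_monom_mult)
      then have c0: "coeff f' (degree f) = 0" by (simp add: f'_alt mult.commute)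
      have "degree t \<le> degree f - degree m" unfolding t_def by (rule degree_monom_le)
      then have "degree (t * m) \<le> degree f" using degree_mult_le[of t m] deg by linarith
      moreover have "degree ([:l:] * f) \<le> degree f" by (simp add: degree_smult_le)
      ultimately have "degree f' \<le> degree f" unfolding f'_alt by (intro degree_diff_le)
      then show ?thesis using c0 by (metis leading_coeff_0_iff le_neq_implies_less)
    qed
    then have "\<exists>c\<in>A. c \<noteq> 0 \<and> m dvd [:c:] * f'"
    proof
      assume "f' = 0" then show ?thesis using one_mem by (intro bexI[of _ 1]) auto
    next
      assume "degree f' < degree f" then show ?thesis using less.hyps f' by blast
    qed
    then obtain c where c: "c \<in> A" "c \<noteq> 0" "m dvd [:c:] * f'" by blast
    have "[:c * l:] * f = [:c:] * f' + [:c:] * t * m" by (simp add: f'_alt algebra_simps)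
    then have "m dvd [:c * l:] * f" using c(3) by (metis dvd_add dvd_triv_right)
    then show ?thesis using c l mult_mem by (intro bexI[of _ "c * l"]) auto
  qed
qed

text \<open>Induction on the degree. Constants factor in A; otherwise a primitive divisor of least
  positive degree is split off, and the work is to show it prime.\<close>

theorem ufd_on_polys: "ufd_on B"
proof -
  have main: "\<exists>u ps. u dvd 1 \<and> (\<forall>p\<in>set ps. prime_in B p) \<and> q = u * prod_list ps"
    if "q \<in> B" "q \<noteq> 0" for q
    using that
  proof (induction "degree q" arbitrary: q rule: less_induct)
    case less
    show ?case
    proof (cases "degree q = 0")
      case True
      then obtain a where a: "q = [:a:]" by (metis degree_eq_zeroE)
      then have "a \<in> A" "a \<noteq> 0" using less.prems const_memD by auto
      then obtain u ps where u: "u dvd 1" "\<forall>p\<in>set ps. prime_in A p" "a = u * prod_list ps"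
        using ufd by (auto simp: ufd_on_def)
      have e: "[:prod_list ps:] = prod_list (map (\<lambda>x. [:x:]) ps)"
      proof (induction ps)
        case (Cons x ps)
        have "[:prod_list (x # ps):] = [:x:] * [:prod_list ps:]" by simp
        then show ?case using Cons by simp
      qed (simp add: one_pCons)
      have "q = [:u:] * [:prod_list ps:]" using a u(3) by simp
      then have "q = [:u:] * prod_list (map (\<lambda>x. [:x:]) ps)" unfolding e .
      moreover have "[:u:] dvd 1" using u(1) by (simp add: const_poly_dvd_iff)
      moreover have "\<forall>p\<in>set (map (\<lambda>x. [:x:]) ps). prime_in B p" using u(2) const_prime by auto
      ultimately show ?thesis by blast
    next
      case False
      \<comment> \<open>Dividing a constant multiple of q imitates dividing q over the fraction
        field, where a divisor of least positive degree is irreducible.\<close>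
      define P where "P d \<longleftrightarrow> d \<in> B \<and> 0 < degree d \<and> (\<exists>c\<in>A. c \<noteq> 0 \<and> d dvd [:c:] * q)" for d
      have "P q" using False less.prems one_mem by (auto simp: P_def intro!: bexI[of _ 1])
      then obtain d0 where d0: "P d0" "\<And>d'. P d' \<Longrightarrow> degree d0 \<le> degree d'"
        using ex_has_least_nat[of P q degree] by blast
      have "d0 \<noteq> 0" using d0 by (auto simp: P_def)
      then obtain e d where d: "e \<in> A" "d \<in> B" "d0 = [:e:] * d" "primitive_over A d"
        using content[of d0] d0(1) unfolding P_def by blast
      have "e \<noteq> 0" "d \<noteq> 0" using \<open>d0 \<noteq> 0\<close> d by auto
      then have degd: "degree d = degree d0" using d(3) by (simp add: degree_mult_eq)
      then have dpos: "0 < degree d" using d0 by (auto simp: P_def)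
      obtain c where c: "c \<in> A" "c \<noteq> 0" "d dvd [:c:] * q"
        using d0(1) d(3) unfolding P_def by (metis dvd_mult_right)
      have dq: "d dvd q" using primitive_cancel[OF d(2,4) c(1,2) less.prems(1) c(3)] .
      have "prime_in B d" unfolding prime_in_def
      proof (intro conjI ballI impI)
        show "d \<in> B" "d \<noteq> 0" by fact+
        show "\<not> d dvd 1"
        proof
          assume "d dvd 1"
          then have "degree d \<le> degree (1::'a poly)" by (rule dvd_imp_degree_le) simp
          then show False using dpos by simp
        qed
        fix g h assume gh: "g \<in> B" "h \<in> B" "d dvd g * h"
        \<comment> \<open>The ideal (d, g). Its generator up to constants, made primitive, divides d
          and g. Either it is constant, which gives a Bezout identity, or minimality of the degree
          of d makes it an associate of d.\<close>
        define M where "M = {u * d + v * g | u v. u \<in> B \<and> v \<in> B}"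
        have dM: "d \<in> M" unfolding M_def
          using polys.one_mem polys.zero_mem by (intro CollectI exI[of _ 1] exI[of _ 0]) auto
        have gM: "g \<in> M" unfolding M_def
          using polys.one_mem polys.zero_mem by (intro CollectI exI[of _ 0] exI[of _ 1]) auto
        have M_add: "x + y \<in> M" if "x \<in> M" "y \<in> M" for x y
        proof -
          obtain u v u' v' where "x = u * d + v * g" "y = u' * d + v' * g" "u \<in> B" "v \<in> B" "u' \<in> B" "v' \<in> B"
            using \<open>x \<in> M\<close> \<open>y \<in> M\<close> by (auto simp: M_def)
          then show ?thesis unfolding M_def using polys.add_mem
            by (intro CollectI exI[of _ "u + u'"] exI[of _ "v + v'"]) (auto simp: algebra_simps)
        qed
        have M_mult: "b * x \<in> M" if "x \<in> M" "b \<in> B" for x b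
        proof -
          obtain u v where "x = u * d + v * g" "u \<in> B" "v \<in> B"
            using \<open>x \<in> M\<close> by (auto simp: M_def)
          then show ?thesis unfolding M_def using polys.mult_mem \<open>b \<in> B\<close>
            by (intro CollectI exI[of _ "b * u"] exI[of _ "b * v"]) (auto simp: algebra_simps)
        qed
        have MB: "M \<subseteq> B" unfolding M_def
          using polys.add_mem polys.mult_mem \<open>d \<in> B\<close> \<open>g \<in> B\<close> by auto
        obtain m where m: "m \<in> M" "m \<noteq> 0" "\<And>x. x \<in> M \<Longrightarrow> x \<noteq> 0 \<Longrightarrow> degree m \<le> degree x"
          using ex_has_least_nat[of "\<lambda>m. m \<in> M \<and> m \<noteq> 0" d degree] dM \<open>d \<noteq> 0\<close> by blast
        have ld: "\<exists>c\<in>A. c \<noteq> 0 \<and> m dvd [:c:] * f" if "f \<in> M" for f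
          by (rule least_degree_dvd[of M m]) (use M_add M_mult MB m that in blast)+
        obtain c1 where c1: "c1 \<in> A" "c1 \<noteq> 0" "m dvd [:c1:] * d" using ld[OF dM] by blast
        obtain c2 where c2: "c2 \<in> A" "c2 \<noteq> 0" "m dvd [:c2:] * g" using ld[OF gM] by blast
        obtain e' m' where m': "e' \<in> A" "m' \<in> B" "m = [:e':] * m'" "primitive_over A m'"
          using content m MB by blast
        have m'd: "m' dvd d" using primitive_cancel[OF m'(2,4) c1(1,2) d(2)] c1(3) m'(3)
          by (metis dvd_mult_right)
        have m'g: "m' dvd g" using primitive_cancel[OF m'(2,4) c2(1,2) gh(1)] c2(3) m'(3)
          by (metis dvd_mult_right)
        show "d dvd g \<or> d dvd h"
        proof (cases "degree m' = 0")
          case True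
          then have "degree m = 0" using m'(3) m(2) by (auto simp: degree_mult_eq)
          then obtain m0 where m0: "m = [:m0:]" by (metis degree_eq_zeroE)
          have m0A: "m0 \<in> A" "m0 \<noteq> 0" using m MB m0 const_memD by auto
          obtain u v where uv: "m = u * d + v * g" using m(1) by (auto simp: M_def)
          have "[:m0:] * h = u * h * d + v * (g * h)" using uv m0 by (simp add: algebra_simps)
          then have "d dvd [:m0:] * h" using gh(3) by (metis dvd_add dvd_mult dvd_triv_right)
          then show ?thesis using primitive_cancel[OF d(2,4) m0A gh(2)] by blast
        next
          case False
          have "m' dvd [:c:] * q" using m'd dq by (meson dvd_mult dvd_trans)
          then have "P m'" using False m' c by (auto simp: P_def)
          then have le: "degree d \<le> degree m'" using d0 degd by simp
          obtain k where k: "d = m' * k" using m'd by (elim dvdE)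
          then have "degree k = 0" using le \<open>d \<noteq> 0\<close> by (auto simp: degree_mult_eq)
          then obtain k0 where k0: "k = [:k0:]" by (metis degree_eq_zeroE)
          have "k \<in> B" using polys.factor_mem2 k d(2) \<open>d \<noteq> 0\<close> by blast
          then have "k0 \<in> A" "k0 \<noteq> 0" using k0 const_memD k \<open>d \<noteq> 0\<close> by auto
          moreover have "[:k0:] dvd d" using k k0 by (metis dvd_triv_right)
          ultimately have "k0 dvd 1" using primitive_const_unit d(4) by blast
          then obtain k1 where "k0 * k1 = 1" by (metis dvdE)
          then have "m' = d * [:k1:]" using k k0 by (simp add: mult_ac)
          then show ?thesis using m'g by (metis dvd_mult_left)
        qed
      qed
      moreover obtain q1 where q1: "q = d * q1" using dq by (elim dvdE)
      moreover have "q1 \<in> B" "q1 \<noteq> 0" using polys.factor_mem2 q1 less.prems by auto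
      moreover have "degree q1 < degree q" using q1 dpos less.prems by (auto simp: degree_mult_eq)
      ultimately obtain u ps where "u dvd 1" "\<forall>p\<in>set ps. prime_in B p" "q1 = u * prod_list ps"
        using less.hyps by blast
      then show ?thesis using q1 \<open>prime_in B d\<close>
        by (intro exI[of _ u] exI[of _ "d # ps"]) (auto simp: mult_ac)
    qed
  qed
  then show ?thesis by (auto simp: ufd_on_def)
qed

end

section \<open>Evaluation homomorphisms and polynomial rings in a given set of variables\<close>

abbreviation "keys \<equiv> Poly_Mapping.keys"
abbreviation "lookup \<equiv> Poly_Mapping.lookup"
abbreviation "const c \<equiv> Poly_Mapping.single (0 :: nat \<Rightarrow>\<^sub>0 nat) (c :: complex)"

definition monom_value :: "(nat \<Rightarrow> 'a::comm_ring_1) \<Rightarrow> (nat \<Rightarrow>\<^sub>0 nat) \<Rightarrow> 'a" where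
  "monom_value v m = (\<Prod>i\<in>keys m. v i ^ lookup m i)"

text \<open>For c as in \<open>coeff_hom\<close> this is the ring homomorphism extending c with
  \<open>Var i\<close> sent to \<open>v i\<close>. The maps \<open>unfold_var\<close>,
  \<open>weigh\<close> and \<open>subst\<close> are instances.\<close>

definition peval :: "(complex \<Rightarrow> 'a) \<Rightarrow> (nat \<Rightarrow> 'a) \<Rightarrow> cpoly \<Rightarrow> 'a::comm_ring_1" where
  "peval c v p = (\<Sum>m\<in>keys p. c (lookup p m) * monom_value v m)"

lemma monom_value_superset:
  assumes "finite K" "keys m \<subseteq> K"
  shows "monom_value v m = (\<Prod>i\<in>K. v i ^ lookup m i)"
  unfolding monom_value_def using assms
  by (intro prod.mono_neutral_left) (auto simp: in_keys_iff)

lemma monom_value_0 [simp]: "monom_value v 0 = 1"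
  by (simp add: monom_value_def)

lemma monom_value_add: "monom_value v (m + n) = monom_value v m * monom_value v n"
proof -
  let ?K = "keys m \<union> keys n"
  have "keys (m + n) \<subseteq> ?K" by (rule keys_add)
  then show ?thesis
    using monom_value_superset[of ?K "m + n" v] monom_value_superset[of ?K m v]
      monom_value_superset[of ?K n v]
    by (simp add: lookup_add power_add prod.distrib)
qed

lemma poly_mapping_sum_singles: "(\<Sum>m\<in>keys p. Poly_Mapping.single m (lookup p m)) = p"
  by (rule poly_mapping_eqI) (auto simp: lookup_sum lookup_single when_def sum.delta' in_keys_iff)

lemma cpoly_induct [case_names single add]:
  fixes p :: cpoly
  assumes single: "\<And>m c. m \<in> keys p \<Longrightarrow> P (Poly_Mapping.single m c)"
    and add: "\<And>p q. P p \<Longrightarrow> P q \<Longrightarrow> P (p + q)" and zero: "P 0"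
  shows "P p"
proof -
  have "P (\<Sum>m\<in>K. Poly_Mapping.single m (lookup p m))" if "finite K" "K \<subseteq> keys p" for K
    using that by (induction K) (auto intro: assms)
  from this[of "keys p"] show ?thesis by (simp add: poly_mapping_sum_singles)
qed

locale coeff_hom =
  fixes c :: "complex \<Rightarrow> 'a::comm_ring_1"
  assumes c_0 [simp]: "c 0 = 0" and c_1 [simp]: "c 1 = 1"
    and c_add: "c (x + y) = c x + c y" and c_mult: "c (x * y) = c x * c y"
begin

lemma peval_superset:
  assumes "finite K" "keys p \<subseteq> K"
  shows "peval c v p = (\<Sum>m\<in>K. c (lookup p m) * monom_value v m)"
  unfolding peval_def using assms
  by (intro sum.mono_neutral_left) (auto simp: in_keys_iff)

lemma peval_0 [simp]: "peval c v 0 = 0"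
  by (simp add: peval_def)

lemma peval_single [simp]: "peval c v (Poly_Mapping.single m a) = c a * monom_value v m"
  by (simp add: peval_superset[of "{m}"])

lemma peval_Var [simp]: "peval c v (Var i) = v i"
  by (simp add: Var_def monom_value_def)

lemma peval_1 [simp]: "peval c v 1 = 1"
  using peval_single[of v 0 1] by simp

lemma peval_add [simp]: "peval c v (p + q) = peval c v p + peval c v q"
proof -
  let ?K = "keys p \<union> keys q"
  have "keys (p + q) \<subseteq> ?K" by (rule keys_add)
  then show ?thesis
    using peval_superset[of ?K "p + q" v] peval_superset[of ?K p v] peval_superset[of ?K q v]
    by (simp add: lookup_add c_add sum.distrib algebra_simps)
qed

lemma peval_uminus [simp]: "peval c v (- p) = - peval c v p"
  using peval_add[of v p "- p"] by (simp add: eq_neg_iff_add_eq_0 add.commute)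

lemma peval_diff [simp]: "peval c v (p - q) = peval c v p - peval c v q"
  using peval_add[of v p "- q"] by simp

lemma peval_mult [simp]: "peval c v (p * q) = peval c v p * peval c v q"
proof (induction p rule: cpoly_induct)
  case (single m a)
  show ?case
    by (induction q rule: cpoly_induct)
      (auto simp: mult_single c_mult monom_value_add algebra_simps)
qed (auto simp: algebra_simps)

lemma peval_power [simp]: "peval c v (p ^ n) = peval c v p ^ n"
  by (induction n) auto

end

lemma Var_power: "Var i ^ k = Poly_Mapping.single (Poly_Mapping.single i k) 1"
  by (induction k) (auto simp: Var_def mult_single single_add[symmetric])

lemma single_eq_prod:
  "Poly_Mapping.single m (c::complex) = const c * (\<Prod>i\<in>keys m. Var i ^ lookup m i)"
proof -
  have "(\<Prod>i\<in>K. Var i ^ f i) = Poly_Mapping.single (\<Sum>i\<in>K. Poly_Mapping.single i (f i)) 1"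
    if "finite K" for K f
    using that by (induction K) (auto simp: Var_power mult_single)
  then show ?thesis by (simp add: poly_mapping_sum_singles mult_single)
qed

lemma const_eq_0_iff [simp]: "const c = 0 \<longleftrightarrow> c = 0"
  by (metis lookup_single_eq lookup_zero single_zero)

lemma const_mem_poly_carrier [simp]: "const c \<in> poly_carrier I"
  by (auto simp: poly_carrier_def)

lemma Var_mem_poly_carrier: "i \<in> I \<Longrightarrow> Var i \<in> poly_carrier I"
  by (auto simp: poly_carrier_def Var_def)

lemma poly_carrier_add: "p \<in> poly_carrier I \<Longrightarrow> q \<in> poly_carrier I \<Longrightarrow> p + q \<in> poly_carrier I"
  using keys_add[of p q] by (auto simp: poly_carrier_def)

lemma poly_carrier_uminus: "p \<in> poly_carrier I \<Longrightarrow> - p \<in> poly_carrier I"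
  by (auto simp: poly_carrier_def in_keys_iff)

lemma poly_carrier_mult:
  assumes "p \<in> poly_carrier I" "q \<in> poly_carrier I"
  shows "p * q \<in> poly_carrier I"
  unfolding poly_carrier_def
proof (intro CollectI ballI)
  fix m assume "m \<in> keys (p * q)"
  then obtain k l where "m = k + l" "k \<in> keys p" "l \<in> keys q" using keys_mult[of p q] by auto
  then show "keys m \<subseteq> I" using assms keys_add[of k l] by (fastforce simp: poly_carrier_def)
qed

lemma poly_carrier_mono: "I \<subseteq> J \<Longrightarrow> poly_carrier I \<subseteq> poly_carrier J"
  by (auto simp: poly_carrier_def)

lemma poly_carrier_0 [simp]: "0 \<in> poly_carrier I" and poly_carrier_1 [simp]: "1 \<in> poly_carrier I"
  by (auto simp: poly_carrier_def)

lemma poly_carrier_UNIV [simp]: "poly_carrier UNIV = UNIV"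
  by (auto simp: poly_carrier_def)

lemma poly_carrier_empty: "poly_carrier {} = range (\<lambda>c. const c)"
proof (intro equalityI subsetI)
  fix p assume "p \<in> poly_carrier {}"
  then have "keys p \<subseteq> {0}" by (auto simp: poly_carrier_def)
  then have "p = const (lookup p 0)"
    by (intro poly_mapping_eqI) (auto simp: lookup_single when_def in_keys_iff)
  then show "p \<in> range (\<lambda>c. const c)" by blast
qed auto

lemma poly_carrier_induct [consumes 1, case_names const Var add mult]:
  assumes "p \<in> poly_carrier I" and const: "\<And>c. P (const c)" and Var: "\<And>i. i \<in> I \<Longrightarrow> P (Var i)"
    and add: "\<And>p q. p \<in> poly_carrier I \<Longrightarrow> q \<in> poly_carrier I \<Longrightarrow> P p \<Longrightarrow> P q \<Longrightarrow> P (p + q)"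
    and mult: "\<And>p q. p \<in> poly_carrier I \<Longrightarrow> q \<in> poly_carrier I \<Longrightarrow> P p \<Longrightarrow> P q \<Longrightarrow> P (p * q)"
  shows "P p"
proof -
  have one: "P 1" using const[of 1] by simp
  have pow: "Var i ^ k \<in> poly_carrier I \<and> P (Var i ^ k)" if "i \<in> I" for i k
    using that by (induction k) (auto intro: poly_carrier_mult Var_mem_poly_carrier mult Var one)
  have pr: "(\<Prod>i\<in>K. Var i ^ f i) \<in> poly_carrier I \<and> P (\<Prod>i\<in>K. Var i ^ f i)"
    if "finite K" "K \<subseteq> I" for K f
    using that by (induction K) (auto intro: poly_carrier_mult mult one simp: pow)
  have "p \<in> poly_carrier I \<and> P p"
  proof -
    have "p \<in> poly_carrier I \<longrightarrow> keys p \<subseteq> {m. keys m \<subseteq> I}" by (auto simp: poly_carrier_def)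
    moreover have "Poly_Mapping.single m c \<in> poly_carrier I \<and> P (Poly_Mapping.single m c)"
      if "keys m \<subseteq> I" for m c
    proof -
      have "const c * (\<Prod>i\<in>keys m. Var i ^ lookup m i) \<in> poly_carrier I \<and>
          P (const c * (\<Prod>i\<in>keys m. Var i ^ lookup m i))"
        using pr[of "keys m" "lookup m"] that by (auto intro: poly_carrier_mult mult const)
      then show ?thesis by (simp only: single_eq_prod[of m c, symmetric])
    qed
    ultimately show ?thesis using assms(1) const[of 0]
      by (intro cpoly_induct[of p "\<lambda>p. p \<in> poly_carrier I \<and> P p"])
        (auto intro: poly_carrier_add add)
  qed
  then show ?thesis by simp
qed

section \<open>Unique factorization in polynomial rings\<close>

text \<open>Reads a polynomial as one in x_k whose coefficients are free of x_k; evaluation at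
  \<open>Var k\<close> is the inverse. This carries degrees and Gauss's theorem over to many
  variables.\<close>

definition unfold_var :: "nat \<Rightarrow> cpoly \<Rightarrow> cpoly poly" where
  "unfold_var k = peval (\<lambda>c. [:const c:]) (\<lambda>i. if i = k then [:0, 1:] else [:Var i:])"

lemma const_mult: "const (x * y) = const x * const y" by (simp add: mult_single)

interpretation poly_const: coeff_hom "\<lambda>c. [:const c:]"
  by standard (simp_all add: single_add mult_single one_pCons mult.commute)

lemma unfold_var_hom [simp]:
  "unfold_var k 0 = 0" "unfold_var k 1 = 1"
  "unfold_var k (p + q) = unfold_var k p + unfold_var k q"
  "unfold_var k (p * q) = unfold_var k p * unfold_var k q"
  "unfold_var k (p ^ n) = unfold_var k p ^ n"
  "unfold_var k (const c) = [:const c:]"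
  "unfold_var k (Var i) = (if i = k then [:0, 1:] else [:Var i:])"
  unfolding unfold_var_def by simp_all

lemma poly_unfold_var [simp]: "poly (unfold_var k p) (Var k) = p"
proof -
  have "p \<in> poly_carrier UNIV" by simp
  then show ?thesis by (induction p rule: poly_carrier_induct) auto
qed

lemma unfold_var_eq_0_iff [simp]: "unfold_var k p = 0 \<longleftrightarrow> p = 0"
  using poly_unfold_var[of k p] by fastforce

lemma unfold_var_absent: "p \<in> poly_carrier I \<Longrightarrow> k \<notin> I \<Longrightarrow> unfold_var k p = [:p:]"
  by (induction p rule: poly_carrier_induct) auto

lemma polys_over_poly_carrier:
  shows "p \<in> polys_over (poly_carrier I) \<Longrightarrow> q \<in> polys_over (poly_carrier I) \<Longrightarrow>
           p + q \<in> polys_over (poly_carrier I)"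
    and "p \<in> polys_over (poly_carrier I) \<Longrightarrow> q \<in> polys_over (poly_carrier I) \<Longrightarrow>
           p * q \<in> polys_over (poly_carrier I)"
proof -
  have sm: "sum f K \<in> poly_carrier I" if "\<And>i. i \<in> K \<Longrightarrow> f i \<in> poly_carrier I" for f and K :: "nat set"
    using that by (induction K rule: infinite_finite_induct) (auto intro: poly_carrier_add)
  show "p \<in> polys_over (poly_carrier I) \<Longrightarrow> q \<in> polys_over (poly_carrier I) \<Longrightarrow>
           p * q \<in> polys_over (poly_carrier I)"
    by (auto simp: polys_over_def coeff_mult intro!: sm poly_carrier_mult)
qed (auto simp: polys_over_def intro: poly_carrier_add)

lemma unfold_var_mem:
  "p \<in> poly_carrier (insert k I) \<Longrightarrow> unfold_var k p \<in> polys_over (poly_carrier (I - {k}))"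
proof (induction p rule: poly_carrier_induct)
  case (const c)
  then show ?case by (auto simp: polys_over_def coeff_pCons split: nat.split)
next
  case (Var i)
  then show ?case
    by (auto simp: polys_over_def coeff_pCons Var_mem_poly_carrier split: nat.split)
qed (auto intro: polys_over_poly_carrier)

lemma poly_Var_mem:
  assumes "q \<in> polys_over (poly_carrier I)"
  shows "poly q (Var k) \<in> poly_carrier (insert k I)"
proof -
  have pow: "Var k ^ j \<in> poly_carrier (insert k I)" for j
    by (induction j) (auto intro: poly_carrier_mult Var_mem_poly_carrier)
  have "coeff q j \<in> poly_carrier (insert k I)" for j
    using assms poly_carrier_mono[of I "insert k I"] by (auto simp: polys_over_def)
  then have "(\<Sum>j\<in>K. coeff q j * Var k ^ j) \<in> poly_carrier (insert k I)" for K
    by (induction K rule: infinite_finite_induct)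
      (auto intro!: poly_carrier_add poly_carrier_mult pow)
  then show ?thesis by (simp add: poly_altdef)
qed

lemma unfold_var_poly:
  assumes "q \<in> polys_over (poly_carrier I)" "k \<notin> I"
  shows "unfold_var k (poly q (Var k)) = q"
proof -
  have "unfold_var k (\<Sum>j\<in>K. coeff q j * Var k ^ j) = (\<Sum>j\<in>K. monom (coeff q j) j)" for K
  proof (induction K rule: infinite_finite_induct)
    case (insert j K)
    have "unfold_var k (coeff q j) = [:coeff q j:]"
      using assms by (intro unfold_var_absent[of _ I]) (auto simp: polys_over_def)
    then show ?case using insert by (simp add: monom_altdef)
  qed auto
  then show ?thesis by (simp add: poly_altdef poly_as_sum_of_monoms)
qed

text \<open>Degrees in x_k add up, so a variable x_k absent from the nonzero product is absent from
  both factors.\<close>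

lemma poly_carrier_factor:
  assumes ab: "a * b \<in> poly_carrier I" "a * b \<noteq> 0"
  shows "a \<in> poly_carrier I"
  unfolding poly_carrier_def
proof (intro CollectI ballI subsetI, rule ccontr)
  fix m k assume m: "m \<in> keys a" "k \<in> keys m" "k \<notin> I"
  have "unfold_var k a * unfold_var k b = [:a * b:]"
    using unfold_var_absent[OF ab(1) m(3)] by simp
  then have "degree (unfold_var k a * unfold_var k b) = 0" by simp
  then have "degree (unfold_var k a) = 0"
    using ab(2) by (subst (asm) degree_mult_eq) auto
  then obtain a0 where a0: "unfold_var k a = [:a0:]" by (metis degree_eq_zeroE)
  then have "a0 = a" using poly_unfold_var[of k a] by simp
  then have "coeff (unfold_var k a) 0 = a" using a0 by simp
  moreover have "unfold_var k a \<in> polys_over (poly_carrier (UNIV - {k}))"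
    by (rule unfold_var_mem) simp
  ultimately have "a \<in> poly_carrier (UNIV - {k})" unfolding polys_over_def by (metis mem_Collect_eq)
  then show False using m by (auto simp: poly_carrier_def)
qed

interpretation poly_carrier: factor_closed_subring "poly_carrier I" for I
  by standard (auto intro: poly_carrier_add poly_carrier_mult poly_carrier_uminus poly_carrier_factor)

lemma fresh_var:
  assumes "finite (F :: cpoly set)" "finite I"
  obtains J k where "finite J" "I \<subseteq> J" "F \<subseteq> poly_carrier J" "k \<notin> J"
proof -
  define J where "J = I \<union> (\<Union>p\<in>F. \<Union>m\<in>keys p. keys m)"
  have "finite J" using assms by (auto simp: J_def)
  moreover have "F \<subseteq> poly_carrier J" by (auto simp: J_def poly_carrier_def)
  moreover obtain k where "k \<notin> J" using \<open>finite J\<close> ex_new_if_finite infinite_UNIV_nat by blast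
  moreover have "I \<subseteq> J" by (auto simp: J_def)
  ultimately show ?thesis using that by blast
qed

text \<open>Putting a fresh variable x_k for the polynomial variable turns the claim into
  \<open>poly_carrier_factor\<close>. Freshness with respect to the coefficients of p lets
  \<open>unfold_var\<close> undo the substitution.\<close>

lemma polys_over_poly_carrier_factor:
  assumes I: "finite I" and pq: "p * q \<in> polys_over (poly_carrier I)" "p * q \<noteq> 0"
  shows "p \<in> polys_over (poly_carrier I)"
proof -
  obtain J k where J: "I \<subseteq> J" "range (coeff p) \<subseteq> poly_carrier J" "k \<notin> J"
  proof -
    have "finite (set (coeffs p))" by simp
    moreover have "range (coeff p) \<subseteq> insert 0 (set (coeffs p))"
      using range_coeff[of p] by auto
    ultimately show ?thesis using fresh_var[of "set (coeffs p)" I] I that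
      by (metis (no_types, lifting) insert_subset poly_carrier_0 subset_trans)
  qed
  have p: "p \<in> polys_over (poly_carrier J)" using J(2) by (auto simp: polys_over_def)
  have k: "k \<notin> I" using J by blast
  have "poly p (Var k) * poly q (Var k) = poly (p * q) (Var k)" by simp
  moreover have "poly (p * q) (Var k) \<in> poly_carrier (insert k I)" using poly_Var_mem[OF pq(1)] .
  moreover have "poly (p * q) (Var k) \<noteq> 0"
    using unfold_var_poly[OF pq(1) k] pq(2) by (metis unfold_var_hom(1))
  ultimately have "poly p (Var k) \<in> poly_carrier (insert k I)"
    using poly_carrier_factor by metis
  then have "unfold_var k (poly p (Var k)) \<in> polys_over (poly_carrier (I - {k}))"
    by (rule unfold_var_mem)
  then show ?thesis using unfold_var_poly[OF p J(3)] k by simp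
qed

text \<open>Induction on the variables: evaluation at \<open>Var k\<close> sends primes of the
  one-variable ring over \<open>poly_carrier I\<close> to primes, with \<open>unfold_var k\<close>
  as inverse.\<close>

lemma ufd_on_poly_carrier:
  assumes "finite I"
  shows "ufd_on (poly_carrier I)"
  using assms
proof (induction I)
  case empty
  have "const c dvd 1" if "c \<noteq> 0" for c
    using that const_mult[of c "inverse c"] by (metis dvdI right_inverse single_one)
  then have "u dvd 1 \<and> (\<forall>p\<in>set []. prime_in (poly_carrier {}) p) \<and> u = u * prod_list []"
    if "u \<in> poly_carrier {}" "u \<noteq> 0" for u
    using that by (auto simp: poly_carrier_empty)
  then show ?case unfolding ufd_on_def by blast
next
  case (insert k I)
  interpret gauss_subring "poly_carrier I"
    by standard (use insert polys_over_poly_carrier_factor in blast)+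
  have prime: "prime_in (poly_carrier (insert k I)) (poly r (Var k))"
    if r: "prime_in B r" for r
    unfolding prime_in_def
  proof (intro conjI ballI impI)
    have rB: "r \<in> B" using r by (simp add: prime_in_def)
    have ur: "unfold_var k (poly r (Var k)) = r" using unfold_var_poly[OF rB] insert by simp
    have dvd: "r dvd unfold_var k a" if "poly r (Var k) dvd a" for a
      using that ur by (auto elim!: dvdE)
    show "poly r (Var k) \<in> poly_carrier (insert k I)" using poly_Var_mem[OF rB] .
    show "poly r (Var k) \<noteq> 0" using ur r by (auto simp: prime_in_def)
    show "\<not> poly r (Var k) dvd 1" using dvd[of 1] r by (auto simp: prime_in_def)
    fix a b assume ab: "a \<in> poly_carrier (insert k I)" "b \<in> poly_carrier (insert k I)"
      "poly r (Var k) dvd a * b"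
    have "unfold_var k a \<in> B" "unfold_var k b \<in> B" using unfold_var_mem ab insert(2) by (metis Diff_empty Diff_insert0)+
    moreover have "r dvd unfold_var k a * unfold_var k b" using dvd[OF ab(3)] by simp
    ultimately have "r dvd unfold_var k a \<or> r dvd unfold_var k b" using r unfolding prime_in_def by blast
    moreover have "poly r (Var k) dvd a" if "r dvd unfold_var k a" for a
      using that poly_unfold_var[of k a] by (metis dvd_def poly_mult)
    ultimately show "poly r (Var k) dvd a \<or> poly r (Var k) dvd b" by blast
  qed
  show ?case unfolding ufd_on_def
  proof (intro ballI impI)
    fix a assume a: "a \<in> poly_carrier (insert k I)" "a \<noteq> 0"
    have "unfold_var k a \<in> B" using unfold_var_mem[OF a(1)] insert(2) by simp
    then obtain u ps where u: "u dvd 1" "\<forall>p\<in>set ps. prime_in B p" "unfold_var k a = u * prod_list ps"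
      using ufd_on_polys a(2) unfolding ufd_on_def by (metis unfold_var_eq_0_iff)
    have "poly (prod_list ps) (Var k) = prod_list (map (\<lambda>r. poly r (Var k)) ps)"
      by (induction ps) auto
    then have "a = poly u (Var k) * prod_list (map (\<lambda>r. poly r (Var k)) ps)"
      using poly_unfold_var[of k a] u(3) by simp
    moreover have "poly u (Var k) dvd 1" using u(1) by (metis dvd_def poly_1 poly_mult)
    moreover have "\<forall>p\<in>set (map (\<lambda>r. poly r (Var k)) ps). prime_in (poly_carrier (insert k I)) p"
      using u(2) prime by auto
    ultimately show "\<exists>u ps. u dvd 1 \<and> (\<forall>p\<in>set ps. prime_in (poly_carrier (insert k I)) p) \<and> a = u * prod_list ps"
      by blast
  qed
qed

lemma unit_poly_const:
  assumes "u dvd (1 :: cpoly)"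
  obtains c where "u = const c" "c \<noteq> 0"
proof -
  have "u \<in> poly_carrier {}" using poly_carrier.dvd_mem[OF assms] by simp
  then obtain c where "u = const c" by (auto simp: poly_carrier_empty)
  moreover from this have "c \<noteq> 0" using assms by auto
  ultimately show ?thesis using that by blast
qed

section \<open>Weighted homogeneous polynomials\<close>

text \<open>Sends x_i to x_i t^(a_i), where t is the polynomial variable, so the coefficient of t^d
  is the component of weighted degree d. Homogeneity, as in \<open>hgrade\<close>, means being a
  monomial in t, a question in one variable.\<close>

definition weigh :: "(nat \<Rightarrow> nat) \<Rightarrow> cpoly \<Rightarrow> cpoly poly" where
  "weigh a = peval (\<lambda>c. [:const c:]) (\<lambda>i. monom (Var i) (a i))"

definition hgrade :: "nat set \<Rightarrow> (nat \<Rightarrow> nat) \<Rightarrow> nat \<Rightarrow> cpoly set" where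
  "hgrade I a d = {p \<in> poly_carrier I. weigh a p = monom p d}"

lemma weigh_hom [simp]:
  "weigh a 0 = 0" "weigh a 1 = 1"
  "weigh a (p + q) = weigh a p + weigh a q"
  "weigh a (p * q) = weigh a p * weigh a q"
  "weigh a (const c) = [:const c:]"
  "weigh a (Var i) = monom (Var i) (a i)"
  unfolding weigh_def by simp_all

lemma poly_weigh_1 [simp]: "poly (weigh a p) 1 = p"
proof -
  have "p \<in> poly_carrier UNIV" by simp
  then show ?thesis by (induction p rule: poly_carrier_induct) (auto simp: poly_monom)
qed

lemma weigh_single:
  "weigh a (Poly_Mapping.single m c) =
    monom (Poly_Mapping.single m c) (\<Sum>i\<in>keys m. a i * lookup m i)"
proof -
  have "monom_value (\<lambda>i. monom (Var i) (a i)) m =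
      monom (\<Prod>i\<in>keys m. Var i ^ lookup m i) (\<Sum>i\<in>keys m. a i * lookup m i)"
  proof -
    have "(\<Prod>i\<in>K. monom (Var i) (a i) ^ f i) = monom (\<Prod>i\<in>K. Var i ^ f i) (\<Sum>i\<in>K. a i * f i)" for K f
      by (induction K rule: infinite_finite_induct) (auto simp: monom_power mult_monom)
    then show ?thesis by (simp only: monom_value_def)
  qed
  then have "weigh a (Poly_Mapping.single m c) =
      monom (const c * (\<Prod>i\<in>keys m. Var i ^ lookup m i)) (\<Sum>i\<in>keys m. a i * lookup m i)"
    unfolding weigh_def poly_const.peval_single by (simp add: smult_monom)
  then show ?thesis by (simp only: single_eq_prod[of m c, symmetric])
qed

lemma weigh_altdef:
  "weigh a p = (\<Sum>m\<in>keys p. monom (Poly_Mapping.single m (lookup p m)) (\<Sum>i\<in>keys m. a i * lookup m i))"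
proof -
  have "weigh a (\<Sum>m\<in>K. Poly_Mapping.single m (lookup p m)) =
     (\<Sum>m\<in>K. monom (Poly_Mapping.single m (lookup p m)) (\<Sum>i\<in>keys m. a i * lookup m i))" for K
    by (induction K rule: infinite_finite_induct) (auto simp: weigh_single)
  from this[of "keys p"] show ?thesis by (simp add: poly_mapping_sum_singles)
qed

text \<open>Distinct monomials do not cancel in \<open>weigh\<close>, so a single power t^d forces
  every exponent sum to be d.\<close>

lemma grade_poly_algebra:
  assumes "finite I"
  shows "grade (poly_algebra I a) d = hgrade I a d"
proof -
  have wt: "(\<Sum>i\<in>I. a i * lookup m i) = (\<Sum>i\<in>keys m. a i * lookup m i)" if "keys m \<subseteq> I" for m
    using that assms by (intro sum.mono_neutral_right) (auto simp: in_keys_iff)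
  have "(\<forall>m\<in>keys p. (\<Sum>i\<in>keys m. a i * lookup m i) = d) \<longleftrightarrow> weigh a p = monom p d" (is "?l \<longleftrightarrow> ?r") for p
  proof
    assume ?l
    then have "weigh a p = (\<Sum>m\<in>keys p. monom (Poly_Mapping.single m (lookup p m)) d)"
      by (simp add: weigh_altdef)
    also have "\<dots> = monom (\<Sum>m\<in>keys p. Poly_Mapping.single m (lookup p m)) d"
      by (rule poly_eqI) (simp add: coeff_sum)
    finally show ?r by (simp add: poly_mapping_sum_singles)
  next
    assume r: ?r
    show ?l
    proof (intro ballI, rule ccontr)
      fix m assume m: "m \<in> keys p" "(\<Sum>i\<in>keys m. a i * lookup m i) \<noteq> d"
      let ?e = "\<Sum>i\<in>keys m. a i * lookup m i"
      have "lookup (coeff (weigh a p) ?e) m =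
        (\<Sum>n\<in>keys p. lookup (if (\<Sum>i\<in>keys n. a i * lookup n i) = ?e then Poly_Mapping.single n (lookup p n) else 0) m)"
        by (simp add: weigh_altdef coeff_sum lookup_sum)
      also have "\<dots> = (\<Sum>n\<in>keys p. if n = m then lookup p m else 0)"
        by (intro sum.cong) (auto simp: lookup_single when_def)
      also have "\<dots> = lookup p m" using m by simp
      finally show False using r m by (simp add: in_keys_iff)
    qed
  qed
  moreover have "(\<forall>m\<in>keys p. (\<Sum>i\<in>I. a i * lookup m i) = d) \<longleftrightarrow>
      (\<forall>m\<in>keys p. (\<Sum>i\<in>keys m. a i * lookup m i) = d)" if "p \<in> poly_carrier I" for p
    using that wt by (auto simp: poly_carrier_def)
  ultimately show ?thesis unfolding poly_algebra_def hgrade_def by auto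
qed

text \<open>In a domain lowest and highest degrees both add up. Here both sums are d, so in p the
  lowest degree equals the highest.\<close>

lemma monom_factor:
  fixes p q :: "'a::idom poly"
  assumes pq: "p * q = monom c d" and c: "c \<noteq> 0"
  shows "\<exists>a e. p = monom a e"
proof -
  have nz: "p \<noteq> 0" "q \<noteq> 0" using assms by auto
  have ex: "\<exists>i. coeff p i \<noteq> 0" "\<exists>i. coeff q i \<noteq> 0" using nz leading_coeff_0_iff by blast+
  define i where "i = (LEAST i. coeff p i \<noteq> 0)"
  define j where "j = (LEAST i. coeff q i \<noteq> 0)"
  have i: "coeff p i \<noteq> 0" "\<And>k. k < i \<Longrightarrow> coeff p k = 0"
    and j: "coeff q j \<noteq> 0" "\<And>k. k < j \<Longrightarrow> coeff q k = 0"
    unfolding i_def j_def using LeastI_ex[OF ex(1)] LeastI_ex[OF ex(2)]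
    by (auto dest: not_less_Least)
  obtain r where "coeff (p * q) (i + j) = coeff p i * coeff q j + 0 * r"
    using coeff_mult_least[of i 0 p j q] i j by auto
  then have "i + j = d" using pq i j by (auto split: if_splits)
  moreover have "degree p + degree q = d" using pq c nz
    by (metis degree_monom_eq degree_mult_eq)
  moreover have "i \<le> degree p" "j \<le> degree q" using i j by (auto intro: le_degree)
  ultimately have "i = degree p" by simp
  then have "p = monom (coeff p i) i" using i
    by (intro poly_eqI) (metis coeff_eq_0 coeff_monom linorder_neqE_nat)
  then show ?thesis by blast
qed

text \<open>This makes prime factors of homogeneous polynomials homogeneous, so that they can
  generate points of Proj.\<close>

lemma hgrade_factor:
  assumes "p * q \<in> hgrade I a d" "p * q \<noteq> 0"
  obtains e where "p \<in> hgrade I a e"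
proof -
  have "weigh a p * weigh a q = monom (p * q) d" using assms by (simp add: hgrade_def)
  then obtain b e where be: "weigh a p = monom b e" using monom_factor assms(2) by blast
  then have "b = p" using poly_weigh_1[of a p] by (simp add: poly_monom)
  then show ?thesis using that be assms poly_carrier_factor by (auto simp: hgrade_def)
qed

lemma hgrade_mult: "p \<in> hgrade I a d \<Longrightarrow> q \<in> hgrade I a e \<Longrightarrow> p * q \<in> hgrade I a (d + e)"
  by (auto simp: hgrade_def mult_monom intro: poly_carrier_mult)

lemma hgrade_unique: "p \<in> hgrade I a d \<Longrightarrow> p \<in> hgrade I a e \<Longrightarrow> p \<noteq> 0 \<Longrightarrow> d = e"
  by (auto simp: hgrade_def) (metis degree_monom_eq)

lemma hgrade_0 [simp]: "0 \<in> hgrade I a d"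
  by (simp add: hgrade_def)

lemma hgrade_const: "const c \<in> hgrade I a 0"
  by (simp add: hgrade_def monom_0)

lemma hgrade_1: "1 \<in> hgrade I a 0"
  by (simp add: hgrade_def)

lemma hgrade_Var: "i \<in> I \<Longrightarrow> Var i \<in> hgrade I a (a i)"
  by (simp add: hgrade_def Var_mem_poly_carrier)

lemma hgrade_subset: "hgrade I a d \<subseteq> poly_carrier I"
  by (auto simp: hgrade_def)

section \<open>Fractions and sections on Proj of a graded ring\<close>

text \<open>The closure properties used when computing with fractions; both S and the coordinate
  ring of X are instances.\<close>

locale graded_cring = cring S for S :: "'a graded_algebra" (structure) +
  assumes grade_closed: "x \<in> grade S d \<Longrightarrow> x \<in> carrier S"
    and grade_mult: "x \<in> grade S d \<Longrightarrow> y \<in> grade S e \<Longrightarrow> x \<otimes> y \<in> grade S (d + e)"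
    and grade_one: "\<one> \<in> grade S 0"
begin

definition basic_open :: "'a \<Rightarrow> 'a set set" where
  "basic_open f = {p \<in> proj_points S. f \<notin> p}"

definition is_frac :: "'a set \<Rightarrow> 'a \<Rightarrow> 'a \<Rightarrow> bool" where
  "is_frac p a f \<longleftrightarrow> (\<exists>d. a \<in> grade S d \<and> f \<in> grade S d) \<and> f \<notin> p"

definition frac_sec :: "'a set set \<Rightarrow> 'a \<Rightarrow> 'a \<Rightarrow> 'a set \<Rightarrow> ('a \<times> 'a) set" where
  "frac_sec U a f = (\<lambda>p\<in>U. hfrac S p a f)"

lemma homog_closed: "h \<in> homog S \<Longrightarrow> h \<in> carrier S"
  by (auto simp: homog_def grade_closed)

lemma grade_homog: "h \<in> grade S d \<Longrightarrow> h \<in> homog S"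
  by (auto simp: homog_def)

lemma proj_points_prime:
  assumes "p \<in> proj_points S"
  shows "ideal p S" "\<one> \<notin> p"
    "\<And>x y. x \<in> carrier S \<Longrightarrow> y \<in> carrier S \<Longrightarrow> x \<otimes> y \<in> p \<Longrightarrow> x \<in> p \<or> y \<in> p"
    "\<And>x y. x \<in> p \<Longrightarrow> y \<in> carrier S \<Longrightarrow> x \<otimes> y \<in> p"
    "\<And>x y. x \<in> p \<Longrightarrow> y \<in> carrier S \<Longrightarrow> y \<otimes> x \<in> p"
proof -
  interpret primeideal p S using assms by (simp add: proj_points_def)
  show "ideal p S" by (rule is_ideal)
  show "\<one> \<notin> p" using I_notcarr one_imp_carrier by auto
  show "\<And>x y. x \<in> carrier S \<Longrightarrow> y \<in> carrier S \<Longrightarrow> x \<otimes> y \<in> p \<Longrightarrow> x \<in> p \<or> y \<in> p"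
    by (rule I_prime)
  show "\<And>x y. x \<in> p \<Longrightarrow> y \<in> carrier S \<Longrightarrow> x \<otimes> y \<in> p" by (rule I_r_closed)
  show "\<And>x y. x \<in> p \<Longrightarrow> y \<in> carrier S \<Longrightarrow> y \<otimes> x \<in> p" by (rule I_l_closed)
qed

lemma homog_diff_mult:
  assumes "p \<in> proj_points S" "h \<in> homog S - p" "k \<in> homog S - p"
  shows "h \<otimes> k \<in> homog S - p"
proof -
  obtain d e where de: "h \<in> grade S d" "k \<in> grade S e" using assms by (auto simp: homog_def)
  then have "h \<otimes> k \<in> homog S" using grade_mult[OF de] by (auto simp: homog_def)
  moreover have "h \<otimes> k \<notin> p"
    using proj_points_prime(3)[OF assms(1), of h k] de assms by (auto simp: grade_closed)
  ultimately show ?thesis by blast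
qed

lemma one_homog_diff: "p \<in> proj_points S \<Longrightarrow> \<one> \<in> homog S - p"
  using proj_points_prime(2) grade_one by (auto simp: homog_def)

lemma is_frac_closed: "is_frac p a f \<Longrightarrow> a \<in> carrier S \<and> f \<in> carrier S \<and> f \<in> homog S - p"
  by (auto simp: is_frac_def grade_closed homog_def)

lemma is_frac_mult:
  assumes "p \<in> proj_points S" "is_frac p a f" "is_frac p b g"
  shows "is_frac p (a \<otimes> b) (f \<otimes> g)"
  using assms homog_diff_mult[of p f g] is_frac_closed[OF assms(2)] is_frac_closed[OF assms(3)]
  unfolding is_frac_def by (blast intro: grade_mult)

lemma mult_minus_eq_zero_iff:
  assumes "h \<in> carrier S" "x \<in> carrier S" "y \<in> carrier S"
  shows "h \<otimes> (x \<ominus> y) = \<zero> \<longleftrightarrow> h \<otimes> x = h \<otimes> y"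
proof -
  have "h \<otimes> (x \<ominus> y) = h \<otimes> x \<ominus> h \<otimes> y" using assms by (simp add: r_distr r_minus minus_eq)
  moreover have "u \<ominus> v = \<zero> \<longleftrightarrow> u = v" if uv: "u \<in> carrier S" "v \<in> carrier S" for u v
  proof
    assume "u \<ominus> v = \<zero>"
    moreover have "(u \<ominus> v) \<oplus> v = u" using uv by (simp add: minus_eq a_assoc l_neg)
    ultimately show "u = v" using uv by simp
  qed (use uv in \<open>simp add: minus_eq r_neg\<close>)
  ultimately show ?thesis using assms by simp
qed

lemma mem_hfrac_iff:
  assumes "is_frac p a f"
  shows "(b, g) \<in> hfrac S p a f \<longleftrightarrow>
    is_frac p b g \<and> (\<exists>h\<in>homog S - p. h \<otimes> (a \<otimes> g) = h \<otimes> (b \<otimes> f))"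
proof -
  have "(b, g) \<in> hfrac S p a f \<longleftrightarrow>
      is_frac p b g \<and> (\<exists>h\<in>homog S - p. h \<otimes> (a \<otimes> g \<ominus> b \<otimes> f) = \<zero>)"
    unfolding hfrac_def is_frac_def by blast
  moreover have "h \<otimes> (a \<otimes> g \<ominus> b \<otimes> f) = \<zero> \<longleftrightarrow> h \<otimes> (a \<otimes> g) = h \<otimes> (b \<otimes> f)"
    if "is_frac p b g" "h \<in> homog S - p" for h
    using is_frac_closed[OF assms] is_frac_closed[OF that(1)] homog_closed[of h] that(2)
    by (intro mult_minus_eq_zero_iff) auto
  ultimately show ?thesis by blast
qed

lemma hfrac_eq_iff:
  assumes p: "p \<in> proj_points S" and af: "is_frac p a f" and bg: "is_frac p b g"
  shows "hfrac S p a f = hfrac S p b g \<longleftrightarrow> (\<exists>h\<in>homog S - p. h \<otimes> (a \<otimes> g) = h \<otimes> (b \<otimes> f))"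
proof
  assume "hfrac S p a f = hfrac S p b g"
  moreover have "(b, g) \<in> hfrac S p b g"
    using bg one_homog_diff[OF p] by (auto simp: mem_hfrac_iff)
  ultimately have "(b, g) \<in> hfrac S p a f" by simp
  then show "\<exists>h\<in>homog S - p. h \<otimes> (a \<otimes> g) = h \<otimes> (b \<otimes> f)"
    using mem_hfrac_iff[OF af] by blast
next
  have trans: "hfrac S p a f \<subseteq> hfrac S p b g"
    if af: "is_frac p a f" and bg: "is_frac p b g"
      and h: "h \<in> homog S - p" "h \<otimes> (a \<otimes> g) = h \<otimes> (b \<otimes> f)" for a f b g h
  proof
    fix z assume "z \<in> hfrac S p a f"
    then obtain c k h' where z: "z = (c, k)" "is_frac p c k" and h': "h' \<in> homog S - p"
      "h' \<otimes> (a \<otimes> k) = h' \<otimes> (c \<otimes> f)"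
      using af by (cases z) (auto simp: mem_hfrac_iff)
    note cl = is_frac_closed[OF af] is_frac_closed[OF bg] is_frac_closed[OF z(2)]
      homog_closed[of h] homog_closed[of h']
    \<comment> \<open>The multiplier includes f, the denominator of the middle fraction a / f, which
      is being eliminated.\<close>
    have "(f \<otimes> (h \<otimes> h')) \<otimes> (b \<otimes> k) = (h \<otimes> (b \<otimes> f)) \<otimes> (h' \<otimes> k)"
      using cl h h' by (simp add: m_ac)
    also have "\<dots> = (h \<otimes> (a \<otimes> g)) \<otimes> (h' \<otimes> k)" using h by simp
    also have "\<dots> = (h' \<otimes> (a \<otimes> k)) \<otimes> (h \<otimes> g)" using cl h(1) h'(1) by (simp add: m_ac)
    also have "\<dots> = (h' \<otimes> (c \<otimes> f)) \<otimes> (h \<otimes> g)" using h' by simp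
    also have "\<dots> = (f \<otimes> (h \<otimes> h')) \<otimes> (c \<otimes> g)" using cl h(1) h'(1) by (simp add: m_ac)
    finally show "z \<in> hfrac S p b g"
      using z bg homog_diff_mult[OF p _ homog_diff_mult[OF p h(1) h'(1)], of f] cl
      by (auto simp: mem_hfrac_iff)
  qed
  assume "\<exists>h\<in>homog S - p. h \<otimes> (a \<otimes> g) = h \<otimes> (b \<otimes> f)"
  then obtain h where h: "h \<in> homog S - p" "h \<otimes> (a \<otimes> g) = h \<otimes> (b \<otimes> f)" by blast
  from trans[OF af bg h] trans[OF bg af h(1) h(2)[symmetric]]
  show "hfrac S p a f = hfrac S p b g" by blast
qed

lemma hfrac_self: "p \<in> proj_points S \<Longrightarrow> is_frac p a f \<Longrightarrow> (a, f) \<in> hfrac S p a f"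
  using one_homog_diff by (auto simp: mem_hfrac_iff)

text \<open>The product is a union over all pairs of representatives. It collapses to one class
  because every pair yields the same class and the union is nonempty.\<close>

lemma hfrac_mult:
  assumes p: "p \<in> proj_points S" and af: "is_frac p a f" and bg: "is_frac p b g"
  shows "hfrac S p a f \<otimes>\<^bsub>homog_localization S p\<^esub> hfrac S p b g = hfrac S p (a \<otimes> b) (f \<otimes> g)"
proof -
  have eq: "hfrac S p (a' \<otimes> b') (f' \<otimes> g') = hfrac S p (a \<otimes> b) (f \<otimes> g)"
    if x: "(a', f') \<in> hfrac S p a f" and y: "(b', g') \<in> hfrac S p b g" for a' f' b' g'
  proof -
    obtain h k where h: "h \<in> homog S - p" "h \<otimes> (a \<otimes> f') = h \<otimes> (a' \<otimes> f)"
      and k: "k \<in> homog S - p" "k \<otimes> (b \<otimes> g') = k \<otimes> (b' \<otimes> g)"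
      and fr: "is_frac p a' f'" "is_frac p b' g'"
      using x y af bg by (auto simp: mem_hfrac_iff)
    note cl = is_frac_closed[OF af] is_frac_closed[OF bg] is_frac_closed[OF fr(1)]
      is_frac_closed[OF fr(2)] homog_closed[of h] homog_closed[of k]
    have "(h \<otimes> k) \<otimes> ((a \<otimes> b) \<otimes> (f' \<otimes> g')) = (h \<otimes> (a \<otimes> f')) \<otimes> (k \<otimes> (b \<otimes> g'))"
      using cl h(1) k(1) by (simp add: m_ac)
    also have "\<dots> = (h \<otimes> (a' \<otimes> f)) \<otimes> (k \<otimes> (b' \<otimes> g))" using h k by simp
    also have "\<dots> = (h \<otimes> k) \<otimes> ((a' \<otimes> b') \<otimes> (f \<otimes> g))"
      using cl h(1) k(1) by (simp add: m_ac)
    finally show ?thesis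
      using hfrac_eq_iff[OF p is_frac_mult[OF p af bg] is_frac_mult[OF p fr]]
        homog_diff_mult[OF p h(1) k(1)] by blast
  qed
  then have "(\<Union>(a', f')\<in>hfrac S p a f. \<Union>(b', g')\<in>hfrac S p b g. hfrac S p (a' \<otimes> b') (f' \<otimes> g'))
      = (\<Union>(a', f')\<in>hfrac S p a f. \<Union>(b', g')\<in>hfrac S p b g. hfrac S p (a \<otimes> b) (f \<otimes> g))"
    by (intro SUP_cong refl) auto
  also have "\<dots> = hfrac S p (a \<otimes> b) (f \<otimes> g)"
    using hfrac_self[OF p af] hfrac_self[OF p bg] by auto
  finally show ?thesis by (simp add: homog_localization_def)
qed

lemma topspace_proj_topology: "topspace (proj_topology S) = proj_points S"
proof -
  have "\<Union> {{p \<in> proj_points S. f \<notin> p} | f. f \<in> homog S} = proj_points S"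
    using one_homog_diff by blast
  then show ?thesis by (simp add: proj_topology_def)
qed

lemma openin_basic_open: "f \<in> homog S \<Longrightarrow> openin (proj_topology S) (basic_open f)"
  unfolding proj_topology_def basic_open_def by (rule topology_generated_by_Basis) blast

lemma open_subset_points: "openin (proj_topology S) U \<Longrightarrow> U \<subseteq> proj_points S"
  using openin_subset topspace_proj_topology by blast

lemma is_frac_mem_localization:
  "is_frac p a f \<Longrightarrow> hfrac S p a f \<in> carrier (homog_localization S p)"
  by (auto simp: homog_localization_def is_frac_def)

lemma regular_sectionD:
  assumes "regular_section S U s" "p \<in> U"
  obtains V a f where "openin (proj_topology S) V" "p \<in> V" "V \<subseteq> U"
    "\<And>q. q \<in> V \<Longrightarrow> is_frac q a f \<and> s q = hfrac S q a f"
proof -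
  obtain V d a f where "openin (proj_topology S) V" "p \<in> V" "V \<subseteq> U" "a \<in> grade S d" "f \<in> grade S d"
    "\<forall>q\<in>V. f \<notin> q \<and> s q = hfrac S q a f"
    using assms unfolding regular_section_def by meson
  then show ?thesis using that[of V a f] by (auto simp: is_frac_def)
qed

lemma regular_sectionI:
  assumes U: "U \<subseteq> proj_points S" and s: "s \<in> extensional U"
    and loc: "\<And>p. p \<in> U \<Longrightarrow> \<exists>V a f. openin (proj_topology S) V \<and> p \<in> V \<and> V \<subseteq> U \<and>
      (\<forall>q\<in>V. is_frac q a f \<and> s q = hfrac S q a f)"
  shows "regular_section S U s"
proof -
  have "s p \<in> carrier (homog_localization S p)" if "p \<in> U" for p
    using loc[OF that] is_frac_mem_localization by metis
  moreover have "\<exists>V. openin (proj_topology S) V \<and> p \<in> V \<and> V \<subseteq> U \<and>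
      (\<exists>d. \<exists>a\<in>grade S d. \<exists>f\<in>grade S d. \<forall>q\<in>V. f \<notin> q \<and> s q = hfrac S q a f)" if pU: "p \<in> U" for p
  proof -
    obtain V a f where V: "openin (proj_topology S) V" "p \<in> V" "V \<subseteq> U"
      and af: "\<forall>q\<in>V. is_frac q a f \<and> s q = hfrac S q a f" using loc[OF pU] by blast
    then obtain d where d: "a \<in> grade S d" "f \<in> grade S d" unfolding is_frac_def by blast
    have "\<forall>q\<in>V. f \<notin> q \<and> s q = hfrac S q a f" using af by (simp add: is_frac_def)
    then show ?thesis using V d by (intro exI[of _ V] conjI exI[of _ d] bexI[of _ a] bexI[of _ f])
  qed
  ultimately show ?thesis using s by (auto simp: regular_section_def PiE_iff)
qed

lemma frac_sec_regular:
  assumes "openin (proj_topology S) U" "\<And>q. q \<in> U \<Longrightarrow> is_frac q a f"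
  shows "regular_section S U (frac_sec U a f)"
proof (rule regular_sectionI)
  fix p assume "p \<in> U"
  then show "\<exists>V b g. openin (proj_topology S) V \<and> p \<in> V \<and> V \<subseteq> U \<and>
      (\<forall>q\<in>V. is_frac q b g \<and> frac_sec U a f q = hfrac S q b g)"
    using assms by (intro exI[of _ U] exI[of _ a] exI[of _ f]) (auto simp: frac_sec_def)
qed (use open_subset_points[OF assms(1)] in \<open>auto simp: frac_sec_def\<close>)

lemma regular_section_mult:
  assumes s: "regular_section S U s" and t: "regular_section S U t" and U: "U \<subseteq> proj_points S"
  shows "regular_section S U (s \<otimes>\<^bsub>proj_sections S U\<^esub> t)"
proof (rule regular_sectionI[OF U])
  fix p assume p: "p \<in> U"
  obtain V a f where V: "openin (proj_topology S) V" "p \<in> V" "V \<subseteq> U"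
    "\<And>q. q \<in> V \<Longrightarrow> is_frac q a f \<and> s q = hfrac S q a f" using regular_sectionD[OF s p] by metis
  obtain W b g where W: "openin (proj_topology S) W" "p \<in> W" "W \<subseteq> U"
    "\<And>q. q \<in> W \<Longrightarrow> is_frac q b g \<and> t q = hfrac S q b g" using regular_sectionD[OF t p] by metis
  have "is_frac q (a \<otimes> b) (f \<otimes> g) \<and> (s \<otimes>\<^bsub>proj_sections S U\<^esub> t) q = hfrac S q (a \<otimes> b) (f \<otimes> g)"
    if q: "q \<in> V \<inter> W" for q
  proof -
    have "q \<in> proj_points S" "q \<in> U" using q V(3) U by auto
    then show ?thesis using q V(4)[of q] W(4)[of q]
      by (auto simp: proj_sections_def is_frac_mult hfrac_mult)
  qed
  then show "\<exists>V a f. openin (proj_topology S) V \<and> p \<in> V \<and> V \<subseteq> U \<and>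
      (\<forall>q\<in>V. is_frac q a f \<and> (s \<otimes>\<^bsub>proj_sections S U\<^esub> t) q = hfrac S q a f)"
    using V W by (intro exI[of _ "V \<inter> W"] exI[of _ "a \<otimes> b"] exI[of _ "f \<otimes> g"]) auto
qed (simp add: proj_sections_def)

lemma regular_section_restrict:
  assumes s: "regular_section S U s" and W: "openin (proj_topology S) W" "W \<subseteq> U"
  shows "regular_section S W (restrict s W)"
proof (rule regular_sectionI)
  fix p assume p: "p \<in> W"
  then obtain V a f where V: "openin (proj_topology S) V" "p \<in> V" "V \<subseteq> U"
    "\<And>q. q \<in> V \<Longrightarrow> is_frac q a f \<and> s q = hfrac S q a f" using regular_sectionD[OF s] W by (metis subsetD)
  then show "\<exists>V a f. openin (proj_topology S) V \<and> p \<in> V \<and> V \<subseteq> W \<and>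
      (\<forall>q\<in>V. is_frac q a f \<and> restrict s W q = hfrac S q a f)"
    using p W by (intro exI[of _ "V \<inter> W"] exI[of _ a] exI[of _ f]) auto
qed (use open_subset_points[OF W(1)] in auto)

lemma frac_sec_mult:
  assumes "U \<subseteq> proj_points S" "\<And>q. q \<in> U \<Longrightarrow> is_frac q a f" "\<And>q. q \<in> U \<Longrightarrow> is_frac q b g"
  shows "frac_sec U a f \<otimes>\<^bsub>proj_sections S U\<^esub> frac_sec U b g = frac_sec U (a \<otimes> b) (f \<otimes> g)"
proof -
  have "frac_sec U a f q \<otimes>\<^bsub>homog_localization S q\<^esub> frac_sec U b g q = hfrac S q (a \<otimes> b) (f \<otimes> g)"
    if "q \<in> U" for q
    using that assms hfrac_mult[of q a f b g] by (auto simp: frac_sec_def)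
  then show ?thesis unfolding proj_sections_def by (auto simp: frac_sec_def[of U "a \<otimes> b"] intro: restrict_ext)
qed

lemma frac_sec_restrict: "W \<subseteq> U \<Longrightarrow> restrict (frac_sec U a f) W = frac_sec W a f"
  unfolding frac_sec_def by (simp add: Int_absorb1)

lemma frac_sec_cong:
  assumes "U \<subseteq> proj_points S" "\<And>q. q \<in> U \<Longrightarrow> is_frac q a f" "\<And>q. q \<in> U \<Longrightarrow> is_frac q b g"
    and "a \<otimes> g = b \<otimes> f"
  shows "frac_sec U a f = frac_sec U b g"
  unfolding frac_sec_def
proof (rule restrict_ext)
  fix q assume "q \<in> U"
  then show "hfrac S q a f = hfrac S q b g"
    using assms hfrac_eq_iff[of q a f b g] one_homog_diff[of q] by (metis subsetD)
qed

end

section \<open>Weighted projective spaces\<close>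

lemma poly_algebra_simps [simp]:
  "carrier (poly_algebra I a) = poly_carrier I"
  "x \<otimes>\<^bsub>poly_algebra I a\<^esub> y = x * y"
  "x \<oplus>\<^bsub>poly_algebra I a\<^esub> y = x + y"
  "\<one>\<^bsub>poly_algebra I a\<^esub> = 1"
  "\<zero>\<^bsub>poly_algebra I a\<^esub> = 0"
  by (simp_all add: poly_algebra_def)

lemma cring_poly_algebra: "cring (poly_algebra I a)"
proof (intro cringI abelian_groupI comm_monoidI)
  fix x assume "x \<in> carrier (poly_algebra I a)"
  then show "\<exists>y\<in>carrier (poly_algebra I a). y \<oplus>\<^bsub>poly_algebra I a\<^esub> x = \<zero>\<^bsub>poly_algebra I a\<^esub>"
    by (intro bexI[of _ "- x"]) (auto intro: poly_carrier_uminus)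
qed (auto simp: algebra_simps intro: poly_carrier_add poly_carrier_mult)

lemma minus_poly_algebra:
  assumes "x \<in> poly_carrier I" "y \<in> poly_carrier I"
  shows "x \<ominus>\<^bsub>poly_algebra I a\<^esub> y = x - y"
proof -
  interpret cring "poly_algebra I a" by (rule cring_poly_algebra)
  have "\<ominus>\<^bsub>poly_algebra I a\<^esub> y = - y"
    using assms by (intro minus_equality) (auto intro: poly_carrier_uminus)
  then show ?thesis by (simp add: a_minus_def)
qed

lemma graded_cring_poly_algebra:
  assumes "finite I"
  shows "graded_cring (poly_algebra I a)"
proof -
  interpret cring "poly_algebra I a" by (rule cring_poly_algebra)
  show ?thesis
    using assms by unfold_locales
      (auto simp: grade_poly_algebra hgrade_mult hgrade_1 intro: subsetD[OF hgrade_subset])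
qed

lemma ideal_poly_algebraI:
  assumes "K \<subseteq> poly_carrier I" "0 \<in> K" "\<And>x y. x \<in> K \<Longrightarrow> y \<in> K \<Longrightarrow> x + y \<in> K"
    "\<And>x y. x \<in> K \<Longrightarrow> y \<in> poly_carrier I \<Longrightarrow> y * x \<in> K"
  shows "ideal K (poly_algebra I a)"
proof (rule idealI)
  interpret cring "poly_algebra I a" by (rule cring_poly_algebra)
  show "ring (poly_algebra I a)" by (rule ring_axioms)
  have "- x \<in> K" if "x \<in> K" for x
    using assms(4)[OF that, of "- 1"] by (simp add: poly_carrier_uminus)
  moreover have "\<ominus>\<^bsub>poly_algebra I a\<^esub> x = - x" if "x \<in> K" for x
    using assms(1) that by (intro minus_equality) (auto intro: poly_carrier_uminus)
  ultimately have inv: "inv\<^bsub>add_monoid (poly_algebra I a)\<^esub> x \<in> K" if "x \<in> K" for x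
    using that unfolding a_inv_def by metis
  show "subgroup K (add_monoid (poly_algebra I a))"
    by (rule subgroup.intro) (use assms inv in simp_all)
qed (use assms in \<open>auto simp: mult.commute\<close>)

locale weighted_proj =
  fixes I :: "nat set" and a :: "nat \<Rightarrow> nat"
  assumes finite_vars: "finite I" and vars_nonempty: "I \<noteq> {}" and weights_pos: "i \<in> I \<Longrightarrow> 0 < a i"
begin

abbreviation "S \<equiv> poly_algebra I a"
abbreviation "gr \<equiv> hgrade I a"

sublocale S: graded_cring S
  by (rule graded_cring_poly_algebra) (rule finite_vars)

lemma grade_S [simp]: "grade S d = gr d"
  by (rule grade_poly_algebra) (rule finite_vars)

lemma gr_0_const:
  assumes "p \<in> gr 0"
  obtains c where "p = const c"
proof -
  have "keys m = {}" if "m \<in> keys p" for m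
  proof (rule ccontr)
    assume "keys m \<noteq> {}"
    then obtain i where i: "i \<in> keys m" by blast
    have p: "p \<in> grade S 0" using assms by simp
    then have "(\<Sum>i\<in>I. a i * lookup m i) = 0" "keys m \<subseteq> I"
      using that by (auto simp: poly_algebra_def poly_carrier_def)
    then have "a i * lookup m i = 0" using i finite_vars by (simp add: subset_iff)
    moreover have "i \<in> I" using i \<open>keys m \<subseteq> I\<close> by blast
    ultimately show False using weights_pos[of i] i by (auto simp: in_keys_iff)
  qed
  then have "p \<in> poly_carrier {}" by (auto simp: poly_carrier_def)
  then show ?thesis using that by (auto simp: poly_carrier_empty)
qed

lemma irrelevant_not_subset:
  assumes "q \<in> gr d" "0 < d" "q \<notin> p"
  shows "\<not> irrelevant_ideal S \<subseteq> p"
proof -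
  have "(\<Union>d\<in>{1..}. grade S d) \<subseteq> irrelevant_ideal S"
    unfolding irrelevant_ideal_def by (rule S.genideal_self) (auto simp: hgrade_def)
  moreover have "q \<in> (\<Union>d\<in>{1..}. grade S d)" using assms by auto
  ultimately show ?thesis using assms(3) by blast
qed

text \<open>The element q of positive degree outside (f) shows that (f) does not contain the
  irrelevant ideal. Admitting f = 0 yields the generic point as well.\<close>

lemma principal_point:
  assumes f: "f = 0 \<or> prime_in (poly_carrier I) f" "f \<in> gr e" and q: "q \<in> gr d" "0 < d" "\<not> f dvd q"
  shows "{p \<in> poly_carrier I. f dvd p} \<in> proj_points S" (is "?P \<in> _")
proof -
  have idl: "ideal ?P S" by (rule ideal_poly_algebraI) (auto intro: poly_carrier_add poly_carrier_mult)
  have "primeideal ?P S"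
  proof (rule primeidealI)
    have "\<not> f dvd 1" using q(3) by (metis dvd_trans one_dvd)
    then have "1 \<in> carrier S" "1 \<notin> ?P" by simp_all
    then show "carrier S \<noteq> ?P" by metis
    fix x y assume "x \<in> carrier S" "y \<in> carrier S" "x \<otimes>\<^bsub>S\<^esub> y \<in> ?P"
    then have "x \<in> poly_carrier I" "y \<in> poly_carrier I" "f dvd x * y" by simp_all
    then have "f dvd x \<or> f dvd y" using f(1) unfolding prime_in_def
      by (metis dvd_0_left_iff mult_eq_0_iff)
    then show "x \<in> ?P \<or> y \<in> ?P" using \<open>x \<in> poly_carrier I\<close> \<open>y \<in> poly_carrier I\<close> by blast
  qed (fact idl, fact S.is_cring)
  moreover have "?P = genideal S (?P \<inter> homog S)"
  proof
    have id2: "ideal (genideal S (?P \<inter> homog S)) S" by (rule S.genideal_ideal) auto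
    have "f \<in> ?P \<inter> homog S" using f hgrade_subset by (auto simp: homog_def)
    moreover have "?P \<inter> homog S \<subseteq> carrier S" by auto
    ultimately have "f \<in> genideal S (?P \<inter> homog S)" using S.genideal_self by blast
    show "?P \<subseteq> genideal S (?P \<inter> homog S)"
    proof
      fix p assume p: "p \<in> ?P"
      show "p \<in> genideal S (?P \<inter> homog S)"
      proof (cases "p = 0")
        case True
        then show ?thesis using additive_subgroup.zero_closed[OF ideal.axioms(1)[OF id2]] by simp
      next
        case False
        obtain r where r: "p = f * r" using p by auto
        then have "r \<in> carrier S" using poly_carrier.factor_mem2[of f r I] p False by simp
        then show ?thesis
          using ideal.I_r_closed[OF id2 \<open>f \<in> genideal S (?P \<inter> homog S)\<close>, of r] r by simp
      qed
    qed
    show "genideal S (?P \<inter> homog S) \<subseteq> ?P" by (rule S.genideal_minimal[OF idl]) blast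
  qed
  ultimately show ?thesis
    using idl irrelevant_not_subset[OF q(1,2), of ?P] q(3) by (auto simp: proj_points_def homogeneous_ideal_def)
qed

lemma generic_point: "{0} \<in> proj_points S"
proof -
  obtain i where i: "i \<in> I" using vars_nonempty by blast
  have "Var i \<noteq> 0" by (simp add: Var_def) (metis lookup_single_eq lookup_zero zero_neq_one)
  then have "{p \<in> poly_carrier I. 0 dvd p} \<in> proj_points S"
    using i weights_pos hgrade_Var by (intro principal_point[where q = "Var i" and e = 0]) auto
  moreover have "{p \<in> poly_carrier I. 0 dvd p} = {0}" by auto
  ultimately show ?thesis by simp
qed

text \<open>Irreducibility of the weighted projective space: a nonempty basic open set comes from
  some f outside a prime, so f is nonzero and lies outside \<open>{0}\<close>.\<close>

lemma generic_mem_open: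
  assumes "openin (proj_topology S) V" "V \<noteq> {}"
  shows "{0} \<in> V"
proof -
  have "generate_topology_on {{p \<in> proj_points S. f \<notin> p} | f. f \<in> homog S} V"
    using assms(1) unfolding proj_topology_def by (rule openin_topology_generated_by)
  then have "V \<noteq> {} \<longrightarrow> {0} \<in> V"
  proof induction
    case (Basis s)
    then obtain f where f: "s = {p \<in> proj_points S. f \<notin> p}" by blast
    have "0 \<in> p" if "p \<in> proj_points S" for p
      using additive_subgroup.zero_closed[OF ideal.axioms(1)[OF S.proj_points_prime(1)[OF that]]] by simp
    then show ?case using f generic_point by blast
  qed auto
  then show ?thesis using assms by blast
qed

lemma zero_mem_point: "p \<in> proj_points S \<Longrightarrow> 0 \<in> p"
  using additive_subgroup.zero_closed[OF ideal.axioms(1)[OF S.proj_points_prime(1)]] by simp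

lemma is_frac_generic: "p \<in> proj_points S \<Longrightarrow> S.is_frac p A B \<Longrightarrow> S.is_frac {0} A B"
  using zero_mem_point by (auto simp: S.is_frac_def)

text \<open>S is a domain, so the multiplier h cancels and equality of fractions does not depend on
  the point p.\<close>

lemma hfrac_S_eq_iff:
  assumes "p \<in> proj_points S" "S.is_frac p A B" "S.is_frac p C D"
  shows "hfrac S p A B = hfrac S p C D \<longleftrightarrow> A * D = C * B"
proof
  assume "hfrac S p A B = hfrac S p C D"
  then obtain h where "h \<in> homog S - p" "h * (A * D) = h * (C * B)"
    using S.hfrac_eq_iff[OF assms] by auto
  moreover then have "h \<noteq> 0" using zero_mem_point[OF assms(1)] by auto
  ultimately show "A * D = C * B" by simp
next
  assume "A * D = C * B"
  then show "hfrac S p A B = hfrac S p C D"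
    using S.hfrac_eq_iff[OF assms] S.one_homog_diff[OF assms(1)] by auto
qed

lemma section_generic:
  assumes t: "regular_section S V t" and V: "V \<subseteq> proj_points S" and p: "p \<in> V"
  obtains A B where "S.is_frac p A B" "t p = hfrac S p A B" "t {0} = hfrac S {0} A B" "{0} \<in> V"
proof -
  obtain W A B where W: "openin (proj_topology S) W" "p \<in> W" "W \<subseteq> V"
    "\<And>q. q \<in> W \<Longrightarrow> S.is_frac q A B \<and> t q = hfrac S q A B"
    using S.regular_sectionD[OF t p] by metis
  moreover have "{0} \<in> W" using generic_mem_open W by blast
  ultimately show ?thesis using that by blast
qed

text \<open>Near each p both sections are fractions that remain valid at \<open>{0}\<close>, where
  they agree by cross multiplication; the same equation gives agreement at p.\<close>

lemma section_eqI:
  assumes t: "regular_section S V t" and t': "regular_section S V t'" and V: "V \<subseteq> proj_points S"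
    and gen: "t {0} = t' {0}"
  shows "t = t'"
proof (rule extensionalityI)
  show "t \<in> extensional V" "t' \<in> extensional V"
    using t t' by (auto simp: regular_section_def PiE_iff)
  fix p assume p: "p \<in> V"
  obtain A B where AB: "S.is_frac p A B" "t p = hfrac S p A B" "t {0} = hfrac S {0} A B"
    using section_generic[OF t V p] by metis
  obtain C D where CD: "S.is_frac p C D" "t' p = hfrac S p C D" "t' {0} = hfrac S {0} C D"
    using section_generic[OF t' V p] by metis
  have pp: "p \<in> proj_points S" using p V by blast
  show "t p = t' p"
    using gen AB CD hfrac_S_eq_iff[OF pp AB(1) CD(1)]
      hfrac_S_eq_iff[OF generic_point is_frac_generic[OF pp AB(1)] is_frac_generic[OF pp CD(1)]]
    by simp
qed

end

section \<open>Transport of sections along an isomorphism\<close>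

locale weighted_proj_iso = weighted_proj I a + R: graded_cring R
  for I :: "nat set" and a :: "nat \<Rightarrow> nat" and R :: "'r graded_algebra" +
  fixes \<phi> :: "'r set \<Rightarrow> cpoly set"
    and \<psi> :: "cpoly set set \<Rightarrow> (cpoly set \<Rightarrow> (cpoly \<times> cpoly) set) \<Rightarrow> ('r set \<Rightarrow> ('r \<times> 'r) set)"
  assumes homeo: "homeomorphic_map (proj_topology R) (proj_topology S) \<phi>"
    and iso: "openin (proj_topology S) V \<Longrightarrow>
      \<psi> V \<in> algebra_iso (proj_sections S V) (proj_sections R (open_preimage (Proj R) \<phi> V))"
    and iso_restrict: "openin (proj_topology S) V \<Longrightarrow> openin (proj_topology S) W \<Longrightarrow> W \<subseteq> V \<Longrightarrow>
      regular_section S V s \<Longrightarrow>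
      \<psi> W (restrict s W) = restrict (\<psi> V s) (open_preimage (Proj R) \<phi> W)"
begin

text \<open>
  The section of \<open>X\<close> over \<open>U\<close> corresponds to the rational function \<open>A / B\<close> on the weighted
  projective space, read off at the generic point \<open>{0}\<close>.
\<close>

definition represents ::
    "'r set set \<Rightarrow> ('r set \<Rightarrow> ('r \<times> 'r) set) \<Rightarrow> cpoly \<Rightarrow> cpoly \<Rightarrow> bool" where
  "represents U g A B \<longleftrightarrow> S.is_frac {0} A B \<and>
     (\<exists>t. regular_section S (\<phi> ` U) t \<and> \<psi> (\<phi> ` U) t = g \<and> t {0} = hfrac S {0} A B)"

lemma image_open: "openin (proj_topology R) U \<Longrightarrow> openin (proj_topology S) (\<phi> ` U)"
  using homeo homeomorphic_map_openness[OF homeo] R.open_subset_points R.topspace_proj_topology by metis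

lemma point_image: "x \<in> proj_points R \<Longrightarrow> \<phi> x \<in> proj_points S"
  using homeomorphic_imp_surjective_map[OF homeo] R.topspace_proj_topology S.topspace_proj_topology by blast

lemma point_preimage:
  assumes "p \<in> proj_points S"
  obtains x where "x \<in> proj_points R" "\<phi> x = p"
  using homeomorphic_imp_surjective_map[OF homeo] R.topspace_proj_topology S.topspace_proj_topology assms
  by (metis imageE)

lemma preimage_image:
  assumes "openin (proj_topology R) U"
  shows "open_preimage (Proj R) \<phi> (\<phi> ` U) = U"
proof -
  have "inj_on \<phi> (proj_points R)"
    using homeomorphic_imp_injective_map[OF homeo] R.topspace_proj_topology by simp
  then show ?thesis using R.open_subset_points[OF assms]
    by (auto simp: open_preimage_def Proj_def R.topspace_proj_topology inj_on_def)
qed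

lemma preimage_open:
  assumes "openin (proj_topology S) V"
  shows "openin (proj_topology R) (open_preimage (Proj R) \<phi> V)" "\<phi> ` open_preimage (Proj R) \<phi> V = V"
proof -
  show "openin (proj_topology R) (open_preimage (Proj R) \<phi> V)"
    unfolding open_preimage_def Proj_def
    using openin_continuous_map_preimage[OF homeomorphic_imp_continuous_map[OF homeo] assms] by simp
  have "V \<subseteq> \<phi> ` proj_points R" using S.open_subset_points[OF assms] point_preimage by blast
  then show "\<phi> ` open_preimage (Proj R) \<phi> V = V"
    by (auto simp: open_preimage_def Proj_def R.topspace_proj_topology)
qed

lemma iso_image:
  assumes U: "openin (proj_topology R) U"
  shows "bij_betw (\<psi> (\<phi> ` U)) {t. regular_section S (\<phi> ` U) t} {g. regular_section R U g}"
    "regular_section S (\<phi> ` U) s \<Longrightarrow> regular_section S (\<phi> ` U) t \<Longrightarrow>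
      \<psi> (\<phi> ` U) (s \<otimes>\<^bsub>proj_sections S (\<phi> ` U)\<^esub> t) = \<psi> (\<phi> ` U) s \<otimes>\<^bsub>proj_sections R U\<^esub> \<psi> (\<phi> ` U) t"
    "\<psi> (\<phi> ` U) (S.frac_sec (\<phi> ` U) 1 1) = R.frac_sec U \<one>\<^bsub>R\<^esub> \<one>\<^bsub>R\<^esub>"
proof -
  have h: "\<psi> (\<phi> ` U) \<in> ring_iso (proj_sections S (\<phi> ` U)) (proj_sections R U)"
    using iso[OF image_open[OF U]] preimage_image[OF U] by (simp add: algebra_iso_def)
  then show "bij_betw (\<psi> (\<phi> ` U)) {t. regular_section S (\<phi> ` U) t} {g. regular_section R U g}"
    by (simp add: ring_iso_def proj_sections_def)
  show "regular_section S (\<phi> ` U) s \<Longrightarrow> regular_section S (\<phi> ` U) t \<Longrightarrow>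
      \<psi> (\<phi> ` U) (s \<otimes>\<^bsub>proj_sections S (\<phi> ` U)\<^esub> t) = \<psi> (\<phi> ` U) s \<otimes>\<^bsub>proj_sections R U\<^esub> \<psi> (\<phi> ` U) t"
    using h ring_hom_mult[of "\<psi> (\<phi> ` U)" "proj_sections S (\<phi> ` U)" "proj_sections R U" s t]
    by (simp add: ring_iso_def) (simp add: proj_sections_def)
  have "\<psi> (\<phi> ` U) \<one>\<^bsub>proj_sections S (\<phi> ` U)\<^esub> = \<one>\<^bsub>proj_sections R U\<^esub>"
    using h ring_hom_one by (auto simp: ring_iso_def)
  then show "\<psi> (\<phi> ` U) (S.frac_sec (\<phi> ` U) 1 1) = R.frac_sec U \<one>\<^bsub>R\<^esub> \<one>\<^bsub>R\<^esub>"
    by (simp add: proj_sections_def homog_localization_def S.frac_sec_def R.frac_sec_def)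
qed

text \<open>The fraction is taken from a local description at the image of x, which is why its
  denominator can be kept from vanishing there.\<close>

lemma represents_exists:
  assumes U: "openin (proj_topology R) U" and g: "regular_section R U g" and x: "x \<in> U"
  obtains A B where "represents U g A B" "B \<notin> \<phi> x"
proof -
  have "g \<in> \<psi> (\<phi> ` U) ` {t. regular_section S (\<phi> ` U) t}"
    using bij_betw_imp_surj_on[OF iso_image(1)[OF U]] g by simp
  then obtain t where t: "regular_section S (\<phi> ` U) t" "\<psi> (\<phi> ` U) t = g" by blast
  have V: "\<phi> ` U \<subseteq> proj_points S" using S.open_subset_points[OF image_open[OF U]] .
  have \<phi>x: "\<phi> x \<in> \<phi> ` U" using x by blast
  obtain A B where fr: "S.is_frac (\<phi> x) A B" and tg: "t {0} = hfrac S {0} A B"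
    by (rule section_generic[OF t(1) V \<phi>x])
  have "S.is_frac {0} A B" using is_frac_generic[OF subsetD[OF V \<phi>x] fr] .
  then have "represents U g A B" using t tg unfolding represents_def by blast
  moreover have "B \<notin> \<phi> x" using fr by (simp add: S.is_frac_def)
  ultimately show ?thesis by (rule that)
qed

lemma represents_unique:
  assumes U: "openin (proj_topology R) U" and "represents U g A B" "represents U g C D"
  shows "A * D = C * B"
proof -
  have "inj_on (\<psi> (\<phi> ` U)) {t. regular_section S (\<phi> ` U) t}"
    using iso_image(1)[OF U] by (auto simp: bij_betw_def)
  then have "hfrac S {0} A B = hfrac S {0} C D"
    using assms(2,3) by (auto simp: represents_def inj_on_def)
  then show ?thesis using assms(2,3) hfrac_S_eq_iff[OF generic_point] by (simp add: represents_def)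
qed

lemma represents_mult:
  assumes U: "openin (proj_topology R) U" "U \<noteq> {}" and "represents U g A B" "represents U k C D"
  shows "represents U (g \<otimes>\<^bsub>proj_sections R U\<^esub> k) (A * C) (B * D)"
proof -
  obtain s t where s: "regular_section S (\<phi> ` U) s" "\<psi> (\<phi> ` U) s = g" "s {0} = hfrac S {0} A B"
    and t: "regular_section S (\<phi> ` U) t" "\<psi> (\<phi> ` U) t = k" "t {0} = hfrac S {0} C D"
    using assms by (auto simp: represents_def)
  have fr: "S.is_frac {0} A B" "S.is_frac {0} C D" using assms by (auto simp: represents_def)
  have gen: "{0} \<in> \<phi> ` U" using generic_mem_open[OF image_open[OF U(1)]] U(2) by simp
  have V: "\<phi> ` U \<subseteq> proj_points S" using S.open_subset_points[OF image_open[OF U(1)]] .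
  have "(s \<otimes>\<^bsub>proj_sections S (\<phi> ` U)\<^esub> t) {0} = hfrac S {0} (A * C) (B * D)"
    using gen s(3) t(3) S.hfrac_mult[OF generic_point fr] by (simp add: proj_sections_def)
  moreover have "S.is_frac {0} (A * C) (B * D)" using S.is_frac_mult[OF generic_point fr] by simp
  ultimately show ?thesis
    using S.regular_section_mult[OF s(1) t(1) V] iso_image(2)[OF U(1) s(1) t(1)] s(2) t(2)
    unfolding represents_def by blast
qed

lemma represents_restrict:
  assumes U: "openin (proj_topology R) U" and W: "openin (proj_topology R) W" "W \<subseteq> U" "W \<noteq> {}"
    and g: "represents U g A B"
  shows "represents W (restrict g W) A B"
proof -
  obtain s where s: "regular_section S (\<phi> ` U) s" "\<psi> (\<phi> ` U) s = g" "s {0} = hfrac S {0} A B"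
    using g by (auto simp: represents_def)
  have sub: "\<phi> ` W \<subseteq> \<phi> ` U" using W by blast
  have gen: "{0} \<in> \<phi> ` W" using generic_mem_open[OF image_open[OF W(1)]] W(3) by simp
  have "\<psi> (\<phi> ` W) (restrict s (\<phi> ` W)) = restrict g W"
    using iso_restrict[OF image_open[OF U] image_open[OF W(1)] sub s(1)] preimage_image[OF W(1)] s(2)
    by simp
  moreover have "regular_section S (\<phi> ` W) (restrict s (\<phi> ` W))"
    using S.regular_section_restrict[OF s(1) image_open[OF W(1)] sub] .
  moreover have "restrict s (\<phi> ` W) {0} = hfrac S {0} A B" using gen s(3) by simp
  ultimately show ?thesis using g unfolding represents_def by blast
qed

lemma represents_inj:
  assumes U: "openin (proj_topology R) U" and "represents U g A B" "represents U k A B"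
  shows "g = k"
proof -
  obtain s t where s: "regular_section S (\<phi> ` U) s" "\<psi> (\<phi> ` U) s = g" "s {0} = hfrac S {0} A B"
    and t: "regular_section S (\<phi> ` U) t" "\<psi> (\<phi> ` U) t = k" "t {0} = hfrac S {0} A B"
    using assms by (auto simp: represents_def)
  have V: "\<phi> ` U \<subseteq> proj_points S" using S.open_subset_points[OF image_open[OF U(1)]] .
  have "s = t" using section_eqI[OF s(1) t(1) V] s(3) t(3) by simp
  then show ?thesis using s t by simp
qed

lemma represents_cong:
  assumes "represents U g A B" "S.is_frac {0} C D" "A * D = C * B"
  shows "represents U g C D"
  using assms hfrac_S_eq_iff[OF generic_point, of A B C D] by (auto simp: represents_def)

lemma represents_one:
  assumes U: "openin (proj_topology R) U" "U \<noteq> {}"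
  shows "represents U (R.frac_sec U \<one>\<^bsub>R\<^esub> \<one>\<^bsub>R\<^esub>) 1 1"
proof -
  have fr: "S.is_frac q 1 1" if "q \<in> proj_points S" for q
    using S.one_homog_diff[OF that] by (auto simp: S.is_frac_def intro: hgrade_1)
  have V: "\<phi> ` U \<subseteq> proj_points S" using S.open_subset_points[OF image_open[OF U(1)]] .
  have "regular_section S (\<phi> ` U) (S.frac_sec (\<phi> ` U) 1 1)"
    using S.frac_sec_regular[OF image_open[OF U(1)]] fr V by blast
  moreover have "{0} \<in> \<phi> ` U" using generic_mem_open[OF image_open[OF U(1)]] U(2) by simp
  then have "S.frac_sec (\<phi> ` U) 1 1 {0} = hfrac S {0} 1 1" by (simp add: S.frac_sec_def)
  ultimately show ?thesis
    using fr[OF generic_point] iso_image(3)[OF U(1)] unfolding represents_def by blast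
qed

text \<open>The opposite direction to \<open>represents_exists\<close>: a fraction regular on V
  produces a section of the other space.\<close>

lemma represents_preimage:
  assumes V: "openin (proj_topology S) V" "V \<noteq> {}" and fr: "\<And>p. p \<in> V \<Longrightarrow> S.is_frac p C D"
  obtains g where "regular_section R (open_preimage (Proj R) \<phi> V) g"
    "represents (open_preimage (Proj R) \<phi> V) g C D"
proof -
  let ?U = "open_preimage (Proj R) \<phi> V"
  note U = preimage_open[OF V(1)]
  have reg: "regular_section S V (S.frac_sec V C D)" using S.frac_sec_regular[OF V(1) fr] .
  have gen: "{0} \<in> V" using generic_mem_open[OF V] .
  have "represents ?U (\<psi> V (S.frac_sec V C D)) C D"
    unfolding represents_def U(2) using reg gen fr[OF gen] by (auto simp: S.frac_sec_def)
  moreover have "regular_section R ?U (\<psi> V (S.frac_sec V C D))"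
    using iso_image(1)[OF U(1)] reg unfolding U(2) by (auto simp: bij_betw_def)
  ultimately show ?thesis using that by blast
qed

lemma represents_frac_restrict:
  assumes U: "openin (proj_topology R) U" and W: "openin (proj_topology R) W" "W \<subseteq> U" "W \<noteq> {}"
    and g: "represents U (R.frac_sec U b f) A B"
  shows "represents W (R.frac_sec W b f) A B"
  using represents_restrict[OF U W g] R.frac_sec_restrict[OF W(2)] by simp

text \<open>Near x the inverse f / b is a section too, represented by some C / D with D nonzero at
  the image of x. From A * C = B * D and primality, A cannot vanish there.\<close>

lemma represents_unit:
  assumes U: "openin (proj_topology R) U" and fr: "\<And>q. q \<in> U \<Longrightarrow> R.is_frac q b f"
    and x: "x \<in> U" "b \<notin> x" and rep: "represents U (R.frac_sec U b f) A B" and B: "B \<notin> \<phi> x"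
  shows "A \<notin> \<phi> x"
proof
  assume A: "A \<in> \<phi> x"
  let ?W = "U \<inter> R.basic_open b"
  have bh: "b \<in> homog R" using fr[OF x(1)] by (auto simp: R.is_frac_def R.grade_homog)
  have W: "openin (proj_topology R) ?W" using U R.openin_basic_open[OF bh] by blast
  have pts: "?W \<subseteq> proj_points R" "x \<in> proj_points R" using R.open_subset_points[OF U] x by auto
  have xW: "x \<in> ?W" using x pts by (simp add: R.basic_open_def)
  have fr1: "R.is_frac q b f" and fr2: "R.is_frac q f b" if "q \<in> ?W" for q
    using fr[of q] that by (auto simp: R.is_frac_def R.basic_open_def)
  obtain C D where CD: "represents ?W (R.frac_sec ?W f b) C D" "D \<notin> \<phi> x"
    using represents_exists[OF W R.frac_sec_regular[OF W fr2] xW] by metis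
  have one: "R.is_frac q \<one>\<^bsub>R\<^esub> \<one>\<^bsub>R\<^esub>" if "q \<in> ?W" for q
    using R.one_homog_diff[of q] that pts R.grade_one by (auto simp: R.is_frac_def)
  have cl: "b \<in> carrier R" "f \<in> carrier R" using R.is_frac_closed[OF fr[OF x(1)]] by auto
  have "represents ?W (R.frac_sec ?W b f) A B"
    using represents_frac_restrict[OF U W _ _ rep] xW by blast
  then have "represents ?W (R.frac_sec ?W b f \<otimes>\<^bsub>proj_sections R ?W\<^esub> R.frac_sec ?W f b) (A * C) (B * D)"
    using represents_mult[OF W _ _ CD(1)] xW by blast
  also have "R.frac_sec ?W b f \<otimes>\<^bsub>proj_sections R ?W\<^esub> R.frac_sec ?W f b =
      R.frac_sec ?W (b \<otimes>\<^bsub>R\<^esub> f) (f \<otimes>\<^bsub>R\<^esub> b)"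
    by (rule R.frac_sec_mult) (use pts fr1 fr2 in auto)
  also have "\<dots> = R.frac_sec ?W \<one>\<^bsub>R\<^esub> \<one>\<^bsub>R\<^esub>"
  proof (rule R.frac_sec_cong)
    fix q assume "q \<in> ?W"
    then show "R.is_frac q (b \<otimes>\<^bsub>R\<^esub> f) (f \<otimes>\<^bsub>R\<^esub> b)"
      using R.is_frac_mult[of q] pts fr1 fr2 by blast
  qed (use pts one cl in \<open>auto simp: R.m_comm\<close>)
  finally have "A * C * 1 = 1 * (B * D)"
    using represents_unique[OF W _ represents_one[OF W]] xW by blast
  moreover have "\<phi> x \<in> proj_points S" using point_image pts by blast
  moreover have "A \<in> carrier S" "B \<in> carrier S" "C \<in> carrier S" "D \<in> carrier S"
    using rep CD(1) S.is_frac_closed unfolding represents_def by blast+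
  ultimately show False
    using S.proj_points_prime(3,4)[of "\<phi> x"] A B CD(2) by (metis mult_1 mult.right_neutral poly_algebra_simps(2))
qed

text \<open>One point x with b nonzero suffices: a representation adapted to x has nonzero
  numerator, and any two representations are proportional.\<close>

lemma represents_nonzero:
  assumes "openin (proj_topology R) U" "\<And>q. q \<in> U \<Longrightarrow> R.is_frac q b f"
    and "x \<in> U" "b \<notin> x" and rep: "represents U (R.frac_sec U b f) A B"
  shows "A \<noteq> 0"
proof -
  obtain C D where CD: "represents U (R.frac_sec U b f) C D" "D \<notin> \<phi> x"
    using represents_exists[OF assms(1) R.frac_sec_regular[OF assms(1,2)] assms(3)] by metis
  then have "C \<notin> \<phi> x" using represents_unit assms by blast
  moreover have "0 \<in> \<phi> x" using zero_mem_point point_image R.open_subset_points assms(1,3) by blast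
  ultimately have "C \<noteq> 0" by blast
  moreover have "A * D = C * B" using represents_unique[OF assms(1) rep CD(1)] .
  moreover have "B \<noteq> 0" using rep by (auto simp: represents_def S.is_frac_def)
  ultimately show ?thesis by auto
qed

end

section \<open>Multiplicities and square roots\<close>

definition ord_at :: "'a::comm_ring_1 \<Rightarrow> 'a \<Rightarrow> nat" where
  "ord_at p a = (THE k. \<exists>b. a = p ^ k * b \<and> \<not> p dvd b)"

lemma ord_at_eqI:
  fixes p :: "'a::idom"
  assumes "p \<noteq> 0" "a = p ^ k * b" "\<not> p dvd b"
  shows "ord_at p a = k"
  unfolding ord_at_def
proof (rule the_equality)
  have le: "j \<le> k" if "p ^ k * b = p ^ j * c" "\<not> p dvd b" for j k b c
  proof (rule ccontr)
    assume "\<not> j \<le> k"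
    then obtain d where d: "j = k + Suc d" using less_imp_Suc_add by (metis add_Suc_right not_le)
    then have "p ^ k * b = p ^ k * (p * p ^ d * c)" using that by (simp add: power_add mult_ac)
    then have "b = p * p ^ d * c" using assms(1) by simp
    then show False using that(2) by simp
  qed
  show "\<exists>b. a = p ^ k * b \<and> \<not> p dvd b" using assms by blast
  fix j assume "\<exists>b. a = p ^ j * b \<and> \<not> p dvd b"
  then obtain c where c: "p ^ k * b = p ^ j * c" "\<not> p dvd c" using assms(2) by auto
  then show "j = k" using le[OF c(1) assms(3)] le[OF c(1)[symmetric] c(2)] by simp
qed

context weighted_proj
begin

definition is_prime :: "cpoly \<Rightarrow> bool" where
  "is_prime \<pi> \<longleftrightarrow> prime_in (poly_carrier I) \<pi>"

lemma is_primeD: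
  assumes "is_prime \<pi>"
  shows "\<pi> \<in> poly_carrier I" "\<pi> \<noteq> 0" "\<not> \<pi> dvd 1"
    "\<And>x y. x \<in> poly_carrier I \<Longrightarrow> y \<in> poly_carrier I \<Longrightarrow> \<pi> dvd x * y \<Longrightarrow> \<pi> dvd x \<or> \<pi> dvd y"
  using assms by (auto simp: is_prime_def prime_in_def)

lemma ord_at_decomp:
  assumes "is_prime \<pi>" "A \<in> poly_carrier I" "A \<noteq> 0"
  obtains b where "A = \<pi> ^ ord_at \<pi> A * b" "\<not> \<pi> dvd b" "b \<in> poly_carrier I"
proof -
  obtain k b where kb: "A = \<pi> ^ k * b" "\<not> \<pi> dvd b"
    using poly_carrier.ord_exists[OF ufd_on_poly_carrier[OF finite_vars]] assms unfolding is_prime_def by blast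
  then have "ord_at \<pi> A = k" using ord_at_eqI is_primeD(2)[OF assms(1)] by blast
  moreover have "b \<in> poly_carrier I" using poly_carrier.factor_mem2 assms kb(1) by blast
  ultimately show ?thesis using that kb by blast
qed

lemma ord_at_mult:
  assumes \<pi>: "is_prime \<pi>" and A: "A \<in> poly_carrier I" "A \<noteq> 0" and B: "B \<in> poly_carrier I" "B \<noteq> 0"
  shows "ord_at \<pi> (A * B) = ord_at \<pi> A + ord_at \<pi> B"
proof -
  obtain b where b: "A = \<pi> ^ ord_at \<pi> A * b" "\<not> \<pi> dvd b" "b \<in> poly_carrier I"
    by (rule ord_at_decomp[OF \<pi> A])
  obtain c where c: "B = \<pi> ^ ord_at \<pi> B * c" "\<not> \<pi> dvd c" "c \<in> poly_carrier I"
    by (rule ord_at_decomp[OF \<pi> B])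
  have "A * B = (\<pi> ^ ord_at \<pi> A * b) * (\<pi> ^ ord_at \<pi> B * c)" using b(1) c(1) by simp
  then have "A * B = \<pi> ^ (ord_at \<pi> A + ord_at \<pi> B) * (b * c)" by (simp add: power_add mult_ac)
  moreover have "\<not> \<pi> dvd b * c" using b c is_primeD(4)[OF \<pi>] by blast
  ultimately show ?thesis using ord_at_eqI is_primeD(2)[OF \<pi>] by blast
qed

lemma ord_at_eq_0: "is_prime \<pi> \<Longrightarrow> \<not> \<pi> dvd A \<Longrightarrow> ord_at \<pi> A = 0"
  using ord_at_eqI[of \<pi> A 0 A] is_primeD(2) by simp

lemma ord_at_pos:
  assumes "is_prime \<pi>" "A \<in> poly_carrier I" "A \<noteq> 0" "\<pi> dvd A"
  shows "0 < ord_at \<pi> A"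
proof (rule ccontr)
  assume "\<not> 0 < ord_at \<pi> A"
  moreover obtain b where "A = \<pi> ^ ord_at \<pi> A * b" "\<not> \<pi> dvd b"
    using ord_at_decomp[OF assms(1-3)] by metis
  ultimately show False using assms(4) by simp
qed

lemma gr_closed: "A \<in> gr d \<Longrightarrow> A \<in> poly_carrier I"
  using hgrade_subset by blast

lemma prime_factor_exists:
  assumes "A \<in> gr d" "A \<noteq> 0" "0 < d"
  obtains \<pi> where "is_prime \<pi>" "\<pi> dvd A"
proof -
  obtain u ps where u: "u dvd 1" "\<forall>p\<in>set ps. prime_in (poly_carrier I) p" "A = u * prod_list ps"
    using ufd_on_poly_carrier[OF finite_vars] gr_closed[OF assms(1)] assms(2) unfolding ufd_on_def by blast
  have "ps \<noteq> []"
  proof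
    assume "ps = []"
    then have "A = u" using u by simp
    then obtain c where "A = const c" using unit_poly_const[OF u(1)] by metis
    then have "A \<in> gr 0" by (simp add: hgrade_const)
    then show False using hgrade_unique[OF assms(1) _ assms(2)] assms(3) by blast
  qed
  then obtain p ps' where "ps = p # ps'" by (cases ps) auto
  then have "is_prime p" "p dvd A" using u by (auto simp: is_prime_def)
  then show ?thesis by (rule that)
qed

lemma prime_degree_pos:
  assumes "is_prime \<pi>" "\<pi> \<in> gr e"
  shows "0 < e"
proof (rule ccontr)
  assume "\<not> 0 < e"
  then obtain c where c: "\<pi> = const c" using gr_0_const assms(2) by auto
  then have "c \<noteq> 0" using is_primeD(2)[OF assms(1)] by auto
  then have "\<pi> * const (inverse c) = 1" using c by (simp add: mult_single)
  then show False using is_primeD(3)[OF assms(1)] by (metis dvdI)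
qed

lemma gr_factor_degrees:
  assumes "A * B \<in> gr d" "A * B \<noteq> 0"
  obtains e f where "A \<in> gr e" "B \<in> gr f" "d = e + f"
proof -
  obtain e where e: "A \<in> gr e" using hgrade_factor[OF assms] by blast
  obtain f where f: "B \<in> gr f" using hgrade_factor[of B A] assms by (metis mult.commute)
  have "d = e + f" using hgrade_unique[OF assms(1) hgrade_mult[OF e f] assms(2)] .
  then show ?thesis using that e f by blast
qed

text \<open>Induction on the degree, removing \<pi> * \<pi> for a prime factor \<pi>; this lowers
  the degree and keeps all multiplicities even.\<close>

lemma square_root:
  assumes "A \<in> gr d" "A \<noteq> 0" "\<And>\<pi>. is_prime \<pi> \<Longrightarrow> even (ord_at \<pi> A)"
  shows "\<exists>C e. C \<in> gr e \<and> A = C * C \<and> d = e + e"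
  using assms
proof (induction d arbitrary: A rule: less_induct)
  case (less d)
  show ?case
  proof (cases "d = 0")
    case True
    then obtain c where c: "A = const c" using gr_0_const less.prems(1) by auto
    \<comment> \<open>The leftover unit is a complex constant, hence a square.\<close>
    have "csqrt c * csqrt c = c" by (metis power2_csqrt power2_eq_square)
    then have "A = const (csqrt c) * const (csqrt c)" using c by (simp add: mult_single)
    then show ?thesis using True hgrade_const[of "csqrt c"] by (intro exI[of _ "const (csqrt c)"] exI[of _ 0]) simp
  next
    case False
    obtain \<pi> where \<pi>: "is_prime \<pi>" "\<pi> dvd A"
      using prime_factor_exists[OF less.prems(1,2)] False by blast
    have A: "A \<in> poly_carrier I" by (rule gr_closed[OF less.prems(1)])
    have "0 < ord_at \<pi> A" using ord_at_pos[OF \<pi>(1) A less.prems(2) \<pi>(2)] .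
    then obtain k where k: "ord_at \<pi> A = Suc (Suc k)"
      using less.prems(3)[OF \<pi>(1)] by (cases "ord_at \<pi> A"; cases "ord_at \<pi> A - 1") auto
    obtain b where b: "A = \<pi> ^ ord_at \<pi> A * b" using ord_at_decomp[OF \<pi>(1) A less.prems(2)] by metis
    define A' where "A' = \<pi> ^ k * b"
    have A': "A = (\<pi> * \<pi>) * A'" using b unfolding k by (simp add: A'_def mult_ac)
    obtain e f where ef: "\<pi> * \<pi> \<in> gr e" "A' \<in> gr f" "d = e + f"
      using gr_factor_degrees less.prems(1,2) unfolding A' by metis
    have nz: "\<pi> * \<pi> \<noteq> 0" "A' \<noteq> 0" using less.prems(2) unfolding A' by auto
    obtain r s where r: "\<pi> \<in> gr r" "\<pi> \<in> gr s" "e = r + s" using gr_factor_degrees[OF ef(1) nz(1)] by blast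
    then have rr: "e = r + r" using hgrade_unique is_primeD(2)[OF \<pi>(1)] by blast
    have "f < d" using prime_degree_pos[OF \<pi>(1) r(1)] ef(3) rr by simp
    moreover have "even (ord_at \<sigma> A')" if "is_prime \<sigma>" for \<sigma>
    proof -
      have p: "\<pi> * \<pi> \<in> poly_carrier I" "A' \<in> poly_carrier I" using gr_closed ef by blast+
      have "ord_at \<sigma> A = ord_at \<sigma> \<pi> + ord_at \<sigma> \<pi> + ord_at \<sigma> A'"
        using ord_at_mult[OF that p(1) nz(1) p(2) nz(2)]
          ord_at_mult[OF that gr_closed[OF r(1)] _ gr_closed[OF r(1)]] is_primeD(2)[OF \<pi>(1)] A'
        by simp
      then show ?thesis using less.prems(3)[OF that] by simp
    qed
    ultimately obtain C g where C: "C \<in> gr g" "A' = C * C" "f = g + g"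
      using less.IH[of f A'] ef(2) nz(2) by blast
    have "A = (\<pi> * C) * (\<pi> * C)" using A' C(2) by (simp add: mult_ac)
    moreover have "\<pi> * C \<in> gr (r + g)" using hgrade_mult[OF r(1) C(1)] .
    moreover have "d = (r + g) + (r + g)" using ef(3) rr C(3) by simp
    ultimately show ?thesis by blast
  qed
qed

definition no_common_prime :: "cpoly \<Rightarrow> cpoly \<Rightarrow> bool" where
  "no_common_prime A B \<longleftrightarrow> (\<forall>\<pi>. is_prime \<pi> \<longrightarrow> \<not> (\<pi> dvd A \<and> \<pi> dvd B))"

text \<open>Take a representation of least degree: a common prime factor has positive degree and
  could be cancelled.\<close>

lemma reduced_fraction:
  assumes "A \<in> gr d" "B \<in> gr d" "A \<noteq> 0" "B \<noteq> 0"
  obtains A' B' e where "A' \<in> gr e" "B' \<in> gr e" "A' \<noteq> 0" "B' \<noteq> 0" "A * B' = A' * B"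
    "no_common_prime A' B'"
proof -
  define P where "P e \<longleftrightarrow> (\<exists>A' B'. A' \<in> gr e \<and> B' \<in> gr e \<and> A' \<noteq> 0 \<and> B' \<noteq> 0 \<and> A * B' = A' * B)" for e
  have "P d" using assms by (auto simp: P_def)
  then have "P (LEAST e. P e)" by (rule LeastI)
  then obtain A' B' where AB: "A' \<in> gr (LEAST e. P e)" "B' \<in> gr (LEAST e. P e)" "A' \<noteq> 0" "B' \<noteq> 0"
    "A * B' = A' * B" by (auto simp: P_def)
  have "no_common_prime A' B'"
    unfolding no_common_prime_def
  proof (intro allI impI notI)
    fix \<pi> assume \<pi>: "is_prime \<pi>" "\<pi> dvd A' \<and> \<pi> dvd B'"
    then obtain A2 B2 where 2: "A' = \<pi> * A2" "B' = \<pi> * B2" by (auto elim!: dvdE)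
    obtain r f where rf: "\<pi> \<in> gr r" "A2 \<in> gr f" "(LEAST e. P e) = r + f"
      using gr_factor_degrees AB(1,3) unfolding 2 by metis
    obtain r' f' where rf': "\<pi> \<in> gr r'" "B2 \<in> gr f'" "(LEAST e. P e) = r' + f'"
      using gr_factor_degrees AB(2,4) unfolding 2 by metis
    have "r = r'" using hgrade_unique rf(1) rf'(1) is_primeD(2)[OF \<pi>(1)] by blast
    then have "f = f'" using rf rf' by simp
    moreover have "A * B2 = A2 * B" using AB(5) is_primeD(2)[OF \<pi>(1)] unfolding 2 by (simp add: mult.left_commute mult.assoc)
    ultimately have "P f" using rf rf' AB unfolding P_def 2 by auto
    then have "(LEAST e. P e) \<le> f" by (rule Least_le)
    then show False using rf(3) prime_degree_pos[OF \<pi>(1) rf(1)] by simp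
  qed
  then show ?thesis using that AB by blast
qed

text \<open>Euclid's lemma, by induction on the degree of B: a prime factor of B divides f * A but
  not A, hence f, and is cancelled on both sides.\<close>

lemma no_common_prime_dvd:
  assumes "B \<in> gr e" "B \<noteq> 0" "A \<in> poly_carrier I" "f \<in> poly_carrier I" "no_common_prime A B"
    "x * B = f * A"
  shows "B dvd f"
  using assms
proof (induction e arbitrary: B f rule: less_induct)
  case (less e)
  show ?case
  proof (cases "e = 0")
    case True
    then obtain c where c: "B = const c" using gr_0_const less.prems(1) by auto
    then have "c \<noteq> 0" using less.prems(2) by auto
    then have "f = B * (const (inverse c) * f)" using c by (simp add: mult_single mult.assoc[symmetric])
    then show ?thesis by (metis dvdI)
  next
    case False
    obtain \<pi> where \<pi>: "is_prime \<pi>" "\<pi> dvd B"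
      using prime_factor_exists[OF less.prems(1,2)] False by blast
    obtain B' where B': "B = \<pi> * B'" using \<pi>(2) by (elim dvdE)
    have "\<pi> dvd f * A" using \<pi>(2) less.prems(6) by (metis dvd_mult)
    then have "\<pi> dvd f" using is_primeD(4)[OF \<pi>(1) less.prems(4,3)] less.prems(5) \<pi>
      unfolding no_common_prime_def by blast
    then obtain f' where f': "f = \<pi> * f'" by (elim dvdE)
    have nz: "\<pi> \<noteq> 0" "B' \<noteq> 0" using less.prems(2) B' by auto
    have f'c: "f' \<in> poly_carrier I"
      using poly_carrier.factor_mem2[of \<pi> f' I] less.prems(4) f' by (cases "f' = 0") (auto simp: nz)
    obtain r s where rs: "\<pi> \<in> gr r" "B' \<in> gr s" "e = r + s"
      using gr_factor_degrees less.prems(1,2) unfolding B' by metis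
    have "s < e" using rs(3) prime_degree_pos[OF \<pi>(1) rs(1)] by simp
    moreover have "no_common_prime A B'" using less.prems(5) unfolding no_common_prime_def B' by auto
    moreover have "\<pi> * (x * B') = \<pi> * (f' * A)" using less.prems(6) unfolding B' f' by (simp add: mult_ac)
    then have "x * B' = f' * A" using nz(1) by simp
    ultimately have "B' dvd f'" using less.IH[of s B' f'] rs(2) nz(2) less.prems(3) f'c by blast
    then show ?thesis unfolding B' f' by (rule mult_dvd_mono[OF dvd_refl])
  qed
qed

end

section \<open>The homogeneous coordinate ring\<close>

definition vars6 :: "nat set" where "vars6 = {1..6}"

abbreviation "P6 \<equiv> poly_algebra vars6 (\<lambda>_. 1)"
abbreviation "pc6 \<equiv> poly_carrier vars6"

definition conic :: "nat \<Rightarrow> nat \<Rightarrow> nat \<Rightarrow> cpoly" where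
  "conic i j k = (Var j)\<^sup>2 - Var i * Var k"

definition relations :: "cpoly set" where
  "relations = genideal P6 {conic 1 2 3, conic 4 5 6}"

definition coset :: "cpoly \<Rightarrow> cpoly set" where
  "coset p = relations +>\<^bsub>P6\<^esub> p"

lemma R_algebra_altdef: "R_algebra = quotient_algebra P6 relations"
  by (simp add: R_algebra_def Let_def relations_def conic_def vars6_def)

interpretation P6: graded_cring P6
  by (rule graded_cring_poly_algebra) (simp add: vars6_def)

lemma pc6_minus: "x \<in> pc6 \<Longrightarrow> y \<in> pc6 \<Longrightarrow> x - y \<in> pc6"
  using poly_carrier_add[of x vars6 "- y"] poly_carrier_uminus by auto

lemma mem_vars6 [simp]: "i \<in> vars6 \<longleftrightarrow> 0 < i \<and> i \<le> 6"
  by (auto simp: vars6_def)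

lemma Var_pc6 [simp]: "i \<in> vars6 \<Longrightarrow> Var i \<in> pc6"
  by (rule Var_mem_poly_carrier)

lemma conic_pc6: "i \<in> vars6 \<Longrightarrow> j \<in> vars6 \<Longrightarrow> k \<in> vars6 \<Longrightarrow> conic i j k \<in> pc6"
  unfolding conic_def power2_eq_square by (intro pc6_minus poly_carrier_mult Var_pc6)

lemma generators_pc6: "{conic 1 2 3, conic 4 5 6} \<subseteq> pc6"
  using conic_pc6[of 1 2 3] conic_pc6[of 4 5 6] by simp

lemma ideal_relations: "ideal relations P6"
  unfolding relations_def by (rule P6.genideal_ideal) (use generators_pc6 in simp)

lemma generators_mem: "conic 1 2 3 \<in> relations" "conic 4 5 6 \<in> relations"
proof -
  have "{conic 1 2 3, conic 4 5 6} \<subseteq> relations"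
    unfolding relations_def by (rule P6.genideal_self) (use generators_pc6 in simp)
  then show "conic 1 2 3 \<in> relations" "conic 4 5 6 \<in> relations" by blast+
qed

lemma relations_mult: "p \<in> relations \<Longrightarrow> q \<in> pc6 \<Longrightarrow> q * p \<in> relations"
  using ideal.I_l_closed[OF ideal_relations, of p q] by simp

lemma relations_subset: "relations \<subseteq> pc6"
  using additive_subgroup.a_subset[OF ideal.axioms(1)[OF ideal_relations]] by simp

text \<open>Makes the coefficients of the two generators explicit, so that substitutions can be
  applied to an arbitrary relation.\<close>

lemma relationsE:
  assumes "p \<in> relations"
  obtains u v where "u \<in> pc6" "v \<in> pc6"
    "p = u * conic 1 2 3 + v * conic 4 5 6"
proof -
  let ?g = "conic 1 2 3" and ?h = "conic 4 5 6"
  have gh: "?g \<in> pc6" "?h \<in> pc6" using generators_pc6 by blast+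
  define K where "K = {u * ?g + v * ?h | u v. u \<in> pc6 \<and> v \<in> pc6}"
  have "ideal K P6"
  proof (rule ideal_poly_algebraI)
    show "K \<subseteq> pc6" unfolding K_def
      using gh by (auto intro!: poly_carrier_add poly_carrier_mult)
    show "0 \<in> K" unfolding K_def by (intro CollectI exI[of _ 0]) simp
    fix x y assume "x \<in> K"
    then obtain u v where x: "x = u * ?g + v * ?h" "u \<in> pc6" "v \<in> pc6" by (auto simp: K_def)
    show "x + y \<in> K" if y: "y \<in> K"
    proof -
      obtain u' v' where "y = u' * ?g + v' * ?h" "u' \<in> pc6" "v' \<in> pc6"
        using y unfolding K_def by blast
      then show ?thesis unfolding K_def using x
        by (intro CollectI exI[of _ "u + u'"] exI[of _ "v + v'"]) (auto simp: algebra_simps intro: poly_carrier_add)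
    qed
    show "y * x \<in> K" if "y \<in> pc6"
      unfolding K_def using x that
      by (intro CollectI exI[of _ "y * u"] exI[of _ "y * v"]) (auto simp: algebra_simps intro: poly_carrier_mult)
  qed
  moreover have "?g \<in> K" unfolding K_def by (intro CollectI exI[of _ 1] exI[of _ 0]) simp
  moreover have "?h \<in> K" unfolding K_def by (intro CollectI exI[of _ 0] exI[of _ 1]) simp
  ultimately have "relations \<subseteq> K" unfolding relations_def by (intro P6.genideal_minimal) blast+
  then show ?thesis using that assms unfolding K_def by blast
qed

lemma coset_eq_iff:
  assumes "p \<in> pc6" "q \<in> pc6"
  shows "coset p = coset q \<longleftrightarrow> p - q \<in> relations"
proof -
  interpret relations: ideal relations P6 by (rule ideal_relations)
  have "p - q \<in> relations \<longleftrightarrow> p \<in> coset q"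
    using relations.a_rcos_module_minus[OF P6.ring_axioms, of q p] assms
    by (simp add: coset_def minus_poly_algebra)
  also have "\<dots> \<longleftrightarrow> coset p = coset q"
    using P6.a_repr_independence[of p relations q, OF _ _ relations.a_subgroup]
      relations.a_rcos_self[of p] assms
    by (auto simp: coset_def)
  finally show ?thesis by simp
qed

lemma R_algebra_simps:
  "carrier R_algebra = coset ` pc6"
  "p \<in> pc6 \<Longrightarrow> q \<in> pc6 \<Longrightarrow> coset p \<otimes>\<^bsub>R_algebra\<^esub> coset q = coset (p * q)"
  "p \<in> pc6 \<Longrightarrow> q \<in> pc6 \<Longrightarrow> coset p \<oplus>\<^bsub>R_algebra\<^esub> coset q = coset (p + q)"
  "\<one>\<^bsub>R_algebra\<^esub> = coset 1"
  "\<zero>\<^bsub>R_algebra\<^esub> = coset 0"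
  "grade R_algebra d = coset ` hgrade vars6 (\<lambda>_. 1) d"
proof -
  interpret relations: ideal relations P6 by (rule ideal_relations)
  show "carrier R_algebra = coset ` pc6"
    by (auto simp: R_algebra_altdef quotient_algebra_def FactRing_def A_RCOSETS_def' coset_def)
  show "p \<in> pc6 \<Longrightarrow> q \<in> pc6 \<Longrightarrow> coset p \<otimes>\<^bsub>R_algebra\<^esub> coset q = coset (p * q)"
    using relations.rcoset_mult_add[of p q]
    by (simp add: R_algebra_altdef quotient_algebra_def FactRing_def coset_def)
  show "p \<in> pc6 \<Longrightarrow> q \<in> pc6 \<Longrightarrow> coset p \<oplus>\<^bsub>R_algebra\<^esub> coset q = coset (p + q)"
    using relations.a_rcos_sum[of p q]
    by (simp add: R_algebra_altdef quotient_algebra_def FactRing_def coset_def)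
  show "\<one>\<^bsub>R_algebra\<^esub> = coset 1" "grade R_algebra d = coset ` hgrade vars6 (\<lambda>_. 1) d"
    by (simp_all add: R_algebra_altdef quotient_algebra_def FactRing_def coset_def grade_poly_algebra vars6_def)
  have "coset 0 = relations"
    using P6.a_coset_add_zero[of relations] relations_subset by (simp add: coset_def)
  then show "\<zero>\<^bsub>R_algebra\<^esub> = coset 0" by (simp add: R_algebra_altdef quotient_algebra_def FactRing_def)
qed

lemma cring_R_algebra: "cring R_algebra"
proof (intro cringI abelian_groupI comm_monoidI)
  fix x assume "x \<in> carrier R_algebra"
  then obtain p where p: "p \<in> pc6" "x = coset p" by (auto simp: R_algebra_simps)
  then show "\<exists>y\<in>carrier R_algebra. y \<oplus>\<^bsub>R_algebra\<^esub> x = \<zero>\<^bsub>R_algebra\<^esub>"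
    by (intro bexI[of _ "coset (- p)"]) (auto simp: R_algebra_simps poly_carrier_uminus)
qed (auto simp: R_algebra_simps poly_carrier_add poly_carrier_mult algebra_simps)

interpretation RA: graded_cring R_algebra
proof -
  interpret cring R_algebra by (rule cring_R_algebra)
  show "graded_cring R_algebra"
  proof
    show "x \<in> grade R_algebra d \<Longrightarrow> x \<in> carrier R_algebra" for x d
      using hgrade_subset[of vars6] by (auto simp: R_algebra_simps)
    show "x \<otimes>\<^bsub>R_algebra\<^esub> y \<in> grade R_algebra (d + e)"
      if xy: "x \<in> grade R_algebra d" "y \<in> grade R_algebra e" for x y d e
    proof -
      obtain p q where pq: "x = coset p" "y = coset q" "p \<in> hgrade vars6 (\<lambda>_. 1) d" "q \<in> hgrade vars6 (\<lambda>_. 1) e"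
        using xy by (auto simp: R_algebra_simps)
      then have "p \<in> pc6" "q \<in> pc6" using hgrade_subset by blast+
      then show ?thesis using pq hgrade_mult[OF pq(3,4)] by (auto simp: R_algebra_simps)
    qed
    show "\<one>\<^bsub>R_algebra\<^esub> \<in> grade R_algebra 0" by (auto simp: R_algebra_simps hgrade_1)
  qed
qed

section \<open>Congruences modulo points of X\<close>

definition subst :: "(nat \<Rightarrow> cpoly) \<Rightarrow> cpoly \<Rightarrow> cpoly" where
  "subst v = peval (\<lambda>c. const c) v"

interpretation const_hom: coeff_hom "\<lambda>c. const c"
  by standard (simp_all add: single_add mult_single)

lemma subst_hom [simp]:
  "subst v 0 = 0" "subst v 1 = 1" "subst v (const c) = const c" "subst v (Var i) = v i"
  "subst v (p + q) = subst v p + subst v q" "subst v (p - q) = subst v p - subst v q"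
  "subst v (p * q) = subst v p * subst v q" "subst v (p ^ k) = subst v p ^ k"
  unfolding subst_def by simp_all

abbreviation "hg6 \<equiv> hgrade vars6 (\<lambda>_. 1)"

lemma hg6_pc6: "p \<in> hg6 d \<Longrightarrow> p \<in> pc6"
  using hgrade_subset by blast

lemma coset_eq_0_iff: "p \<in> pc6 \<Longrightarrow> coset p = coset 0 \<longleftrightarrow> p \<in> relations"
  by (simp add: coset_eq_iff)

lemma ideal_R_coset:
  assumes "ideal K R_algebra"
  shows "coset 0 \<in> K"
    "p \<in> pc6 \<Longrightarrow> q \<in> pc6 \<Longrightarrow> coset p \<in> K \<Longrightarrow> coset q \<in> K \<Longrightarrow> coset (p + q) \<in> K"
    "p \<in> pc6 \<Longrightarrow> q \<in> pc6 \<Longrightarrow> coset p \<in> K \<Longrightarrow> coset (q * p) \<in> K"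
proof -
  interpret ideal K R_algebra by fact
  show "coset 0 \<in> K" using zero_closed by (simp add: R_algebra_simps)
  show "p \<in> pc6 \<Longrightarrow> q \<in> pc6 \<Longrightarrow> coset p \<in> K \<Longrightarrow> coset q \<in> K \<Longrightarrow> coset (p + q) \<in> K"
    using a_closed[of "coset p" "coset q"] by (simp add: R_algebra_simps)
  show "p \<in> pc6 \<Longrightarrow> q \<in> pc6 \<Longrightarrow> coset p \<in> K \<Longrightarrow> coset (q * p) \<in> K"
    using I_l_closed[of "coset p" "coset q"] by (simp add: R_algebra_simps)
qed

text \<open>If each variable is congruent to its substitute modulo K, then so is each polynomial.
  Used for the constant term, for killing a block, and for the diagonal line.\<close>

lemma coset_diff_subst_mem:
  assumes K: "ideal K R_algebra" and v: "\<And>t. t \<in> vars6 \<Longrightarrow> v t \<in> pc6 \<and> coset (Var t - v t) \<in> K"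
    and "p \<in> pc6"
  shows "subst v p \<in> pc6 \<and> coset (p - subst v p) \<in> K"
  using assms(3)
proof (induction p rule: poly_carrier_induct)
  case (const c)
  then show ?case using ideal_R_coset(1)[OF K] by simp
next
  case (Var i)
  then show ?case using v by simp
next
  case (add p q)
  have eq: "p + q - subst v (p + q) = (p - subst v p) + (q - subst v q)" by simp
  have "p - subst v p \<in> pc6" "q - subst v q \<in> pc6" using add by (auto intro: pc6_minus)
  then show ?case unfolding eq using add ideal_R_coset(2)[OF K, of "p - subst v p" "q - subst v q"]
    by (simp add: poly_carrier_add)
next
  case (mult p q)
  have eq: "p * q - subst v (p * q) = p * (q - subst v q) + subst v q * (p - subst v p)"
    by (simp add: algebra_simps)
  have cl: "p - subst v p \<in> pc6" "q - subst v q \<in> pc6" using mult by (auto intro: pc6_minus)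
  have "coset (p * (q - subst v q)) \<in> K" "coset (subst v q * (p - subst v p)) \<in> K"
    using mult cl ideal_R_coset(3)[OF K] by blast+
  then show ?case unfolding eq
    using mult cl ideal_R_coset(2)[OF K, of "p * (q - subst v q)" "subst v q * (p - subst v p)"]
    by (simp add: poly_carrier_mult)
qed

lemma R_point_ideal: "x \<in> proj_points R_algebra \<Longrightarrow> ideal x R_algebra"
  by (rule RA.proj_points_prime(1))

lemma R_point_prime:
  assumes "x \<in> proj_points R_algebra" "p \<in> pc6" "q \<in> pc6"
  shows "coset (p * q) \<in> x \<longleftrightarrow> coset p \<in> x \<or> coset q \<in> x"
proof
  assume "coset (p * q) \<in> x"
  then show "coset p \<in> x \<or> coset q \<in> x"
    using RA.proj_points_prime(3)[OF assms(1), of "coset p" "coset q"] assms(2,3)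
    by (auto simp: R_algebra_simps)
next
  assume "coset p \<in> x \<or> coset q \<in> x"
  then show "coset (p * q) \<in> x"
    using ideal_R_coset(3)[OF R_point_ideal[OF assms(1)]] assms(2,3) by (metis mult.commute)
qed

text \<open>A point containing all variables would contain all forms of positive degree, hence the
  irrelevant ideal. The variable found here serves as denominator in an affine chart around
  x.\<close>

lemma point_misses_variable:
  assumes x: "x \<in> proj_points R_algebra"
  obtains t where "t \<in> vars6" "coset (Var t) \<notin> x"
proof (rule ccontr)
  assume "\<not> thesis"
  then have all: "coset (Var t) \<in> x" if "t \<in> vars6" for t using that \<open>\<And>t. t \<in> vars6 \<Longrightarrow> coset (Var t) \<notin> x \<Longrightarrow> thesis\<close> by blast
  have K: "ideal x R_algebra" using R_point_ideal[OF x] .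
  have "coset p \<in> x" if p: "p \<in> hg6 d" "1 \<le> d" for p d
  proof -
    \<comment> \<open>Setting t = 0 in \<open>weigh\<close> leaves the constant term, which a form
      of positive degree does not have.\<close>
    have "poly (weigh (\<lambda>_. 1) p) 0 = subst (\<lambda>_. 0) p"
      using hg6_pc6[OF p(1)] by (induction p rule: poly_carrier_induct) (auto simp: poly_monom)
    moreover have "weigh (\<lambda>_. 1) p = monom p d" using p by (simp add: hgrade_def)
    ultimately have "subst (\<lambda>_. 0) p = 0" using p(2) by (simp add: poly_monom power_0_left)
    then show ?thesis
      using coset_diff_subst_mem[OF K, of "\<lambda>_. 0" p] all hg6_pc6[OF p(1)] by simp
  qed
  then have "(\<Union>d\<in>{1..}. grade R_algebra d) \<subseteq> x" by (auto simp: R_algebra_simps)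
  then have "irrelevant_ideal R_algebra \<subseteq> x"
    unfolding irrelevant_ideal_def by (rule RA.genideal_minimal[OF K])
  then show False using x by (simp add: proj_points_def)
qed

text \<open>
  The two blocks of variables \<open>x\<^sub>i, x\<^sub>j, x\<^sub>k\<close> and \<open>x\<^sub>l, x\<^sub>m, x\<^sub>n\<close>, in any order compatible
  with the symmetries of the relations \<open>x\<^sub>j\<^sup>2 = x\<^sub>i x\<^sub>k\<close> and \<open>x\<^sub>m\<^sup>2 = x\<^sub>l x\<^sub>n\<close>.
\<close>

definition blocks :: "nat \<Rightarrow> nat \<Rightarrow> nat \<Rightarrow> nat \<Rightarrow> nat \<Rightarrow> nat \<Rightarrow> bool" where
  "blocks i j k l m n \<longleftrightarrow>
     (i, j, k) \<in> {(1, 2, 3), (3, 2, 1)} \<and> (l, m, n) \<in> {(4, 5, 6), (6, 5, 4)} \<or>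
     (i, j, k) \<in> {(4, 5, 6), (6, 5, 4)} \<and> (l, m, n) \<in> {(1, 2, 3), (3, 2, 1)}"

lemma blocks_vars:
  assumes "blocks i j k l m n"
  shows "{i, j, k, l, m, n} \<subseteq> vars6" "i \<noteq> j" "i \<noteq> k" "j \<noteq> k" "{l, m, n} \<inter> {i, j, k} = {}"
  using assms by (auto simp: blocks_def)

lemma blocks_swap: "blocks i j k l m n \<Longrightarrow> blocks k j i l m n"
  by (auto simp: blocks_def)

lemma blocks_relations:
  assumes "blocks i j k l m n"
  shows "conic i j k \<in> relations" "conic l m n \<in> relations"
    "p \<in> relations \<Longrightarrow> \<exists>u\<in>pc6. \<exists>v\<in>pc6. p = u * conic i j k + v * conic l m n"
proof -
  have flip: "conic i j k = conic k j i" for i j k by (simp add: conic_def mult.commute)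
  have eq: "conic i j k = conic 1 2 3 \<and> conic l m n = conic 4 5 6 \<or>
      conic i j k = conic 4 5 6 \<and> conic l m n = conic 1 2 3"
    using assms flip[of 3 2 1] flip[of 6 5 4] by (auto simp: blocks_def)
  then show "conic i j k \<in> relations" "conic l m n \<in> relations" using generators_mem by auto
  assume "p \<in> relations"
  then obtain u v where "u \<in> pc6" "v \<in> pc6" "p = u * conic 1 2 3 + v * conic 4 5 6"
    by (rule relationsE)
  then show "\<exists>u\<in>pc6. \<exists>v\<in>pc6. p = u * conic i j k + v * conic l m n"
    using eq by (metis add.commute)
qed

text \<open>
  At a point of the plane \<open>x\<^sub>i = x\<^sub>j = x\<^sub>k = 0\<close> the cone over the conic is singular: a relation
  \<open>x\<^sub>i P = x\<^sub>j Q\<close>, compared in the terms linear in \<open>x\<^sub>i\<close> only, forces \<open>P\<close> to vanish there.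
\<close>

lemma linear_syzygy_vanishes:
  assumes b: "blocks i j k l m n" and x: "x \<in> proj_points R_algebra"
    and vx: "coset (Var i) \<in> x" "coset (Var j) \<in> x" "coset (Var k) \<in> x"
    and PQ: "P \<in> pc6" "Q \<in> pc6" "P * Var i - Q * Var j \<in> relations"
  shows "coset P \<in> x"
proof -
  define v where "v t = (if t \<in> {i, j, k} then 0 else Var t)" for t
  \<comment> \<open>Sets x_j and x_k to 0 and makes x_i the polynomial variable T; the coefficient
    of T is the part linear in x_i.\<close>
  define s where "s = peval (\<lambda>c. [:const c:])
    (\<lambda>t. if t = i then [:0, 1:] else if t = j \<or> t = k then 0 else [:Var t:])"
  have s_hom [simp]: "s (p + q) = s p + s q" "s (p - q) = s p - s q" "s (p * q) = s p * s q"
    "s (p ^ 2) = s p ^ 2" "s (const c) = [:const c:]" for p q c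
    unfolding s_def by simp_all
  have s_Var: "s (Var t) = (if t = i then [:0, 1:] else if t = j \<or> t = k then 0 else [:Var t:])" for t
    unfolding s_def by simp
  have s0: "coeff (s p) 0 = subst v p" if "p \<in> pc6" for p
    using that by (induction p rule: poly_carrier_induct) (auto simp: s_Var v_def coeff_mult_0)
  have sp: "s p \<in> polys_over pc6" if "p \<in> pc6" for p
    using that
  proof (induction p rule: poly_carrier_induct)
    case (const c)
    then show ?case by (auto simp: polys_over_def coeff_pCons split: nat.split)
  next
    case (Var t)
    then show ?case
      by (auto simp: s_Var polys_over_def coeff_pCons Var_mem_poly_carrier split: nat.split)
  qed (auto intro: polys_over_poly_carrier)
  obtain u w where uw: "u \<in> pc6" "w \<in> pc6" "P * Var i - Q * Var j = u * conic i j k + w * conic l m n"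
    using blocks_relations(3)[OF b PQ(3)] by blast
  \<comment> \<open>The first conic lies in the ideal (x_j, x_k) and dies; the second is constant in
    T.\<close>
  have conics: "s (conic i j k) = 0" "s (conic l m n) = [:conic l m n:]"
    using blocks_vars[OF b] by (auto simp: conic_def s_Var power2_eq_square)
  have "s P * [:0, 1:] = s (P * Var i - Q * Var j)"
    using blocks_vars[OF b] by (simp add: s_Var)
  also have "\<dots> = s w * [:conic l m n:]" unfolding uw(3) by (simp add: conics)
  \<comment> \<open>On the left this is P with the block set to 0; on the right it is a multiple of
    the second conic, hence zero in R.\<close>
  finally have "coeff (s P * [:0, 1:]) 1 = coeff (s w * [:conic l m n:]) 1" by simp
  then have "subst v P = coeff (s w) 1 * conic l m n" using s0[OF PQ(1)] by (simp add: mult.commute)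
  moreover have "coeff (s w) 1 \<in> pc6" using sp[OF uw(2)] by (simp add: polys_over_def)
  ultimately have rel: "subst v P \<in> relations" using relations_mult blocks_relations(2)[OF b] by simp
  note K = R_point_ideal[OF x]
  have vt: "v t \<in> pc6 \<and> coset (Var t - v t) \<in> x" if "t \<in> vars6" for t
    using that vx ideal_R_coset(1)[OF K] by (auto simp: v_def)
  then have d: "subst v P \<in> pc6 \<and> coset (P - subst v P) \<in> x"
    using coset_diff_subst_mem[OF K _ PQ(1)] by blast
  have "coset (subst v P) \<in> x" using rel d coset_eq_0_iff ideal_R_coset(1)[OF K] by metis
  then show ?thesis using ideal_R_coset(2)[OF K _ _ conjunct2[OF d]] d PQ(1) pc6_minus by fastforce
qed

text \<open>A point in the torus: the generic point of the line \<open>x\<^sub>1 = x\<^sub>2 = x\<^sub>3, x\<^sub>4 = x\<^sub>5 = x\<^sub>6\<close>.\<close>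

definition diagonal :: "cpoly \<Rightarrow> cpoly" where
  "diagonal = subst (\<lambda>t. if t \<le> 3 then Var 1 else Var 4)"

definition line_point :: "cpoly set set" where
  "line_point = coset ` {p \<in> pc6. diagonal p = 0}"

lemma diagonal_hom [simp]:
  "diagonal 0 = 0" "diagonal 1 = 1" "diagonal (p + q) = diagonal p + diagonal q"
  "diagonal (p - q) = diagonal p - diagonal q" "diagonal (p * q) = diagonal p * diagonal q"
  "diagonal (Var i) = (if i \<le> 3 then Var 1 else Var 4)"
  by (simp_all add: diagonal_def)

lemma diagonal_relations: "p \<in> relations \<Longrightarrow> diagonal p = 0"
  by (elim relationsE) (simp add: conic_def power2_eq_square)

lemma coset_mem_line_point_iff:
  assumes "p \<in> pc6"
  shows "coset p \<in> line_point \<longleftrightarrow> diagonal p = 0"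
proof
  assume "coset p \<in> line_point"
  then obtain q where q: "q \<in> pc6" "coset p = coset q" "diagonal q = 0" by (auto simp: line_point_def)
  then have "diagonal (p - q) = 0" using assms coset_eq_iff diagonal_relations by blast
  then show "diagonal p = 0" using q by simp
qed (use assms in \<open>auto simp: line_point_def\<close>)

lemma Var_nonzero [simp]: "Var i \<noteq> 0"
  by (simp add: Var_def) (metis lookup_single_eq lookup_zero zero_neq_one)

lemma line_point_Var: "t \<in> vars6 \<Longrightarrow> coset (Var t) \<notin> line_point"
  by (simp add: coset_mem_line_point_iff)

text \<open>\<open>diagonal\<close> maps into a domain and kills the relations, so its kernel gives
  a prime. It is homogeneous because it is generated by the linear forms x_t -
  \<open>diagonal\<close> x_t.\<close>

lemma line_point_in_proj: "line_point \<in> proj_points R_algebra"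
proof -
  have sub: "line_point \<subseteq> carrier R_algebra" by (auto simp: line_point_def R_algebra_simps)
  have cl: "coset (p + q) \<in> line_point" "coset (r * p) \<in> line_point"
    if "p \<in> pc6" "q \<in> pc6" "r \<in> pc6" "coset p \<in> line_point" "coset q \<in> line_point" for p q r
    using that by (simp_all add: coset_mem_line_point_iff poly_carrier_add poly_carrier_mult)
  have idl: "ideal line_point R_algebra"
  proof (rule idealI)
    show "ring R_algebra" by (rule RA.ring_axioms)
    show "subgroup line_point (add_monoid R_algebra)"
    proof (rule subgroup.intro)
      show "line_point \<subseteq> carrier (add_monoid R_algebra)" using sub by simp
      show "\<one>\<^bsub>add_monoid R_algebra\<^esub> \<in> line_point"
        by (simp add: R_algebra_simps coset_mem_line_point_iff)
    next
      fix X Y assume "X \<in> line_point" "Y \<in> line_point"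
      then show "X \<otimes>\<^bsub>add_monoid R_algebra\<^esub> Y \<in> line_point"
        by (auto simp: line_point_def R_algebra_simps intro!: imageI poly_carrier_add)
    next
      fix X assume "X \<in> line_point"
      then obtain p where p: "p \<in> pc6" "diagonal p = 0" "X = coset p" by (auto simp: line_point_def)
      have "\<ominus>\<^bsub>R_algebra\<^esub> X = coset (- p)"
        using p by (intro RA.minus_equality) (auto simp: R_algebra_simps poly_carrier_uminus)
      moreover have "diagonal (- p) = 0" using p(2) diagonal_hom(4)[of 0 p] by simp
      ultimately have "\<ominus>\<^bsub>R_algebra\<^esub> X \<in> line_point"
        using p by (simp add: coset_mem_line_point_iff poly_carrier_uminus)
      then show "inv\<^bsub>add_monoid R_algebra\<^esub> X \<in> line_point" by (simp add: a_inv_def)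
    qed
    fix X Y assume "X \<in> line_point" "Y \<in> carrier R_algebra"
    then obtain p q where "p \<in> pc6" "q \<in> pc6" "diagonal p = 0" "X = coset p" "Y = coset q"
      by (auto simp: line_point_def R_algebra_simps)
    then show "Y \<otimes>\<^bsub>R_algebra\<^esub> X \<in> line_point" "X \<otimes>\<^bsub>R_algebra\<^esub> Y \<in> line_point"
      by (auto simp: R_algebra_simps coset_mem_line_point_iff poly_carrier_mult)
  qed
  have "primeideal line_point R_algebra"
  proof (rule primeidealI[OF idl RA.is_cring])
    have "coset 1 \<notin> line_point" by (simp add: coset_mem_line_point_iff)
    moreover have "coset 1 \<in> carrier R_algebra" by (simp add: R_algebra_simps)
    ultimately show "carrier R_algebra \<noteq> line_point" by metis
    fix X Y assume "X \<in> carrier R_algebra" "Y \<in> carrier R_algebra" "X \<otimes>\<^bsub>R_algebra\<^esub> Y \<in> line_point"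
    then show "X \<in> line_point \<or> Y \<in> line_point"
      by (auto simp: R_algebra_simps coset_mem_line_point_iff poly_carrier_mult)
  qed
  moreover have "line_point = genideal R_algebra (line_point \<inter> homog R_algebra)" (is "_ = ?K")
  proof
    have K: "ideal ?K R_algebra" by (rule RA.genideal_ideal) (use sub in blast)
    have Var_diff: "coset (Var t - diagonal (Var t)) \<in> ?K" if t: "t \<in> vars6" for t
    proof -
      have "Var t - diagonal (Var t) \<in> hg6 1"
        unfolding hgrade_def using t by (auto intro: pc6_minus simp: weigh_def diff_monom)
      then have "coset (Var t - diagonal (Var t)) \<in> homog R_algebra"
        by (intro RA.grade_homog[of _ 1]) (simp only: R_algebra_simps imageI)
      moreover have "coset (Var t - diagonal (Var t)) \<in> line_point"
        using t by (subst coset_mem_line_point_iff) (auto intro: pc6_minus)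
      ultimately show ?thesis using RA.genideal_self[of "line_point \<inter> homog R_algebra"] sub by blast
    qed
    have "coset (p - diagonal p) \<in> ?K" if p: "p \<in> pc6" for p
    proof -
      have "(if t \<le> 3 then Var 1 else Var 4) \<in> pc6 \<and>
          coset (Var t - (if t \<le> 3 then Var 1 else Var 4)) \<in> ?K" if "t \<in> vars6" for t
        using Var_diff[OF that] unfolding diagonal_hom by simp
      from coset_diff_subst_mem[OF K this p] show ?thesis unfolding diagonal_def by blast
    qed
    then show "line_point \<subseteq> ?K" by (force simp: line_point_def)
    show "?K \<subseteq> line_point" by (rule RA.genideal_minimal[OF idl]) blast
  qed
  moreover have "\<not> irrelevant_ideal R_algebra \<subseteq> line_point"
  proof -
    have "coset (Var 1) \<in> grade R_algebra 1" using hgrade_Var[of 1 vars6 "\<lambda>_. 1"]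
      by (auto simp: R_algebra_simps)
    then have "coset (Var 1) \<in> irrelevant_ideal R_algebra" unfolding irrelevant_ideal_def
      using RA.genideal_self[of "\<Union>d\<in>{1..}. grade R_algebra d"] RA.grade_closed by blast
    then show ?thesis using line_point_Var[of 1] by auto
  qed
  ultimately show ?thesis using idl by (simp add: proj_points_def homogeneous_ideal_def)
qed

text \<open>The degrees in x_1 of the two sides have different parity.\<close>

lemma ratio_not_square:
  assumes "G * G * Var 1 = F * F * Var 4" "G \<noteq> 0"
  shows False
proof -
  have nz: "F \<noteq> 0" using assms by auto
  have "unfold_var 1 (G * G * Var 1) = unfold_var 1 (F * F * Var 4)" using assms(1) by simp
  then have "unfold_var 1 G * unfold_var 1 G * [:0, 1:] = unfold_var 1 F * unfold_var 1 F * [:Var 4:]"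
    by (simp del: mult_pCons_right)
  then have "degree (unfold_var 1 G * unfold_var 1 G * [:0, 1:]) =
      degree (unfold_var 1 F * unfold_var 1 F * [:Var 4:])" by simp
  then have "2 * degree (unfold_var 1 G) + 1 = 2 * degree (unfold_var 1 F)"
    using assms(2) nz by (simp add: degree_mult_eq del: mult_pCons_right)
  then show False by presburger
qed

section \<open>Rational functions on X as quotients of polynomials\<close>

definition frac_on :: "cpoly set set set \<Rightarrow> cpoly \<Rightarrow> cpoly \<Rightarrow> bool" where
  "frac_on U p q \<longleftrightarrow> openin (proj_topology R_algebra) U \<and>
     (\<exists>d. p \<in> hg6 d \<and> q \<in> hg6 d) \<and> (\<forall>x\<in>U. coset q \<notin> x)"

lemma frac_onD:
  assumes "frac_on U p q"
  shows "openin (proj_topology R_algebra) U" "U \<subseteq> proj_points R_algebra" "p \<in> pc6" "q \<in> pc6"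
    "\<And>x. x \<in> U \<Longrightarrow> RA.is_frac x (coset p) (coset q)"
proof -
  show U: "openin (proj_topology R_algebra) U" using assms by (simp add: frac_on_def)
  show "U \<subseteq> proj_points R_algebra" by (rule RA.open_subset_points[OF U])
  obtain d where d: "p \<in> hg6 d" "q \<in> hg6 d" using assms by (auto simp: frac_on_def)
  then show "p \<in> pc6" "q \<in> pc6" by (simp_all add: hg6_pc6)
  have "coset p \<in> grade R_algebra d" "coset q \<in> grade R_algebra d"
    using d by (simp_all add: R_algebra_simps)
  then show "RA.is_frac x (coset p) (coset q)" if "x \<in> U" for x
    using assms that by (auto simp: frac_on_def RA.is_frac_def)
qed

lemma frac_on_mono:
  "frac_on U p q \<Longrightarrow> openin (proj_topology R_algebra) W \<Longrightarrow> W \<subseteq> U \<Longrightarrow> frac_on W p q"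
  unfolding frac_on_def by blast

lemma frac_on_mult:
  assumes "frac_on U p q" "frac_on U p' q'"
  shows "frac_on U (p * p') (q * q')"
proof -
  obtain d e where de: "p \<in> hg6 d" "q \<in> hg6 d" "p' \<in> hg6 e" "q' \<in> hg6 e"
    using assms by (auto simp: frac_on_def)
  have "coset (q * q') \<notin> x" if "x \<in> U" for x
  proof -
    have "x \<in> proj_points R_algebra" using that frac_onD(2)[OF assms(1)] by blast
    then show ?thesis
      using R_point_prime[OF _ frac_onD(4)[OF assms(1)] frac_onD(4)[OF assms(2)]] that assms
      by (simp add: frac_on_def)
  qed
  moreover have "\<exists>d. p * p' \<in> hg6 d \<and> q * q' \<in> hg6 d"
    using hgrade_mult[OF de(1,3)] hgrade_mult[OF de(2,4)] by blast
  ultimately show ?thesis using assms(1) by (simp add: frac_on_def)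
qed

definition D_var :: "nat \<Rightarrow> cpoly set set set" where
  "D_var k = RA.basic_open (coset (Var k))"

lemma mem_D_var: "x \<in> D_var k \<longleftrightarrow> x \<in> proj_points R_algebra \<and> coset (Var k) \<notin> x"
  by (simp add: D_var_def RA.basic_open_def)

lemma open_D_var: "k \<in> vars6 \<Longrightarrow> openin (proj_topology R_algebra) (D_var k)"
  unfolding D_var_def
proof (rule RA.openin_basic_open)
  assume "k \<in> vars6"
  then have "coset (Var k) \<in> grade R_algebra 1"
    unfolding R_algebra_simps by (intro imageI hgrade_Var[where a = "\<lambda>_. 1"])
  then show "coset (Var k) \<in> homog R_algebra" by (rule RA.grade_homog)
qed

lemma frac_on_D_var:
  assumes "i \<in> vars6" "k \<in> vars6"
  shows "frac_on (D_var k) (Var i) (Var k)"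
proof -
  have "Var i \<in> hg6 1" "Var k \<in> hg6 1" using assms hgrade_Var[of _ vars6 "\<lambda>_. 1"] by blast+
  then have "\<exists>d. Var i \<in> hg6 d \<and> Var k \<in> hg6 d" by blast
  then show ?thesis using open_D_var[OF assms(2)] by (simp add: frac_on_def mem_D_var)
qed

lemma line_point_D_var: "k \<in> vars6 \<Longrightarrow> line_point \<in> D_var k"
  using line_point_in_proj line_point_Var by (simp add: mem_D_var)

lemma relations_0 [simp]: "0 \<in> relations"
  using additive_subgroup.zero_closed[OF ideal.axioms(1)[OF ideal_relations]] by simp

lemma relations_diff: "p \<in> relations \<Longrightarrow> q \<in> relations \<Longrightarrow> p - q \<in> relations"
  using additive_subgroup.a_closed[OF ideal.axioms(1)[OF ideal_relations], of p "- q"]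
    relations_mult[of q "- 1"] by (simp add: poly_carrier_uminus)

section \<open>Dictionary between fractions on X and on the weighted projective space\<close>

locale X_iso = weighted_proj_iso I a R_algebra \<phi> \<psi> for I a \<phi> \<psi>
begin

text \<open>p / q on X and A / B on the weighted projective space are the same function. Products
  and relations pass across, so later arguments only cross-multiply.\<close>

definition rep :: "cpoly set set set \<Rightarrow> cpoly \<Rightarrow> cpoly \<Rightarrow> cpoly \<Rightarrow> cpoly \<Rightarrow> bool" where
  "rep U p q A B \<longleftrightarrow> frac_on U p q \<and> represents U (RA.frac_sec U (coset p) (coset q)) A B"

lemma repD:
  assumes "rep U p q A B"
  shows "frac_on U p q" "represents U (RA.frac_sec U (coset p) (coset q)) A B"
    "\<exists>d. A \<in> gr d \<and> B \<in> gr d" "B \<noteq> 0" "A \<in> poly_carrier I" "B \<in> poly_carrier I"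
proof -
  show 1: "frac_on U p q" "represents U (RA.frac_sec U (coset p) (coset q)) A B"
    using assms by (auto simp: rep_def)
  show 2: "\<exists>d. A \<in> gr d \<and> B \<in> gr d" "B \<noteq> 0" using 1(2) by (auto simp: represents_def S.is_frac_def)
  show "A \<in> poly_carrier I" "B \<in> poly_carrier I" using 2(1) gr_closed by blast+
qed

lemma rep_exists:
  assumes "frac_on U p q" "x \<in> U"
  obtains A B where "rep U p q A B" "B \<notin> \<phi> x"
proof -
  note f = frac_onD[OF assms(1)]
  obtain A B where "represents U (RA.frac_sec U (coset p) (coset q)) A B" "B \<notin> \<phi> x"
    using represents_exists[OF f(1) RA.frac_sec_regular[OF f(1,5)] assms(2)] by metis
  then show ?thesis using that assms(1) by (auto simp: rep_def)
qed

lemma rep_restrict: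
  assumes "rep U p q A B" "openin (proj_topology R_algebra) W" "W \<subseteq> U" "W \<noteq> {}"
  shows "rep W p q A B"
  using represents_frac_restrict[OF frac_onD(1)[OF repD(1)[OF assms(1)]] assms(2-4) repD(2)[OF assms(1)]]
    frac_on_mono[OF repD(1)[OF assms(1)] assms(2,3)] by (simp add: rep_def)

lemma rep_mult:
  assumes "rep U p q A B" "rep U p' q' A' B'" "U \<noteq> {}"
  shows "rep U (p * p') (q * q') (A * A') (B * B')"
proof -
  note f = frac_onD[OF repD(1)[OF assms(1)]] and f' = frac_onD[OF repD(1)[OF assms(2)]]
  have "RA.frac_sec U (coset p) (coset q) \<otimes>\<^bsub>proj_sections R_algebra U\<^esub> RA.frac_sec U (coset p') (coset q')
      = RA.frac_sec U (coset (p * p')) (coset (q * q'))"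
    using RA.frac_sec_mult[OF f(2,5) f'(5)] f(3,4) f'(3,4) by (simp add: R_algebra_simps)
  then have "represents U (RA.frac_sec U (coset (p * p')) (coset (q * q'))) (A * A') (B * B')"
    using represents_mult[OF f(1) assms(3) repD(2)[OF assms(1)] repD(2)[OF assms(2)]] by simp
  then show ?thesis using frac_on_mult[OF repD(1)[OF assms(1)] repD(1)[OF assms(2)]] by (simp add: rep_def)
qed

lemma rep_unique:
  assumes "rep U p q A B" "rep U p' q' A' B'" "p * q' - p' * q \<in> relations"
  shows "A * B' = A' * B"
proof -
  note f = frac_onD[OF repD(1)[OF assms(1)]] and f' = frac_onD[OF repD(1)[OF assms(2)]]
  have "coset (p * q') = coset (p' * q)"
    using assms(3) f(3,4) f'(3,4) by (subst coset_eq_iff) (auto intro: poly_carrier_mult)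
  then have "RA.frac_sec U (coset p) (coset q) = RA.frac_sec U (coset p') (coset q')"
    using f(3,4) f'(3,4) by (intro RA.frac_sec_cong[OF f(2,5) f'(5)]) (auto simp: R_algebra_simps)
  then show ?thesis using represents_unique[OF f(1) repD(2)[OF assms(1)]] repD(2)[OF assms(2)] by simp
qed

text \<open>Converse of \<open>rep_unique\<close>. Equality of classes at x only gives a relation up
  to a multiplier h that is invertible at x.\<close>

lemma rep_eqD:
  assumes "rep U p q A B" "rep U p' q' A' B'" "A * B' = A' * B" "x \<in> U"
  obtains h where "h \<in> pc6" "coset h \<notin> x" "h * (p * q') - h * (p' * q) \<in> relations"
proof -
  note f = frac_onD[OF repD(1)[OF assms(1)]] and f' = frac_onD[OF repD(1)[OF assms(2)]]
  have "S.is_frac {0} A' B'" using repD(2)[OF assms(2)] by (simp add: represents_def)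
  then have "represents U (RA.frac_sec U (coset p) (coset q)) A' B'"
    using represents_cong[OF repD(2)[OF assms(1)] _ assms(3)] by blast
  then have "RA.frac_sec U (coset p) (coset q) = RA.frac_sec U (coset p') (coset q')"
    using represents_inj[OF f(1) _ repD(2)[OF assms(2)]] by blast
  then have "RA.frac_sec U (coset p) (coset q) x = RA.frac_sec U (coset p') (coset q') x" by simp
  then have "hfrac R_algebra x (coset p) (coset q) = hfrac R_algebra x (coset p') (coset q')"
    using assms(4) by (simp add: RA.frac_sec_def)
  then obtain H where H: "H \<in> homog R_algebra - x"
    "H \<otimes>\<^bsub>R_algebra\<^esub> (coset p \<otimes>\<^bsub>R_algebra\<^esub> coset q') = H \<otimes>\<^bsub>R_algebra\<^esub> (coset p' \<otimes>\<^bsub>R_algebra\<^esub> coset q)"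
    using RA.hfrac_eq_iff[of x, OF _ f(5) f'(5)] assms(4) f(2) by blast
  then obtain h where h: "h \<in> pc6" "H = coset h" using RA.homog_closed by (auto simp: R_algebra_simps)
  have "coset (h * (p * q')) = coset (h * (p' * q))"
    using H(2) h f(3,4) f'(3,4) by (simp add: R_algebra_simps poly_carrier_mult)
  then have "h * (p * q') - h * (p' * q) \<in> relations"
    using h f(3,4) f'(3,4) by (subst (asm) coset_eq_iff) (auto intro: poly_carrier_mult)
  then show ?thesis using that h H(1) by blast
qed

lemma rep_unit:
  assumes "rep U p q A B" "x \<in> U" "coset p \<notin> x" "B \<notin> \<phi> x"
  shows "A \<notin> \<phi> x"
  using represents_unit[OF frac_onD(1,5)[OF repD(1)[OF assms(1)]] assms(2,3) repD(2)[OF assms(1)] assms(4)] .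

lemma rep_nonzero:
  assumes "rep U p q A B" "x \<in> U" "coset p \<notin> x"
  shows "A \<noteq> 0"
  using represents_nonzero[OF frac_onD(1,5)[OF repD(1)[OF assms(1)]] assms(2,3) repD(2)[OF assms(1)]] .

text \<open>A fraction C / D regular at the image of x pulls back to a section, which near x is a
  quotient of two forms in x_1, ..., x_6.\<close>

lemma rep_preimage:
  assumes V: "openin (proj_topology S) V" and fr: "\<And>p. p \<in> V \<Longrightarrow> S.is_frac p C D"
    and x: "x \<in> proj_points R_algebra" "\<phi> x \<in> V"
  obtains W p q where "x \<in> W" "rep W p q C D"
proof -
  let ?U = "open_preimage (Proj R_algebra) \<phi> V"
  have xU: "x \<in> ?U" using x by (simp add: open_preimage_def Proj_def RA.topspace_proj_topology)
  obtain g where g: "regular_section R_algebra ?U g" "represents ?U g C D"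
    using represents_preimage[OF V _ fr] x(2) by blast
  obtain W b f where W: "openin (proj_topology R_algebra) W" "x \<in> W" "W \<subseteq> ?U"
    "\<And>q. q \<in> W \<Longrightarrow> RA.is_frac q b f \<and> g q = hfrac R_algebra q b f"
    using RA.regular_sectionD[OF g(1) xU] by metis
  obtain d where "b \<in> grade R_algebra d" "f \<in> grade R_algebra d"
    using W(2,4) by (auto simp: RA.is_frac_def)
  then obtain p q where pq: "p \<in> hg6 d" "q \<in> hg6 d" "b = coset p" "f = coset q"
    by (auto simp: R_algebra_simps)
  have "restrict g W = RA.frac_sec W b f"
    unfolding RA.frac_sec_def using W(4) by (intro restrict_ext) blast
  moreover have "represents W (restrict g W) C D"
    using represents_restrict[OF preimage_open(1)[OF V] W(1,3) _ g(2)] W(2) by blast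
  moreover have "frac_on W p q" using W pq by (auto simp: frac_on_def RA.is_frac_def)
  ultimately have "rep W p q C D" using pq by (simp add: rep_def)
  then show ?thesis using that W(2) by blast
qed

text \<open>A reduced fraction is defined wherever the function is: its denominator B divides that
  of any other representation, in particular of one adapted to x.\<close>

lemma coprime_denominator_nonvanishing:
  assumes "A \<in> gr d" "B \<in> gr d" "A \<noteq> 0" "no_common_prime A B" "rep U p q A B" "x \<in> U"
  shows "B \<notin> \<phi> x"
proof
  assume B: "B \<in> \<phi> x"
  obtain A' B' where 1: "rep U p q A' B'" "B' \<notin> \<phi> x" using rep_exists[OF repD(1)[OF assms(5)] assms(6)] .
  have "A' * B = B' * A" using rep_unique[OF assms(5) 1(1)] by (simp add: mult.commute)
  then have "B dvd B'"
    using no_common_prime_dvd[OF assms(2) repD(4)[OF assms(5)] repD(5)[OF assms(5)] repD(6)[OF 1(1)] assms(4)]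
    by blast
  then obtain r where r: "B' = B * r" by (elim dvdE)
  then have "r \<in> poly_carrier I"
    using poly_carrier.factor_mem2[of B r I] repD(4,6)[OF 1(1)] by simp
  moreover have "\<phi> x \<in> proj_points S"
    using point_image frac_onD(2)[OF repD(1)[OF assms(5)]] assms(6) by blast
  ultimately show False using S.proj_points_prime(4)[OF _ B, of r] r 1(2) by simp
qed

section \<open>Multiplicities of the coordinates along prime divisors\<close>

text \<open>Otherwise x_i / x_j would be regular at x, equal to some F / G there. Then G x_i = F x_j
  up to factors invertible at x, and \<open>linear_syzygy_vanishes\<close> makes G vanish at
  x.\<close>

lemma ratio_not_regular:
  assumes b: "blocks i j k l m n" and x: "x \<in> proj_points R_algebra"
    and vx: "coset (Var i) \<in> x" "coset (Var j) \<in> x" "coset (Var k) \<in> x"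
    and \<pi>: "is_prime \<pi>" "\<phi> x = {f \<in> poly_carrier I. \<pi> dvd f}"
    and t: "t \<in> vars6" "coset (Var t) \<notin> x"
    and rep_i: "rep (D_var t) (Var i) (Var t) A\<^sub>i B\<^sub>i" "B\<^sub>i \<notin> \<phi> x" "A\<^sub>i \<noteq> 0"
    and rep_j: "rep (D_var t) (Var j) (Var t) A\<^sub>j B\<^sub>j" "A\<^sub>j \<noteq> 0"
  shows "ord_at \<pi> A\<^sub>i < ord_at \<pi> A\<^sub>j"
proof (rule ccontr)
  assume le: "\<not> ?thesis"
  define p where "p = \<pi> ^ ord_at \<pi> A\<^sub>j"
  obtain b\<^sub>j where bj: "A\<^sub>j = p * b\<^sub>j" "\<not> \<pi> dvd b\<^sub>j" "b\<^sub>j \<in> poly_carrier I"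
    unfolding p_def by (rule ord_at_decomp[OF \<pi>(1) repD(5)[OF rep_j(1)] rep_j(2)])
  obtain b\<^sub>i where bi: "A\<^sub>i = \<pi> ^ ord_at \<pi> A\<^sub>i * b\<^sub>i"
    by (rule ord_at_decomp[OF \<pi>(1) repD(5)[OF rep_i(1)] rep_i(3)])
  define c where "c = \<pi> ^ (ord_at \<pi> A\<^sub>i - ord_at \<pi> A\<^sub>j) * b\<^sub>i"
  have "\<pi> ^ ord_at \<pi> A\<^sub>i * b\<^sub>i = p * c"
    using le unfolding p_def c_def mult.assoc[symmetric] power_add[symmetric] by simp
  with bi have c: "A\<^sub>i = p * c" by (rule trans)
  obtain d\<^sub>i d\<^sub>j where d: "A\<^sub>i \<in> gr d\<^sub>i" "B\<^sub>i \<in> gr d\<^sub>i" "A\<^sub>j \<in> gr d\<^sub>j" "B\<^sub>j \<in> gr d\<^sub>j"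
    using repD(3)[OF rep_i(1)] repD(3)[OF rep_j(1)] by blast
  obtain r s where rs: "p \<in> gr r" "c \<in> gr s" "d\<^sub>i = r + s"
    using gr_factor_degrees[of p c d\<^sub>i] d(1) rep_i(3) c by blast
  obtain r' s' where rs': "p \<in> gr r'" "b\<^sub>j \<in> gr s'" "d\<^sub>j = r' + s'"
    using gr_factor_degrees[of p b\<^sub>j d\<^sub>j] d(3) rep_j(2) bj(1) by blast
  have "p \<noteq> 0" using rep_i(3) c by auto
  then have "r = r'" using hgrade_unique[OF rs(1) rs'(1)] by blast
  \<comment> \<open>C / D is the quotient of A_i / B_i by A_j / B_j after cancelling the power p of
    \<pi>; its denominator is prime to \<pi>. Cancelling the same p on both sides keeps the degrees
    equal.\<close>
  define C D where "C = c * B\<^sub>j" and "D = B\<^sub>i * b\<^sub>j"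
  have "C \<in> gr (s + d\<^sub>j)" "D \<in> gr (d\<^sub>i + s')"
    unfolding C_def D_def using hgrade_mult d rs rs' by blast+
  then have CD: "C \<in> gr (s + d\<^sub>j)" "D \<in> gr (s + d\<^sub>j)" using rs(3) rs'(3) \<open>r = r'\<close> by (simp_all add: ac_simps)
  have "\<not> \<pi> dvd B\<^sub>i" using rep_i(2) \<pi>(2) repD(6)[OF rep_i(1)] by blast
  then have "\<not> \<pi> dvd D" unfolding D_def using is_primeD(4)[OF \<pi>(1) repD(6)[OF rep_i(1)] bj(3)] bj(2) by blast
  then have Dx: "D \<notin> \<phi> x" using \<pi>(2) by blast
  let ?V = "S.basic_open D"
  have V: "openin (proj_topology S) ?V"
    by (rule S.openin_basic_open, rule S.grade_homog) (use CD in simp)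
  have fr: "S.is_frac q C D" if "q \<in> ?V" for q
    using that CD unfolding S.is_frac_def S.basic_open_def by auto
  have "\<phi> x \<in> ?V" using Dx point_image[OF x] by (simp add: S.basic_open_def)
  then obtain W F G where W: "x \<in> W" "rep W F G C D" using rep_preimage[OF V fr x] by blast
  let ?W = "W \<inter> D_var t"
  have xW: "x \<in> ?W" using W(1) x t by (simp add: mem_D_var)
  have oW: "openin (proj_topology R_algebra) ?W"
    using frac_onD(1)[OF repD(1)[OF W(2)]] open_D_var[OF t(1)] by blast
  have reps: "rep ?W F G C D" "rep ?W (Var i) (Var t) A\<^sub>i B\<^sub>i" "rep ?W (Var j) (Var t) A\<^sub>j B\<^sub>j"
    using rep_restrict[OF W(2) oW] rep_restrict[OF rep_i(1) oW] rep_restrict[OF rep_j(1) oW] xW by blast+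
  have "rep ?W (F * Var j) (G * Var t) (C * A\<^sub>j) (D * B\<^sub>j)"
    using rep_mult[OF reps(1,3)] xW by blast
  moreover have "A\<^sub>i * (D * B\<^sub>j) = (C * A\<^sub>j) * B\<^sub>i"
    unfolding C_def D_def c bj(1) by (simp add: mult_ac)
  ultimately obtain h where h: "h \<in> pc6" "coset h \<notin> x"
    "h * (Var i * (G * Var t)) - h * ((F * Var j) * Var t) \<in> relations"
    using rep_eqD[OF reps(2) _ _ xW] by blast
  have FG: "F \<in> pc6" "G \<in> pc6" "coset G \<notin> x"
    using frac_onD(3,4)[OF repD(1)[OF W(2)]] repD(1)[OF W(2)] W(1) by (auto simp: frac_on_def)
  \<comment> \<open>The coefficient of x_i in the relation; h, G and x_t are all nonzero at x, and
    therefore so is P.\<close>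
  define P where "P = h * (G * Var t)"
  have "P * Var i - (h * (F * Var t)) * Var j \<in> relations"
    using h(3) by (simp add: P_def mult_ac)
  moreover have P: "P \<in> pc6" "h * (F * Var t) \<in> pc6"
    unfolding P_def using h FG t by (auto intro!: poly_carrier_mult)
  ultimately have "coset P \<in> x" using linear_syzygy_vanishes[OF b x vx] by blast
  then show False
    using R_point_prime[OF x h(1), of "G * Var t"] R_point_prime[OF x FG(2), of "Var t"] h(2) FG(3) t FG(2)
    by (simp add: P_def poly_carrier_mult)
qed

lemma block_not_on_divisor:
  assumes b: "blocks i j k l m n" and x: "x \<in> proj_points R_algebra"
    and \<pi>: "is_prime \<pi>" "\<phi> x = {f \<in> poly_carrier I. \<pi> dvd f}"
  shows "coset (Var i) \<notin> x \<or> coset (Var j) \<notin> x \<or> coset (Var k) \<notin> x"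
proof (rule ccontr)
  assume "\<not> ?thesis"
  then have vx: "coset (Var i) \<in> x" "coset (Var j) \<in> x" "coset (Var k) \<in> x" by auto
  obtain t where t: "t \<in> vars6" "coset (Var t) \<notin> x" using point_misses_variable[OF x] .
  let ?U = "D_var t"
  have xU: "x \<in> ?U" using x t by (simp add: mem_D_var)
  have "\<exists>A B. rep ?U (Var u) (Var t) A B \<and> B \<notin> \<phi> x \<and> A \<noteq> 0 \<and> ord_at \<pi> B = 0" if u: "u \<in> vars6" for u
  proof -
    obtain A B where AB: "rep ?U (Var u) (Var t) A B" "B \<notin> \<phi> x"
      using rep_exists[OF frac_on_D_var[OF u t(1)] xU] .
    \<comment> \<open>x_u may vanish at x, but it is nonzero at \<open>line_point\<close>, which
      lies in every chart.\<close>
    have "A \<noteq> 0" using rep_nonzero[OF AB(1) line_point_D_var[OF t(1)] line_point_Var[OF u]] .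
    moreover have "\<not> \<pi> dvd B" using AB(2) \<pi>(2) repD(6)[OF AB(1)] by blast
    then have "ord_at \<pi> B = 0" by (rule ord_at_eq_0[OF \<pi>(1)])
    ultimately show ?thesis using AB by blast
  qed
  moreover have ijk: "i \<in> vars6" "j \<in> vars6" "k \<in> vars6" using blocks_vars(1)[OF b] by blast+
  ultimately obtain A\<^sub>i B\<^sub>i A\<^sub>j B\<^sub>j A\<^sub>k B\<^sub>k where
    i: "rep ?U (Var i) (Var t) A\<^sub>i B\<^sub>i" "B\<^sub>i \<notin> \<phi> x" "A\<^sub>i \<noteq> 0" "ord_at \<pi> B\<^sub>i = 0" and
    j: "rep ?U (Var j) (Var t) A\<^sub>j B\<^sub>j" "B\<^sub>j \<notin> \<phi> x" "A\<^sub>j \<noteq> 0" "ord_at \<pi> B\<^sub>j = 0" and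
    k: "rep ?U (Var k) (Var t) A\<^sub>k B\<^sub>k" "B\<^sub>k \<notin> \<phi> x" "A\<^sub>k \<noteq> 0" "ord_at \<pi> B\<^sub>k = 0" by metis
  have ne: "?U \<noteq> {}" using xU by blast
  \<comment> \<open>The equation x_j^2 = x_i x_k divided by x_t^4, in the cross-multiplied form of
    two fractions over x_t^2.\<close>
  have "(Var j * Var j) * (Var t * Var t) - (Var i * Var k) * (Var t * Var t) = (Var t * Var t) * conic i j k"
    by (simp add: conic_def power2_eq_square algebra_simps)
  moreover have "(Var t * Var t) * conic i j k \<in> relations"
    using relations_mult[OF blocks_relations(1)[OF b]] t by (simp add: poly_carrier_mult)
  ultimately have "(A\<^sub>j * A\<^sub>j) * (B\<^sub>i * B\<^sub>k) = (A\<^sub>i * A\<^sub>k) * (B\<^sub>j * B\<^sub>j)"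
    using rep_unique[OF rep_mult[OF j(1) j(1) ne] rep_mult[OF i(1) k(1) ne]] by simp
  then have "ord_at \<pi> ((A\<^sub>j * A\<^sub>j) * (B\<^sub>i * B\<^sub>k)) = ord_at \<pi> ((A\<^sub>i * A\<^sub>k) * (B\<^sub>j * B\<^sub>j))" by simp
  then have "ord_at \<pi> A\<^sub>j + ord_at \<pi> A\<^sub>j = ord_at \<pi> A\<^sub>i + ord_at \<pi> A\<^sub>k"
    using i(3,4) j(3,4) k(3,4) repD(4-6)[OF i(1)] repD(4-6)[OF j(1)] repD(4-6)[OF k(1)]
    by (simp add: ord_at_mult[OF \<pi>(1)] poly_carrier_mult)
  moreover have "ord_at \<pi> A\<^sub>i < ord_at \<pi> A\<^sub>j"
    using ratio_not_regular[OF b x vx \<pi> t i(1-3) j(1,3)] .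
  moreover have "ord_at \<pi> A\<^sub>k < ord_at \<pi> A\<^sub>j"
    using ratio_not_regular[OF blocks_swap[OF b] x vx(3,2,1) \<pi> t k(1-3) j(1,3)] .
  ultimately show False by simp
qed

lemma outer_variable_invertible:
  assumes b: "blocks i j k l m n" and x: "x \<in> proj_points R_algebra"
    and \<pi>: "is_prime \<pi>" "\<phi> x = {f \<in> poly_carrier I. \<pi> dvd f}"
  obtains u y where "u \<in> vars6" "y \<in> vars6" "coset (Var u) \<notin> x" "Var y * Var y - Var i * Var u \<in> relations"
proof -
  have ijk: "i \<in> vars6" "j \<in> vars6" "k \<in> vars6" using blocks_vars(1)[OF b] by blast+
  have sq: "Var j * Var j - Var i * Var k \<in> relations"
    using blocks_relations(1)[OF b] by (simp add: conic_def power2_eq_square)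
  then have "coset (Var j * Var j) = coset (Var i * Var k)"
    using ijk by (simp add: coset_eq_iff poly_carrier_mult)
  then have "coset (Var j) \<in> x \<longleftrightarrow> coset (Var i) \<in> x \<or> coset (Var k) \<in> x"
    using R_point_prime[OF x, of "Var j" "Var j"] R_point_prime[OF x, of "Var i" "Var k"] ijk by simp
  then consider "coset (Var i) \<notin> x" | "coset (Var k) \<notin> x"
    using block_not_on_divisor[OF b x \<pi>] by blast
  then show ?thesis
  proof cases
    case 1
    \<comment> \<open>When x_i itself is invertible, x_i * x_i is the required square.\<close>
    then show ?thesis using that[of i i] ijk by simp
  next
    case 2
    then show ?thesis using that[of k j] sq ijk by blast
  qed
qed

text \<open>
  Up to squares and units \<open>x\<^sub>1 / x\<^sub>4\<close> is \<open>x\<^sub>u / x\<^sub>u\<^sub>'\<close> for any outer variables of the two blocks,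
  so its divisor on \<open>X\<close> is twice a Weil divisor.
\<close>

lemma ratio_order_even:
  assumes x: "x \<in> proj_points R_algebra"
    and \<pi>: "is_prime \<pi>" "\<phi> x = {f \<in> poly_carrier I. \<pi> dvd f}"
    and AB: "rep (D_var 4) (Var 1) (Var 4) A B"
  shows "even (ord_at \<pi> A + ord_at \<pi> B)"
proof -
  have "blocks 1 2 3 4 5 6" "blocks 4 5 6 1 2 3" by (simp_all add: blocks_def)
  then obtain u y u' y' where
    u: "u \<in> vars6" "y \<in> vars6" "coset (Var u) \<notin> x" "Var y * Var y - Var 1 * Var u \<in> relations" and
    u': "u' \<in> vars6" "y' \<in> vars6" "coset (Var u') \<notin> x" "Var y' * Var y' - Var 4 * Var u' \<in> relations"
    using outer_variable_invertible[OF _ x \<pi>] by metis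
  \<comment> \<open>x may lie outside \<open>D_var 4\<close>. Invertibility at x is therefore
    checked on \<open>?W\<close>, and the identity with x_1 / x_4 on the smaller \<open>?W4\<close>,
    which is nonempty because it contains \<open>line_point\<close>.\<close>
  let ?W = "D_var u \<inter> D_var u'" and ?W4 = "D_var u \<inter> D_var u' \<inter> D_var 4"
  have xW: "x \<in> ?W" using x u u' by (simp add: mem_D_var)
  have oW: "openin (proj_topology R_algebra) ?W" "openin (proj_topology R_algebra) ?W4"
    using open_D_var[of 4] open_D_var[OF u(1)] open_D_var[OF u'(1)] by auto
  have lp: "line_point \<in> ?W4" using line_point_D_var[of 4] line_point_D_var u(1) u'(1) by simp
  have ne: "?W4 \<noteq> {}" using lp by blast
  have unit: "\<not> \<pi> dvd E" if "E \<in> poly_carrier I" "E \<notin> \<phi> x" for E using that \<pi>(2) by blast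
  have ex: "\<exists>C D. rep ?W (Var v) (Var w) C D \<and> D \<notin> \<phi> x \<and> rep ?W4 (Var v) (Var w) C D \<and> C \<noteq> 0 \<and> ord_at \<pi> D = 0"
    if "v \<in> vars6" "w \<in> {u, u'}" for v w
  proof -
    have "w \<in> vars6" "?W \<subseteq> D_var w" using that(2) u(1) u'(1) by auto
    then have f: "frac_on ?W (Var v) (Var w)"
      using frac_on_mono[OF frac_on_D_var[of v w] oW(1)] that(1) by blast
    obtain C D where CD: "rep ?W (Var v) (Var w) C D" "D \<notin> \<phi> x" using rep_exists[OF f xW] .
    have r4: "rep ?W4 (Var v) (Var w) C D" using rep_restrict[OF CD(1) oW(2) _ ne] by blast
    have "C \<noteq> 0" using rep_nonzero[OF r4 lp line_point_Var[OF that(1)]] .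
    moreover have "ord_at \<pi> D = 0"
      by (rule ord_at_eq_0[OF \<pi>(1)], rule unit) (use repD(6)[OF r4] CD(2) in auto)
    ultimately show ?thesis using CD r4 by blast
  qed
  obtain A1 B1 where 1: "rep ?W (Var u) (Var u') A1 B1" "B1 \<notin> \<phi> x" "rep ?W4 (Var u) (Var u') A1 B1"
    "A1 \<noteq> 0" "ord_at \<pi> B1 = 0" using ex[of u u'] u(1) by blast
  obtain A2 B2 where 2: "rep ?W4 (Var y) (Var u) A2 B2" "A2 \<noteq> 0" "ord_at \<pi> B2 = 0"
    using ex[of y u] u(2) by blast
  obtain A3 B3 where 3: "rep ?W4 (Var y') (Var u') A3 B3" "A3 \<noteq> 0" "ord_at \<pi> B3 = 0"
    using ex[of y' u'] u'(2) by blast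
  have "A1 \<notin> \<phi> x" using rep_unit[OF 1(1) xW u(3) 1(2)] .
  then have A1: "ord_at \<pi> A1 = 0" by (intro ord_at_eq_0[OF \<pi>(1)] unit repD(5)[OF 1(3)])
  have r4: "rep ?W4 (Var 1) (Var 4) A B" using rep_restrict[OF AB oW(2) _ ne] by blast
  have A: "A \<noteq> 0" using rep_nonzero[OF r4 lp] line_point_Var[of 1] by simp
  \<comment> \<open>Both sides of x_1 / x_4 * (y' / u')^2 = u / u' * (y / u)^2 equal x_1 / u', by
    y'^2 = x_4 u' and y^2 = x_1 u (indices standing for variables). The combination is the
    cross-multiplied difference.\<close>
  have "(Var 1 * Var u' * (Var u * Var u)) * (Var y' * Var y' - Var 4 * Var u')
      - (Var u * Var 4 * (Var u' * Var u')) * (Var y * Var y - Var 1 * Var u) \<in> relations"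
    by (intro relations_diff relations_mult[OF u(4)] relations_mult[OF u'(4)] poly_carrier_mult Var_pc6)
      (use u u' in auto)
  then have "(Var 1 * (Var y' * Var y')) * (Var u' * (Var u * Var u))
      - (Var u * (Var y * Var y)) * (Var 4 * (Var u' * Var u')) \<in> relations"
    by (simp add: algebra_simps)
  then have "(A * (A3 * A3)) * (B1 * (B2 * B2)) = (A1 * (A2 * A2)) * (B * (B3 * B3))"
    using rep_unique[OF rep_mult[OF r4 rep_mult[OF 3(1) 3(1) ne] ne] rep_mult[OF 1(3) rep_mult[OF 2(1) 2(1) ne] ne]]
    by blast
  then have "ord_at \<pi> ((A * (A3 * A3)) * (B1 * (B2 * B2))) = ord_at \<pi> ((A1 * (A2 * A2)) * (B * (B3 * B3)))"
    by simp
  then have "ord_at \<pi> A + (ord_at \<pi> A3 + ord_at \<pi> A3) = ord_at \<pi> A2 + ord_at \<pi> A2 + ord_at \<pi> B"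
    using A A1 1(4,5) 2(2,3) 3(2,3)
      repD(4-6)[OF r4] repD(4-6)[OF 1(3)] repD(4-6)[OF 2(1)] repD(4-6)[OF 3(1)]
    by (simp add: ord_at_mult[OF \<pi>(1)] poly_carrier_mult)
  then show ?thesis by presburger
qed

text \<open>The form B, of the same positive degree as A and not divisible by \<pi>, certifies that
  (\<pi>) misses part of the irrelevant ideal.\<close>

lemma prime_divisor_point:
  assumes \<pi>: "is_prime \<pi>" "\<pi> dvd A" and AB: "A \<in> gr d" "B \<in> gr d" "A \<noteq> 0" "\<not> \<pi> dvd B"
  obtains x where "x \<in> proj_points R_algebra" "\<phi> x = {f \<in> poly_carrier I. \<pi> dvd f}"
proof -
  obtain c where c: "A = \<pi> * c" using \<pi>(2) by (elim dvdE)
  obtain e f where ef: "\<pi> \<in> gr e" "d = e + f" using gr_factor_degrees[of \<pi> c d] AB(1,3) c by blast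
  then have "0 < d" using prime_degree_pos[OF \<pi>(1)] by auto
  then have "{f \<in> poly_carrier I. \<pi> dvd f} \<in> proj_points S"
    using principal_point[OF _ ef(1) AB(2) _ AB(4)] \<pi>(1) by (simp add: is_prime_def)
  then show ?thesis using that by (rule point_preimage)
qed

lemma no_isomorphism: False
proof -
  have frac: "frac_on (D_var 4) (Var 1) (Var 4)" by (rule frac_on_D_var) simp_all
  have lp4: "line_point \<in> D_var 4" by (rule line_point_D_var) simp
  obtain A0 B0 where 0: "rep (D_var 4) (Var 1) (Var 4) A0 B0" using rep_exists[OF frac lp4] .
  have "A0 \<noteq> 0" by (rule rep_nonzero[OF 0 lp4 line_point_Var]) simp
  then obtain A B d where AB: "A \<in> gr d" "B \<in> gr d" "A \<noteq> 0" "B \<noteq> 0" "A0 * B = A * B0" "no_common_prime A B"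
    using repD(3,4)[OF 0] reduced_fraction[of A0 _ B0] by metis
  have "S.is_frac {0} A B" using AB unfolding S.is_frac_def by auto
  then have rep: "rep (D_var 4) (Var 1) (Var 4) A B"
    using represents_cong[OF repD(2)[OF 0] _ AB(5)] frac by (simp add: rep_def)
  have even: "even (ord_at \<pi> A) \<and> even (ord_at \<pi> B)" if \<pi>: "is_prime \<pi>" for \<pi>
  proof -
    have nc: "\<not> \<pi> dvd A \<or> \<not> \<pi> dvd B" using AB(6) \<pi> by (auto simp: no_common_prime_def)
    show ?thesis
    proof (cases "\<pi> dvd A \<or> \<pi> dvd B")
      case True
      then obtain x where "x \<in> proj_points R_algebra" "\<phi> x = {f \<in> poly_carrier I. \<pi> dvd f}"
        using nc prime_divisor_point[OF \<pi> _ AB(1,2,3)] prime_divisor_point[OF \<pi> _ AB(2,1,4)] by blast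
      then have "even (ord_at \<pi> A + ord_at \<pi> B)" using ratio_order_even[OF _ \<pi> _ rep] by blast
      \<comment> \<open>At most one of A and B is divisible by \<pi>, so one multiplicity is 0 and
        the other equals the even sum.\<close>
      then show ?thesis using nc ord_at_eq_0[OF \<pi>, of A] ord_at_eq_0[OF \<pi>, of B] by auto
    qed (simp add: ord_at_eq_0[OF \<pi>])
  qed
  obtain C e where C: "C \<in> gr e" "A = C * C" "d = e + e" using square_root[OF AB(1,3)] even by blast
  obtain D e' where D: "D \<in> gr e'" "B = D * D" "d = e' + e'" using square_root[OF AB(2,4)] even by blast
  \<comment> \<open>Equal degrees make C / D a legitimate fraction of degree zero.\<close>
  have "e' = e" using C(3) D(3) by simp
  then have "D \<in> gr e" using D(1) by simp
  let ?V = "S.basic_open D"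
  have V: "openin (proj_topology S) ?V"
    by (rule S.openin_basic_open, rule S.grade_homog) (use D in simp)
  have fr: "S.is_frac q C D" if "q \<in> ?V" for q
    using that C(1) \<open>D \<in> gr e\<close> unfolding S.is_frac_def S.basic_open_def by auto
  note lp = line_point_in_proj
  \<comment> \<open>x_1 / x_4 is regular at \<open>line_point\<close>, so the reduced denominator B
    = D * D does not vanish at its image; hence C / D is regular there.\<close>
  have "D * D \<notin> \<phi> line_point" using coprime_denominator_nonvanishing[OF AB(1,2,3,6) rep lp4] D(2) by simp
  then have "D \<notin> \<phi> line_point"
    using S.proj_points_prime(4)[OF point_image[OF lp], of D D] gr_closed[OF D(1)] by auto
  then have "\<phi> line_point \<in> ?V" using point_image[OF lp] by (simp add: S.basic_open_def)
  then obtain W F G where W: "line_point \<in> W" "rep W F G C D" using rep_preimage[OF V fr lp] by blast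
  let ?W = "W \<inter> D_var 4"
  have lpW: "line_point \<in> ?W" using W(1) lp4 by simp
  have oW: "openin (proj_topology R_algebra) ?W"
    using frac_onD(1)[OF repD(1)[OF W(2)]] frac_onD(1)[OF frac] by blast
  have reps: "rep ?W F G C D" "rep ?W (Var 1) (Var 4) A B"
    using rep_restrict[OF W(2) oW] rep_restrict[OF rep oW] lpW by blast+
  \<comment> \<open>F / G is the pulled back square root: its square and x_1 / x_4 are represented
    by the same fraction.\<close>
  have sq: "rep ?W (F * F) (G * G) (C * C) (D * D)" using rep_mult[OF reps(1,1)] lpW by blast
  obtain h where h: "h \<in> pc6" "coset h \<notin> line_point"
    "h * ((F * F) * Var 4) - h * (Var 1 * (G * G)) \<in> relations"
    by (rule rep_eqD[OF sq reps(2) _ lpW]) (use C(2) D(2) in simp)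
  \<comment> \<open>h is invertible at \<open>line_point\<close>, so its restriction to the line is
    nonzero and cancels.\<close>
  have "diagonal h \<noteq> 0" using h by (simp add: coset_mem_line_point_iff)
  moreover have "diagonal h * (diagonal F * diagonal F * Var 4) - diagonal h * (Var 1 * (diagonal G * diagonal G)) = 0"
    using diagonal_relations[OF h(3)] by simp
  ultimately have "diagonal G * diagonal G * Var 1 = diagonal F * diagonal F * Var 4"
    by (simp add: mult.commute)
  moreover have "coset G \<notin> line_point" "G \<in> pc6"
    using repD(1)[OF W(2)] frac_onD(4)[OF repD(1)[OF W(2)]] W(1) by (auto simp: frac_on_def)
  then have "diagonal G \<noteq> 0" by (simp add: coset_mem_line_point_iff)
  ultimately show False by (rule ratio_not_square)
qed

end

theorem proposition4p4:
  shows "\<not> (\<exists>(n::nat) (a::nat \<Rightarrow> nat). (\<forall>i\<le>n. 0 < a i) \<and>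
             isomorphic_over_C X_variety (weighted_projective_space n a))"
proof
  assume "\<exists>(n::nat) (a::nat \<Rightarrow> nat). (\<forall>i\<le>n. 0 < a i) \<and>
             isomorphic_over_C X_variety (weighted_projective_space n a)"
  then obtain n a where a: "\<forall>i\<le>n. 0 < a i"
    and iso: "isomorphic_over_C (Proj R_algebra) (Proj (poly_algebra {0..n} a))"
    unfolding X_variety_def weighted_projective_space_def by blast
  let ?S = "poly_algebra {0..n} a"
  obtain \<phi> \<psi> where iso: "homeomorphic_map (space_top (Proj R_algebra)) (space_top (Proj ?S)) \<phi>"
    "\<forall>V. openin (space_top (Proj ?S)) V \<longrightarrow>
       \<psi> V \<in> algebra_iso (sections (Proj ?S) V) (sections (Proj R_algebra) (open_preimage (Proj R_algebra) \<phi> V))"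
    "\<forall>V W. openin (space_top (Proj ?S)) V \<longrightarrow> openin (space_top (Proj ?S)) W \<longrightarrow> W \<subseteq> V \<longrightarrow>
       (\<forall>s\<in>carrier (sections (Proj ?S) V). \<psi> W (restr (Proj ?S) V W s) =
         restr (Proj R_algebra) (open_preimage (Proj R_algebra) \<phi> V) (open_preimage (Proj R_algebra) \<phi> W) (\<psi> V s))"
    using iso unfolding isomorphic_over_C_def by blast
  interpret X_iso "{0..n}" a \<phi> \<psi>
  proof
    show "finite {0..n}" "{0..n} \<noteq> {}" by simp_all
    show "0 < a i" if "i \<in> {0..n}" for i using a that by simp
    show "homeomorphic_map (proj_topology R_algebra) (proj_topology ?S) \<phi>" using iso(1) by (simp add: Proj_def)
    show "\<psi> V \<in> algebra_iso (proj_sections ?S V) (proj_sections R_algebra (open_preimage (Proj R_algebra) \<phi> V))"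
      if "openin (proj_topology ?S) V" for V
      using iso(2) that by (simp add: Proj_def)
    show "\<psi> W (restrict s W) = restrict (\<psi> V s) (open_preimage (Proj R_algebra) \<phi> W)"
      if "openin (proj_topology ?S) V" "openin (proj_topology ?S) W" "W \<subseteq> V" "regular_section ?S V s" for V W s
    proof -
      have "s \<in> carrier (proj_sections ?S V)" using that(4) by (simp add: proj_sections_def)
      then show ?thesis using iso(3) that(1-3) by (simp add: Proj_def)
    qed
  qed
  show False by (rule no_isomorphism)
qed

end
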